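(* There exist strongly numerically hypercyclic operators on $B_2(H)$, $B_0(H)$ and $\tilde\ell_2(B_0(H))$ that are not C*-transitive. Furthermore, there exist strongly numerically hypercyclic operators on $\ell^2(\mathbb N)$ which are not topologically numerically transitive.
   Context: $H$ is a complex separable Hilbert space with an orthonormal basis $\{e_j\}_{j\in\mathbb Z}$; $B_0(H)$ is the C*-algebra of compact operators (operator norm), $B_2(H)$ the Hilbert–Schmidt operators (Hilbert–Schmidt norm), $B_1(H)$ the trace class operators (trace norm). $\tilde\ell_2(B_0(H))$ is the standard Hilbert module over $B_0(H)$: sequences $x=(x_j)_{j\in\mathbb N}$ in $B_0(H)$ with $\sum_j x_j^*x_j$ norm convergent, with norm $\|\sum_jx_j^*x_j\|^{1/2}$. In each case let $\varphi:X\times X\to\mathcal M$ be: $X=\mathcal M=B_0(H)$, $\varphi(A,B)=B^*A$; $X=B_2(H)$, $\mathcal M=B_1(H)$, $\varphi(A,B)=B^*A$; $X=\tilde\ell_2(B_0(H))$, $\mathcal M=B_0(H)$, $\varphi(x,y)=\sum_jy_j^*x_j$. With $S(X)$ the unit sphere, $T\in\mathcal B(X)$ is C*-transitive if for every nonempty open $W\subseteq S(X)\times S(X)$ and nonempty open $O\subseteq\mathcal M$ there exist $n\in\mathbb N$ and $(x,y)\in W$ with $\varphi(T^nx,y)\in O$. For a complex Banach space $X$, $\Pi(X):=\{(x,x^* )\in S_X\times S_{X^*}:x^*(x)=1\}$ with the topology induced by the norm $\max\{\|x\|,\|x^*\|\}$. $T\in\mathcal B(X)$ is numerically hypercyclic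 if there is $(x,x^* )\in\Pi(X)$ with $\{x^*(T^nx):n\ge0\}$ dense in $\mathbb C$; strongly numerically hypercyclic if every operator similar to $T$ is numerically hypercyclic; topologically numerically transitive if for every nonempty open $U\subset\Pi(X)$ and nonempty open $V\subset\mathbb C$ there exist $n\ge0$ and $(x,x^* )\in U$ with $x^*(T^nx)\in V$. *)

theory Defs
  imports "HOL-Analysis.Analysis" "HOL-Library.Function_Algebras" "HOL-Library.Nonpos_Ints"
begin

section \<open>Complex vector spaces and Hilbert spaces\<close>

class complex_vector = ab_group_add +
  fixes scaleC :: "complex \<Rightarrow> 'a \<Rightarrow> 'a" (infixr "*\<^sub>C" 75)
  assumes scaleC_add_right: "c *\<^sub>C (x + y) = c *\<^sub>C x + c *\<^sub>C y"
    and scaleC_add_left: "(c + d) *\<^sub>C x = c *\<^sub>C x + d *\<^sub>C x"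
    and scaleC_scaleC: "c *\<^sub>C d *\<^sub>C x = (c * d) *\<^sub>C x"
    and scaleC_one: "1 *\<^sub>C x = x"

instantiation complex :: complex_vector
begin
definition scaleC_complex :: "complex \<Rightarrow> complex \<Rightarrow> complex"
  where "scaleC_complex c x = c * x"
instance
  by standard (simp_all add: scaleC_complex_def algebra_simps)
end

instantiation "fun" :: (type, complex_vector) complex_vector
begin
definition scaleC_fun :: "complex \<Rightarrow> ('a \<Rightarrow> 'b) \<Rightarrow> 'a \<Rightarrow> 'b"
  where "scaleC_fun c f = (\<lambda>x. c *\<^sub>C f x)"
instance
  by standard
    (simp_all add: scaleC_fun_def plus_fun_def scaleC_add_right scaleC_add_left
      scaleC_scaleC scaleC_one)
end

text \<open>The inner product is linear in its first argument. Completeness and the metric come from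
  the class \<open>banach\<close>.\<close>

class chilbert_space = complex_vector + banach +
  fixes cinner :: "'a \<Rightarrow> 'a \<Rightarrow> complex"
  assumes scaleR_scaleC: "r *\<^sub>R x = complex_of_real r *\<^sub>C x"
    and cinner_commute: "cinner x y = cnj (cinner y x)"
    and cinner_add_left: "cinner (x + y) z = cinner x z + cinner y z"
    and cinner_scaleC_left: "cinner (c *\<^sub>C x) y = c * cinner x y"
    and norm_eq_sqrt_cinner: "norm x = sqrt (Re (cinner x x))"

definition orthonormal_basis :: "('i \<Rightarrow> 'h::chilbert_space) \<Rightarrow> bool"
  where "orthonormal_basis e \<longleftrightarrow>
    (\<forall>i j. cinner (e i) (e j) = (if i = j then 1 else 0)) \<and>
    (\<forall>x. ((\<lambda>j. cinner x (e j) *\<^sub>C e j) has_sum x) UNIV)"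


section \<open>Normed spaces of functions\<close>

text \<open>A normed space is a subspace of an ambient complex vector space (of operators, or of
  sequences), together with a norm. The function \<open>nrm\<close> is meaningful on the carrier only.\<close>

record 'x nspace =
  carr :: "'x set"
  nrm :: "'x \<Rightarrow> real"

definition unit_sphere :: "'x nspace \<Rightarrow> 'x set"
  where "unit_sphere X = {x \<in> carr X. nrm X x = 1}"

definition linear_on_carr :: "'x::complex_vector nspace \<Rightarrow> ('x \<Rightarrow> 'y::complex_vector) \<Rightarrow> bool"
  where "linear_on_carr X f \<longleftrightarrow>
    (\<forall>x\<in>carr X. \<forall>y\<in>carr X. f (x + y) = f x + f y) \<and>
    (\<forall>c. \<forall>x\<in>carr X. f (c *\<^sub>C x) = c *\<^sub>C f x)"

definition bounded_ops :: "'x::complex_vector nspace \<Rightarrow> ('x \<Rightarrow> 'x) set"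
  where "bounded_ops X = {T. T ` carr X \<subseteq> carr X \<and> linear_on_carr X T \<and>
    (\<exists>K. \<forall>x\<in>carr X. nrm X (T x) \<le> K * nrm X x)}"

text \<open>Functionals are normalised to vanish off the carrier, so that each element of the dual space
  is represented by exactly one function.\<close>

definition dual :: "'x::complex_vector nspace \<Rightarrow> ('x \<Rightarrow> complex) nspace"
  where "dual X = \<lparr>
    carr = {f. linear_on_carr X f \<and> (\<exists>K. \<forall>x\<in>carr X. cmod (f x) \<le> K * nrm X x) \<and>
      (\<forall>x. x \<notin> carr X \<longrightarrow> f x = 0)},
    nrm = (\<lambda>f. SUP x\<in>{x \<in> carr X. nrm X x \<le> 1}. cmod (f x)) \<rparr>"

definition open_wrt :: "'p set \<Rightarrow> ('p \<Rightarrow> 'p \<Rightarrow> real) \<Rightarrow> 'p set \<Rightarrow> bool"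
  where "open_wrt S d U \<longleftrightarrow> U \<subseteq> S \<and> (\<forall>p\<in>U. \<exists>\<epsilon>>0. \<forall>q\<in>S. d p q < \<epsilon> \<longrightarrow> q \<in> U)"

definition nrm_dist :: "'x::minus nspace \<Rightarrow> 'x \<Rightarrow> 'x \<Rightarrow> real"
  where "nrm_dist X x y = nrm X (x - y)"

definition max_dist ::
    "'x::minus nspace \<Rightarrow> 'y::minus nspace \<Rightarrow> 'x \<times> 'y \<Rightarrow> 'x \<times> 'y \<Rightarrow> real"
  where "max_dist X Y p q = max (nrm_dist X (fst p) (fst q)) (nrm_dist Y (snd p) (snd q))"

definition norm_sums :: "'x::ab_group_add nspace \<Rightarrow> (nat \<Rightarrow> 'x) \<Rightarrow> 'x \<Rightarrow> bool"
  where "norm_sums X f s \<longleftrightarrow>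
    s \<in> carr X \<and> (\<lambda>n. nrm X ((\<Sum>j<n. f j) - s)) \<longlonglongrightarrow> 0"


section \<open>Spaces of operators\<close>

definition bounded_clinear :: "('h::chilbert_space \<Rightarrow> 'h) \<Rightarrow> bool"
  where "bounded_clinear A \<longleftrightarrow> bounded_linear A \<and> (\<forall>c x. A (c *\<^sub>C x) = c *\<^sub>C A x)"

definition adj :: "('h::chilbert_space \<Rightarrow> 'h) \<Rightarrow> 'h \<Rightarrow> 'h"
  where "adj A = (THE B. \<forall>x y. cinner (A x) y = cinner x (B y))"

definition positive_op :: "('h::chilbert_space \<Rightarrow> 'h) \<Rightarrow> bool"
  where "positive_op P \<longleftrightarrow> bounded_clinear P \<and> (\<forall>x. cinner (P x) x \<in> \<real>\<^sub>\<ge>\<^sub>0)"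

definition abs_op :: "('h::chilbert_space \<Rightarrow> 'h) \<Rightarrow> 'h \<Rightarrow> 'h"
  where "abs_op A = (THE P. positive_op P \<and> P \<circ> P = adj A \<circ> A)"

definition B0 :: "('h::chilbert_space \<Rightarrow> 'h) nspace"
  where "B0 = \<lparr>
    carr = {A. bounded_clinear A \<and> compact (closure (A ` cball 0 1))},
    nrm = onorm \<rparr>"

text \<open>The Hilbert--Schmidt and the trace norm are computed in a given orthonormal basis \<open>e\<close>;
  their values do not depend on it.\<close>

definition B2 :: "(int \<Rightarrow> 'h::chilbert_space) \<Rightarrow> ('h \<Rightarrow> 'h) nspace"
  where "B2 e = \<lparr>
    carr = {A. bounded_clinear A \<and> (\<lambda>j. (norm (A (e j)))\<^sup>2) summable_on UNIV},
    nrm = (\<lambda>A. sqrt (\<Sum>\<^sub>\<infinity>j. (norm (A (e j)))\<^sup>2)) \<rparr>"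

definition B1 :: "(int \<Rightarrow> 'h::chilbert_space) \<Rightarrow> ('h \<Rightarrow> 'h) nspace"
  where "B1 e = \<lparr>
    carr = {A. bounded_clinear A \<and> (\<lambda>j. Re (cinner (abs_op A (e j)) (e j))) summable_on UNIV},
    nrm = (\<lambda>A. \<Sum>\<^sub>\<infinity>j. Re (cinner (abs_op A (e j)) (e j))) \<rparr>"

definition op_form :: "('h::chilbert_space \<Rightarrow> 'h) \<Rightarrow> ('h \<Rightarrow> 'h) \<Rightarrow> 'h \<Rightarrow> 'h"
  where "op_form A B = adj B \<circ> A"

definition module_form :: "(nat \<Rightarrow> 'h::chilbert_space \<Rightarrow> 'h) \<Rightarrow> (nat \<Rightarrow> 'h \<Rightarrow> 'h) \<Rightarrow> 'h \<Rightarrow> 'h"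
  where "module_form x y = (THE S. norm_sums B0 (\<lambda>j. adj (y j) \<circ> x j) S)"

definition l2_module :: "(nat \<Rightarrow> 'h::chilbert_space \<Rightarrow> 'h) nspace"
  where "l2_module = \<lparr>
    carr = {x. (\<forall>j. x j \<in> carr B0) \<and> (\<exists>S. norm_sums B0 (\<lambda>j. adj (x j) \<circ> x j) S)},
    nrm = (\<lambda>x. sqrt (nrm B0 (module_form x x))) \<rparr>"

definition ell2 :: "(nat \<Rightarrow> complex) nspace"
  where "ell2 = \<lparr>
    carr = {x. summable (\<lambda>n. (cmod (x n))\<^sup>2)},
    nrm = (\<lambda>x. sqrt (\<Sum>n. (cmod (x n))\<^sup>2)) \<rparr>"


section \<open>Dynamical properties\<close>

definition Cstar_transitive ::
    "'x::complex_vector nspace \<Rightarrow> 'm::complex_vector nspace \<Rightarrow> ('x \<Rightarrow> 'x \<Rightarrow> 'm)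
      \<Rightarrow> ('x \<Rightarrow> 'x) \<Rightarrow> bool"
  where "Cstar_transitive X M \<phi> T \<longleftrightarrow>
    (\<forall>W V. open_wrt (unit_sphere X \<times> unit_sphere X) (max_dist X X) W \<and> W \<noteq> {} \<and>
        open_wrt (carr M) (nrm_dist M) V \<and> V \<noteq> {} \<longrightarrow>
      (\<exists>n. \<exists>(x, y)\<in>W. \<phi> ((T ^^ n) x) y \<in> V))"

definition num_states :: "'x::complex_vector nspace \<Rightarrow> ('x \<times> ('x \<Rightarrow> complex)) set"
  where "num_states X = {(x, f). x \<in> unit_sphere X \<and> f \<in> unit_sphere (dual X) \<and> f x = 1}"

definition numerically_hypercyclic :: "'x::complex_vector nspace \<Rightarrow> ('x \<Rightarrow> 'x) \<Rightarrow> bool"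
  where "numerically_hypercyclic X T \<longleftrightarrow>
    (\<exists>(x, f)\<in>num_states X. closure (range (\<lambda>n. f ((T ^^ n) x))) = UNIV)"

definition similar_ops :: "'x::complex_vector nspace \<Rightarrow> ('x \<Rightarrow> 'x) \<Rightarrow> ('x \<Rightarrow> 'x) \<Rightarrow> bool"
  where "similar_ops X S T \<longleftrightarrow>
    (\<exists>A\<in>bounded_ops X. \<exists>B\<in>bounded_ops X.
      (\<forall>x\<in>carr X. A (B x) = x \<and> B (A x) = x) \<and> (\<forall>x\<in>carr X. S x = B (T (A x))))"

definition strongly_numerically_hypercyclic ::
    "'x::complex_vector nspace \<Rightarrow> ('x \<Rightarrow> 'x) \<Rightarrow> bool"
  where "strongly_numerically_hypercyclic X T \<longleftrightarrow>
    (\<forall>S\<in>bounded_ops X. similar_ops X S T \<longrightarrow> numerically_hypercyclic X S)"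

definition topologically_numerically_transitive ::
    "'x::complex_vector nspace \<Rightarrow> ('x \<Rightarrow> 'x) \<Rightarrow> bool"
  where "topologically_numerically_transitive X T \<longleftrightarrow>
    (\<forall>U V. open_wrt (num_states X) (max_dist X (dual X)) U \<and> U \<noteq> {} \<and> open V \<and> V \<noteq> {} \<longrightarrow>
      (\<exists>n. \<exists>(x, f)\<in>U. f ((T ^^ n) x) \<in> V))"

end

theory Submission
  imports Defs
begin

text \<open>An operator \<open>T\<close> with a vector \<open>x\<^sub>0 \<noteq> 0\<close> whose orbit approximates every multiple of \<open>x\<^sub>0\<close> is strongly
  numerically hypercyclic: the property passes to similar operators, and a norming functional of
  \<open>x\<^sub>0\<close> turns the orbit into a dense subset of the plane. Such vectors exist for multiples \<open>R\<close> of the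
  backward shift on \<open>H\<close>.

  On the spaces of operators take \<open>T A = \<langle>\<cdot>, e\<^sub>0\<rangle> R (A e\<^sub>0)\<close>, acting on the coordinate \<open>0\<close> only in the
  Hilbert module. All values \<open>\<phi>(T\<^sup>n x, y)\<close> with \<open>n \<ge> 1\<close> annihilate \<open>e\<^sub>1\<close>, and for \<open>n = 0\<close> they have norm
  at most \<open>1\<close>, so they miss the set of all \<open>A\<close> with \<open>\<bar>\<langle>A e\<^sub>1, e\<^sub>1\<rangle>\<bar> > 2\<close>. That this set is open in the
  trace norm requires that the trace class is closed under differences.

  On \<open>\<ell>\<^sup>2\<close> add to \<open>R\<close> an eigenvector whose eigenvalue exceeds the norm of \<open>R\<close>. Near the corresponding
  state the numerical orbits stay away from \<open>0\<close>.\<close>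

subsection \<open>Inner products\<close>

text \<open>Cutting an operator down to its column at \<open>e 0\<close> keeps a copy of the Hilbert
  space on which \<open>T\<close> acts as \<open>R\<close>, and at the same time makes every image
  vanish at \<open>e 1\<close>. Recurrence towards multiples of a single vector suffices because a
  norming functional reads off just one scalar; such a vector can be written down explicitly, with
  coefficients that repeat themselves along the powers of two. Norming functionals are explicit. On
  spaces of Hilbert type they are inner products; on the compact operators and on the module they
  come from a unit vector at which a compact operator attains its norm. The main obstacle is the
  trace norm. It is an infinite sum that is meaningful on the carrier only, so a small distance from
  \<open>A\<close> to \<open>B\<close> says something only once \<open>A - B\<close> is known to be
  of trace class. The usual argument for this uses the polar decomposition; here it is replaced by
  operators of norm at most \<open>2\<close>, which only worsens constants. Square roots of positive
  operators, with uniqueness, are built because the absolute value is a definite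
  description.\<close>

lemma cinner_add_right: "cinner x (y + z) = cinner x y + cinner (x::'h::chilbert_space) z"
  by (metis cinner_commute cinner_add_left complex_cnj_add)

lemma cinner_scaleC_right: "cinner x (c *\<^sub>C y) = cnj c * cinner (x::'h::chilbert_space) y"
  by (metis cinner_commute cinner_scaleC_left complex_cnj_mult)

lemma cinner_scaleR_left: "cinner (r *\<^sub>R x) y = r *\<^sub>R cinner (x::'h::chilbert_space) y"
  by (simp add: scaleR_scaleC cinner_scaleC_left scaleR_conv_of_real)

lemma cinner_scaleR_right: "cinner x (r *\<^sub>R y) = r *\<^sub>R cinner (x::'h::chilbert_space) y"
  by (simp add: scaleR_scaleC cinner_scaleC_right scaleR_conv_of_real)

lemma cinner_zero_left [simp]: "cinner 0 (y::'h::chilbert_space) = 0"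
  by (metis add_cancel_right_left cinner_add_left)

lemma cinner_zero_right [simp]: "cinner (y::'h::chilbert_space) 0 = 0"
  by (metis add_cancel_right_left cinner_add_right)

lemma cinner_minus_left: "cinner (- x) (y::'h::chilbert_space) = - cinner x y"
  by (metis cinner_add_left cinner_zero_left add.right_inverse add_eq_0_iff)

lemma cinner_minus_right: "cinner (x::'h::chilbert_space) (- y) = - cinner x y"
  by (metis cinner_add_right cinner_zero_right add.right_inverse add_eq_0_iff)

lemma cinner_diff_left: "cinner (x - z) (y::'h::chilbert_space) = cinner x y - cinner z y"
  by (metis cinner_add_left cinner_minus_left diff_conv_add_uminus)

lemma cinner_diff_right: "cinner (x::'h::chilbert_space) (y - z) = cinner x y - cinner x z"
  by (metis cinner_add_right cinner_minus_right diff_conv_add_uminus)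

lemma cinner_sum_left: "cinner (\<Sum>i\<in>F. f i) (y::'h::chilbert_space) = (\<Sum>i\<in>F. cinner (f i) y)"
  by (induction F rule: infinite_finite_induct) (auto simp: cinner_add_left)

lemma cinner_sum_right: "cinner (y::'h::chilbert_space) (\<Sum>i\<in>F. f i) = (\<Sum>i\<in>F. cinner y (f i))"
  by (induction F rule: infinite_finite_induct) (auto simp: cinner_add_right)

lemma Im_cinner_self [simp]: "Im (cinner x (x::'h::chilbert_space)) = 0"
proof -
  have "Im (cinner x x) = - Im (cinner x x)"
    by (metis cinner_commute cnj.simps(2))
  then show ?thesis by simp
qed

text \<open>The class does not postulate that \<open>cinner x x\<close> is nonnegative. It follows
  because norms are nonnegative and the real \<open>sqrt\<close> takes negative values at negative
  numbers.\<close>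

lemma norm_sq_Re_cinner: "(norm (x::'h::chilbert_space))\<^sup>2 = Re (cinner x x)"
proof -
  have "0 \<le> Re (cinner x x)"
    using norm_ge_zero[of x] unfolding norm_eq_sqrt_cinner[of x] by simp
  then show ?thesis by (simp add: norm_eq_sqrt_cinner)
qed

lemma cinner_self: "cinner x x = complex_of_real ((norm (x::'h::chilbert_space))\<^sup>2)"
  by (simp add: complex_eq_iff norm_sq_Re_cinner)

lemma norm_scaleC: "norm (c *\<^sub>C (x::'h::chilbert_space)) = cmod c * norm x"
proof -
  have "(norm (c *\<^sub>C x))\<^sup>2 = Re ((c * cnj c) * cinner x x)"
    by (simp add: norm_sq_Re_cinner cinner_scaleC_left cinner_scaleC_right mult.assoc)
  also have "\<dots> = (cmod c * norm x)\<^sup>2"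
    by (simp add: cinner_self power_mult_distrib flip: complex_norm_square of_real_power)
  finally show ?thesis by (simp add: power2_eq_iff_nonneg)
qed

lemma scaleC_zero_right [simp]: "c *\<^sub>C (0::'a::complex_vector) = 0"
  by (metis add_cancel_right_left scaleC_add_right)

lemma scaleC_zero_left [simp]: "0 *\<^sub>C (x::'a::complex_vector) = 0"
  by (metis add_cancel_right_left scaleC_add_left)

lemma scaleC_minus_right: "c *\<^sub>C (- x) = - (c *\<^sub>C (x::'a::complex_vector))"
  by (metis add.right_inverse add_eq_0_iff scaleC_add_right scaleC_zero_right)

lemma scaleC_minus_left: "(- c) *\<^sub>C x = - (c *\<^sub>C (x::'a::complex_vector))"
  by (metis add.right_inverse add_eq_0_iff scaleC_add_left scaleC_zero_left)

lemma scaleC_diff_right: "c *\<^sub>C (x - y) = c *\<^sub>C x - c *\<^sub>C (y::'a::complex_vector)"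
  by (metis diff_conv_add_uminus scaleC_add_right scaleC_minus_right)

lemma scaleC_minus_one: "(- 1) *\<^sub>C x = - (x::'a::complex_vector)"
  by (simp add: scaleC_minus_left scaleC_one)

lemma norm_diff_sq:
  "(norm (x - y))\<^sup>2 = (norm x)\<^sup>2 - 2 * Re (cinner x y) + (norm (y::'h::chilbert_space))\<^sup>2"
  using cinner_commute[of y x] by (simp add: norm_sq_Re_cinner cinner_diff_left cinner_diff_right)

text \<open>The proof expands \<open>\<parallel>s x - c y\<parallel>\<^sup>2 \<ge> 0\<close> for \<open>c = \<langle>x, y\<rangle>\<close> and \<open>s = \<parallel>y\<parallel>\<^sup>2\<close>.\<close>

lemma cinner_Cauchy_Schwarz: "cmod (cinner x y) \<le> norm x * norm (y::'h::chilbert_space)"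
proof (cases "y = 0")
  case False
  define s where "s = (norm y)\<^sup>2"
  define c where "c = cinner x y"
  have s: "s > 0" using False by (simp add: s_def)
  have yx: "cinner y x = cnj c" using cinner_commute[of y x] by (simp add: c_def)
  have cc: "c * cnj c = complex_of_real ((cmod c)\<^sup>2)" by (rule complex_norm_square[symmetric])
  let ?z = "complex_of_real s *\<^sub>C x - c *\<^sub>C y"
  have "cinner ?z ?z = of_real s * of_real s * of_real ((norm x)\<^sup>2) - of_real s * (c * cnj c)
      - of_real s * (c * cnj c) + (c * cnj c) * of_real s"
    by (simp add: cinner_diff_left cinner_diff_right cinner_scaleC_left cinner_scaleC_right
        cinner_self[of x] cinner_self[of y] yx algebra_simps flip: c_def s_def)
  also have "\<dots> = complex_of_real (s * (s * (norm x)\<^sup>2 - (cmod c)\<^sup>2))"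
    unfolding cc by (simp add: algebra_simps)
  finally have "0 \<le> s * (s * (norm x)\<^sup>2 - (cmod c)\<^sup>2)"
    using norm_sq_Re_cinner[of ?z] by (metis Re_complex_of_real zero_le_power2)
  then have "(cmod c)\<^sup>2 \<le> (norm x * norm y)\<^sup>2"
    using s by (simp add: zero_le_mult_iff s_def power_mult_distrib mult.commute)
  then show ?thesis unfolding c_def by (simp add: power2_le_iff_abs_le)
qed simp

text \<open>Over the reals conjugate linearity is linearity, so the theory of bounded bilinear maps
  supplies continuity and the exchange with sums.\<close>

lemma bounded_bilinear_cinner: "bounded_bilinear (cinner :: 'h::chilbert_space \<Rightarrow> 'h \<Rightarrow> complex)"
  by standard
    (auto simp: cinner_add_left cinner_add_right cinner_scaleR_left cinner_scaleR_right
      intro!: exI[of _ 1] cinner_Cauchy_Schwarz)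

lemmas tendsto_cinner = bounded_bilinear.tendsto[OF bounded_bilinear_cinner]

lemma bounded_bilinear_scaleC: "bounded_bilinear (scaleC :: complex \<Rightarrow> 'h::chilbert_space \<Rightarrow> 'h)"
  by standard
    (auto simp: scaleC_add_left scaleC_add_right scaleR_scaleC scaleC_scaleC norm_scaleC
      scaleR_conv_of_real mult.commute intro!: exI[of _ 1])

lemmas tendsto_scaleC = bounded_bilinear.tendsto[OF bounded_bilinear_scaleC]

lemma cinner_ext:
  assumes "\<And>y. cinner x y = cinner x' (y::'h::chilbert_space)"
  shows "x = x'"
proof -
  have "cinner (x - x') (x - x') = 0" using assms by (simp add: cinner_diff_left)
  then show ?thesis by (simp add: cinner_self)
qed

lemma cinner_ext_right:
  assumes "\<And>y. cinner y x = cinner y (x'::'h::chilbert_space)"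
  shows "x = x'"
  using assms by (metis cinner_commute cinner_ext)

subsection \<open>Bounded operators\<close>

lemma bounded_clinearI:
  assumes "\<And>x y. A (x + y) = A x + A y" "\<And>c x. A (c *\<^sub>C x) = c *\<^sub>C A x"
    "\<And>x. norm (A x) \<le> K * norm (x::'h::chilbert_space)"
  shows "bounded_clinear A"
  unfolding bounded_clinear_def
  using assms by (auto intro!: bounded_linear_intro[where K = K] simp: scaleR_scaleC mult.commute)

lemma bounded_clinearD:
  assumes "bounded_clinear A"
  shows "bounded_linear A" "A (x + y) = A x + A y" "A (x - y) = A x - A y" "A (c *\<^sub>C x) = c *\<^sub>C A x"
    "A 0 = 0" "A (- x) = - A x" "A (\<Sum>i\<in>F. f i) = (\<Sum>i\<in>F. A (f i))"
    "norm (A x) \<le> onorm A * norm x"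
proof -
  show bl: "bounded_linear A" using assms by (simp add: bounded_clinear_def)
  interpret bounded_linear A by fact
  show "A (x + y) = A x + A y" "A (x - y) = A x - A y" "A 0 = 0" "A (- x) = - A x"
    "A (\<Sum>i\<in>F. f i) = (\<Sum>i\<in>F. A (f i))"
    by (simp_all add: add diff zero neg sum)
  show "A (c *\<^sub>C x) = c *\<^sub>C A x" using assms by (simp add: bounded_clinear_def)
  show "norm (A x) \<le> onorm A * norm x" using bl by (rule onorm)
qed

lemmas bounded_clinear_simps = bounded_clinearD(2-7)

lemma bounded_clinear_id: "bounded_clinear (\<lambda>x. x)"
  by (rule bounded_clinearI[where K = 1]) auto

lemma bounded_clinear_zero: "bounded_clinear (\<lambda>x. 0)"
  by (rule bounded_clinearI[where K = 1]) auto

lemma bounded_clinear_compose: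
  "bounded_clinear A \<Longrightarrow> bounded_clinear B \<Longrightarrow> bounded_clinear (\<lambda>x. A (B x))"
  unfolding bounded_clinear_def by (auto intro: bounded_linear_compose)

lemma bounded_clinear_add:
  "bounded_clinear A \<Longrightarrow> bounded_clinear B \<Longrightarrow> bounded_clinear (\<lambda>x. A x + B x)"
  unfolding bounded_clinear_def by (auto intro: bounded_linear_add simp: scaleC_add_right)

lemma bounded_clinear_diff:
  "bounded_clinear A \<Longrightarrow> bounded_clinear B \<Longrightarrow> bounded_clinear (\<lambda>x. A x - B x)"
  unfolding bounded_clinear_def by (auto intro: bounded_linear_sub simp: scaleC_diff_right)

lemma bounded_clinear_scaleC: "bounded_clinear A \<Longrightarrow> bounded_clinear (\<lambda>x. c *\<^sub>C A x)"
  by (rule bounded_clinearI[where K = "cmod c * onorm A"])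
    (auto simp: bounded_clinear_simps scaleC_add_right scaleC_scaleC norm_scaleC mult.commute[of c]
      mult.assoc intro!: mult_left_mono bounded_clinearD(8))

lemma bounded_clinear_sum:
  "(\<And>i. i \<in> F \<Longrightarrow> bounded_clinear (A i)) \<Longrightarrow> bounded_clinear (\<lambda>x. \<Sum>i\<in>F. A i x)"
  by (induction F rule: infinite_finite_induct) (auto intro: bounded_clinear_zero bounded_clinear_add)

lemma bounded_clinear_funpow: "bounded_clinear A \<Longrightarrow> bounded_clinear (A ^^ n)"
proof (induction n)
  case 0 then show ?case using bounded_clinear_id by (simp add: id_def)
next
  case (Suc n) then show ?case by (simp add: comp_def bounded_clinear_compose)
qed

lemmas bounded_clinear_intros = bounded_clinear_id bounded_clinear_zero
  bounded_clinear_add bounded_clinear_diff bounded_clinear_scaleC bounded_clinear_sum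
  bounded_clinear_funpow

definition rank_one :: "'h::chilbert_space \<Rightarrow> 'h \<Rightarrow> 'h \<Rightarrow> 'h"
  where "rank_one u v = (\<lambda>h. cinner h u *\<^sub>C v)"

lemma bounded_clinear_rank_one: "bounded_clinear (rank_one u v)"
proof (rule bounded_clinearI[where K = "norm u * norm v"])
  show "norm (rank_one u v x) \<le> norm u * norm v * norm x" for x
    using mult_right_mono[OF cinner_Cauchy_Schwarz[of x u] norm_ge_zero[of v]]
    by (simp add: rank_one_def norm_scaleC mult_ac)
qed (auto simp: rank_one_def cinner_add_left scaleC_add_left cinner_scaleC_left scaleC_scaleC)

lemma onorm_nonneg: "bounded_clinear A \<Longrightarrow> 0 \<le> onorm A"
  by (simp add: bounded_clinearD(1) onorm_pos_le)

subsection \<open>Orthonormal bases\<close>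

locale orthonormal =
  fixes e :: "int \<Rightarrow> 'h::chilbert_space"
  assumes basis: "orthonormal_basis e"
begin

lemma cinner_e: "cinner (e i) (e j) = (if i = j then 1 else 0)"
  using basis by (auto simp: orthonormal_basis_def)

lemma norm_e [simp]: "norm (e i) = 1"
  by (simp add: norm_eq_sqrt_cinner cinner_e)

lemma expansion: "((\<lambda>j. cinner x (e j) *\<^sub>C e j) has_sum x) UNIV"
  using basis by (auto simp: orthonormal_basis_def)

lemma cinner_sum_e:
  assumes "finite F"
  shows "cinner (\<Sum>j\<in>F. a j *\<^sub>C e j) (\<Sum>j\<in>F. b j *\<^sub>C e j) = (\<Sum>j\<in>F. a j * cnj (b j))"
  using assms
  by (simp add: cinner_sum_left cinner_sum_right cinner_scaleC_left cinner_scaleC_right cinner_e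
      if_distrib sum.delta mult.commute cong: if_cong)

lemma norm_sum_e:
  assumes "finite F"
  shows "(norm (\<Sum>j\<in>F. a j *\<^sub>C e j))\<^sup>2 = (\<Sum>j\<in>F. (cmod (a j))\<^sup>2)"
  unfolding norm_sq_Re_cinner cinner_sum_e[OF assms]
  by (simp add: flip: complex_norm_square of_real_power)

lemma has_sum_cinner:
  "((\<lambda>j. cinner x (e j) * cnj (cinner y (e j))) has_sum cinner x y) UNIV"
proof -
  have "bounded_linear (\<lambda>z. cinner z y)"
    using bounded_bilinear.bounded_linear_left[OF bounded_bilinear_cinner] .
  from has_sum_bounded_linear[OF this expansion[of x]] show ?thesis
    by (simp add: cinner_scaleC_left flip: cinner_commute)
qed

lemma Parseval: "((\<lambda>j. (cmod (cinner x (e j)))\<^sup>2) has_sum (norm x)\<^sup>2) UNIV"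
  using has_sum_Re[OF has_sum_cinner[of x x]]
  by (simp add: norm_sq_Re_cinner[of x] flip: complex_norm_square of_real_power)

lemma Bessel:
  assumes "finite F" shows "(\<Sum>j\<in>F. (cmod (cinner x (e j)))\<^sup>2) \<le> (norm x)\<^sup>2"
  by (rule finite_sum_le_has_sum[OF Parseval assms]) auto

text \<open>By orthonormality the squared distance of two nested partial sums is a difference of
  partial sums of the squares, so the Cauchy property passes from the squares to the
  vectors.\<close>

lemma Riesz_Fischer:
  assumes "(\<lambda>j. (cmod (a j))\<^sup>2) summable_on UNIV"
  shows "(\<lambda>j. a j *\<^sub>C e j) summable_on UNIV"
proof -
  let ?f = "\<lambda>j. a j *\<^sub>C e j" and ?g = "\<lambda>j. (cmod (a j))\<^sup>2"
  obtain L where "(sum ?g \<longlongrightarrow> L) (finite_subsets_at_top UNIV)"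
    using assms by (auto simp: summable_on_def has_sum_def)
  then have *: "cauchy_filter (filtermap (sum ?g) (finite_subsets_at_top UNIV))"
    by (auto intro!: nhds_imp_cauchy_filter simp: filterlim_def)
  have "\<exists>P. eventually P (finite_subsets_at_top UNIV) \<and>
      (\<forall>F F'. P F \<and> P F' \<longrightarrow> dist (sum ?f F) (sum ?f F') < \<epsilon>)" if "\<epsilon> > 0" for \<epsilon>
  proof -
    define d where "d = (\<epsilon>/2)\<^sup>2"
    have d: "d > 0" using that by (simp add: d_def)
    obtain P where ev: "eventually P (finite_subsets_at_top UNIV)"
      and P: "\<And>F F'. P F \<Longrightarrow> P F' \<Longrightarrow> dist (sum ?g F) (sum ?g F') < d"
      using * d unfolding cauchy_filter_metric_filtermap by metis
    from ev obtain M where M: "finite M" "\<And>F. finite F \<Longrightarrow> M \<subseteq> F \<Longrightarrow> P F"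
      unfolding eventually_finite_subsets_at_top by auto
    \<comment> \<open>Two finite sets need not be nested, so both are compared with their common
      subset \<open>M\<close>.\<close>
    have near: "norm (sum ?f F - sum ?f M) < \<epsilon>/2" if "finite F" "M \<subseteq> F" for F
    proof -
      have "(norm (sum ?f F - sum ?f M))\<^sup>2 = (norm (sum ?f (F - M)))\<^sup>2"
        using that M(1) by (simp add: sum_diff)
      also have "\<dots> = sum ?g F - sum ?g M"
        using that M(1) by (subst norm_sum_e) (simp_all add: sum_diff)
      also have "\<dots> < d"
        using P[OF M(2)[OF that] M(2)[OF M(1)]] by (simp add: dist_real_def)
      finally show ?thesis
        unfolding d_def by (rule power2_less_imp_less) (use \<open>\<epsilon> > 0\<close> in auto)
    qed
    show ?thesis
    proof (intro exI conjI allI impI)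
      show "eventually (\<lambda>F. finite F \<and> M \<subseteq> F) (finite_subsets_at_top UNIV)"
        unfolding eventually_finite_subsets_at_top using M(1) by auto
      fix F F' assume "(finite F \<and> M \<subseteq> F) \<and> (finite F' \<and> M \<subseteq> F')"
      then show "dist (sum ?f F) (sum ?f F') < \<epsilon>"
        using near[of F] near[of F'] norm_triangle_ineq4[of "sum ?f F - sum ?f M" "sum ?f F' - sum ?f M"]
        by (simp add: dist_norm)
    qed
  qed
  then have "cauchy_filter (filtermap (sum ?f) (finite_subsets_at_top UNIV))"
    by (simp add: cauchy_filter_metric_filtermap)
  moreover have "complete (UNIV::'h set)"
    by (meson Cauchy_convergent UNIV_I complete_def convergent_def)
  ultimately obtain L where "(sum ?f \<longlongrightarrow> L) (finite_subsets_at_top UNIV)"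
    using complete_uniform[where S=UNIV] by (force simp add: filterlim_def)
  then show ?thesis by (auto simp: summable_on_def has_sum_def)
qed

lemma cinner_has_sum_e:
  assumes "((\<lambda>j. a j *\<^sub>C e j) has_sum s) UNIV"
  shows "cinner s (e i) = a i"
proof -
  have "bounded_linear (\<lambda>z. cinner z (e i))"
    using bounded_bilinear.bounded_linear_left[OF bounded_bilinear_cinner] .
  from has_sum_bounded_linear[OF this assms]
  have "((\<lambda>j. if j = i then a i else 0) has_sum cinner s (e i)) UNIV"
    by (simp add: cinner_scaleC_left cinner_e if_distrib cong: if_cong)
  moreover have "((\<lambda>j. if j = i then a i else 0) has_sum a i) UNIV"
    by (rule has_sum_finite_neutralI[where B = "{i}"]) auto
  ultimately show ?thesis using has_sum_unique by blast
qed

text \<open>Vectors are constructed from their coefficients: the values of adjoints, the operator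
  \<open>R\<close> and its recurrent vector \<open>g\<close> all come from here.\<close>

lemma ex_coefficients:
  assumes "\<And>F. finite F \<Longrightarrow> (\<Sum>j\<in>F. (cmod (a j))\<^sup>2) \<le> K"
  obtains s where "\<And>i. cinner s (e i) = a i" "(norm s)\<^sup>2 \<le> K"
proof -
  have "(\<lambda>j. (cmod (a j))\<^sup>2) summable_on UNIV"
    by (rule nonneg_bdd_above_summable_on) (use assms in \<open>auto intro!: bdd_aboveI[where M = K]\<close>)
  from Riesz_Fischer[OF this] obtain s where "((\<lambda>j. a j *\<^sub>C e j) has_sum s) UNIV"
    by (auto simp: summable_on_def)
  then have s: "cinner s (e i) = a i" for i by (rule cinner_has_sum_e)
  have "(norm s)\<^sup>2 \<le> K"
    using has_sum_le_finite_sums[OF Parseval[of s]] assms by (simp add: s)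
  with s show ?thesis using that by blast
qed

lemma ext_e:
  assumes "\<And>i. cinner x (e i) = cinner y (e i)"
  shows "x = y"
  using expansion[of x] expansion[of y] assms has_sum_unique by fastforce

subsection \<open>Adjoints\<close>

text \<open>The only candidate has the coefficients \<open>cinner y (A (e j))\<close>. Their square
  sum over \<open>F\<close> is the squared norm of the vector \<open>z\<close> with these
  coefficients, and it equals \<open>cinner y (A z)\<close>. This is at most a constant times
  \<open>norm z\<close>, so one factor cancels.\<close>

lemma ex_adjoint:
  assumes A: "bounded_clinear (A :: 'h \<Rightarrow> 'h)"
  shows "\<exists>b. \<forall>x. cinner (A x) y = cinner x b"
proof -
  define a where "a j = cinner y (A (e j))" for j
  let ?K = "(norm y * onorm A)\<^sup>2"
  have "(\<Sum>j\<in>F. (cmod (a j))\<^sup>2) \<le> ?K" if F: "finite F" for F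
  proof -
    define z where "z = (\<Sum>j\<in>F. a j *\<^sub>C e j)"
    have "cinner y (A z) = (\<Sum>j\<in>F. cnj (a j) * a j)"
      unfolding z_def bounded_clinear_simps[OF A] cinner_sum_right cinner_scaleC_right
      by (simp add: a_def bounded_clinear_simps[OF A] cinner_scaleC_right)
    also have "\<dots> = of_real (\<Sum>j\<in>F. (cmod (a j))\<^sup>2)"
      by (simp add: mult.commute[of "cnj _"] flip: complex_norm_square of_real_power)
    finally have "(norm z)\<^sup>2 = Re (cinner y (A z))"
      unfolding z_def norm_sum_e[OF F] by simp
    also have "\<dots> \<le> norm y * norm (A z)"
      using cinner_Cauchy_Schwarz complex_Re_le_cmod order_trans by blast
    also have "\<dots> \<le> norm y * (onorm A * norm z)"
      by (intro mult_left_mono bounded_clinearD(8)[OF A]) auto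
    finally have "norm z * norm z \<le> (norm y * onorm A) * norm z"
      by (simp add: power2_eq_square mult.assoc)
    then have "norm z \<le> norm y * onorm A"
      using onorm_nonneg[OF A] by (cases "norm z = 0") (auto simp: mult_le_cancel_right)
    then have "(norm z)\<^sup>2 \<le> ?K" by (intro power_mono) auto
    then show ?thesis unfolding z_def norm_sum_e[OF F] .
  qed
  from ex_coefficients[OF this] obtain b where b: "\<And>i. cinner b (e i) = a i" by metis
  have "cinner (A x) y = cinner x b" for x
  proof -
    have "bounded_linear (\<lambda>z. cinner (A z) y)"
      by (rule bounded_linear_compose[OF bounded_bilinear.bounded_linear_left[OF bounded_bilinear_cinner]
            bounded_clinearD(1)[OF A]])
    from has_sum_bounded_linear[OF this expansion[of x]]
    have "((\<lambda>j. cinner x (e j) * cnj (cinner b (e j))) has_sum cinner (A x) y) UNIV"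
      by (simp add: bounded_clinear_simps[OF A] cinner_scaleC_left b a_def flip: cinner_commute)
    then show ?thesis using has_sum_cinner has_sum_unique by blast
  qed
  then show ?thesis by blast
qed

lemma adj_eqI:
  assumes "\<And>x y. cinner (A x) y = cinner x (B (y::'h))"
  shows "adj A = B"
  unfolding adj_def
proof (rule the_equality)
  fix B' assume "\<forall>x y. cinner (A x) y = cinner x (B' y)"
  then have "cinner x (B' y) = cinner x (B y)" for x y using assms by metis
  then show "B' = B" using cinner_ext_right by blast
qed (use assms in auto)

lemma adj:
  assumes "bounded_clinear A"
  shows "cinner (A x) y = cinner x (adj A (y::'h))"
proof -
  obtain B where B: "\<And>y x. cinner (A x) y = cinner x (B y)"
    using ex_adjoint[OF assms] by metis
  then have "adj A = B" by (intro adj_eqI) auto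
  then show ?thesis using B by simp
qed

lemma adj': 
  assumes "bounded_clinear A"
  shows "cinner (adj A x) (y::'h) = cinner x (A y)"
  by (metis adj[OF assms] cinner_commute)

text \<open>The squared norm of \<open>adj A x\<close> is \<open>cinner (A (adj A x)) x\<close>,
  which contains one factor \<open>norm (adj A x)\<close> to cancel. A general \<open>K\<close> lets
  explicit bounds, such as the \<open>2\<close> of the polar approximants, pass to adjoints.\<close>

lemma norm_adj_le:
  assumes "bounded_clinear A" "\<And>x. norm (A x) \<le> K * norm x" "0 \<le> K"
  shows "norm (adj A (x::'h)) \<le> K * norm x"
proof (cases "adj A x = 0")
  case False
  have "(norm (adj A x))\<^sup>2 = Re (cinner (A (adj A x)) x)"
    by (simp add: norm_sq_Re_cinner adj[OF assms(1)])
  also have "\<dots> \<le> norm (A (adj A x)) * norm x"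
    using cinner_Cauchy_Schwarz complex_Re_le_cmod order_trans by blast
  also have "\<dots> \<le> K * norm (adj A x) * norm x"
    using assms(2) by (intro mult_right_mono) auto
  finally have "norm (adj A x) * norm (adj A x) \<le> (K * norm x) * norm (adj A x)"
    by (simp add: power2_eq_square algebra_simps)
  then show ?thesis using False by (simp add: mult_le_cancel_right)
qed (use assms in auto)

lemma bounded_clinear_adj:
  assumes A: "bounded_clinear A"
  shows "bounded_clinear (adj (A :: 'h \<Rightarrow> 'h))"
proof (rule bounded_clinearI[where K = "onorm A"])
  show "adj A (x + y) = adj A x + adj A y" for x y
    by (rule cinner_ext) (simp add: adj'[OF A] cinner_add_left)
  show "adj A (c *\<^sub>C x) = c *\<^sub>C adj A x" for x c
    by (rule cinner_ext) (simp add: adj'[OF A] cinner_scaleC_left)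
  show "norm (adj A x) \<le> onorm A * norm x" for x
    by (rule norm_adj_le[OF A bounded_clinearD(8)[OF A] onorm_nonneg[OF A]])
qed

lemma adj_adj: "bounded_clinear A \<Longrightarrow> adj (adj (A :: 'h \<Rightarrow> 'h)) = A"
  by (rule adj_eqI) (rule adj')

lemma adj_compose:
  "bounded_clinear A \<Longrightarrow> bounded_clinear B \<Longrightarrow> adj (\<lambda>x. A (B x)) = (\<lambda>x. adj B (adj A (x::'h)))"
  by (rule adj_eqI) (simp add: adj)

end

subsection \<open>Positive operators and their square roots\<close>

lemma positive_opD:
  assumes "positive_op P"
  shows "bounded_clinear P" "Im (cinner (P x) x) = 0" "0 \<le> Re (cinner (P x) x)"
  using assms by (auto simp: positive_op_def complex_nonneg_Reals_iff)

lemma positive_opI: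
  assumes "bounded_clinear P" "\<And>x. Im (cinner (P x) x) = 0" "\<And>x. 0 \<le> Re (cinner (P x) x)"
  shows "positive_op P"
  using assms by (auto simp: positive_op_def complex_nonneg_Reals_iff)

text \<open>Polarisation: reality of the form at \<open>x + y\<close> settles the imaginary parts,
  reality at \<open>x + \<i> y\<close> the real parts.\<close>

lemma positive_op_symmetric:
  assumes P: "positive_op P"
  shows "cinner (P x) y = cinner x (P y)"
proof -
  note bc = positive_opD(1)[OF P]
  have "Im (cinner (P x) y + cinner (P y) x) = 0"
    using positive_opD(2)[OF P, of "x + y"] positive_opD(2)[OF P, of x] positive_opD(2)[OF P, of y]
    by (simp add: bounded_clinear_simps[OF bc] cinner_add_left cinner_add_right)
  moreover have "Re (cinner (P y) x) - Re (cinner (P x) y) = 0"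
    using positive_opD(2)[OF P, of "x + \<i> *\<^sub>C y"] positive_opD(2)[OF P, of x] positive_opD(2)[OF P, of y]
    by (simp add: bounded_clinear_simps[OF bc] cinner_add_left cinner_add_right
        cinner_scaleC_left cinner_scaleC_right)
  ultimately have "cinner (P x) y = cnj (cinner (P y) x)"
    by (simp add: complex_eq_iff)
  then show ?thesis by (simp flip: cinner_commute)
qed

text \<open>With \<open>c = cinner (P x) y\<close> the form of \<open>P\<close> at
  \<open>x - t c y\<close> is a nonnegative polynomial in the real variable \<open>t\<close>, of
  degree at most two.\<close>

lemma positive_op_Cauchy_Schwarz:
  assumes P: "positive_op P"
  shows "(cmod (cinner (P x) y))\<^sup>2 \<le> Re (cinner (P x) x) * Re (cinner (P y) y)"
proof -
  note bc = positive_opD(1)[OF P]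
  define a b c where "a = Re (cinner (P x) x)" and "b = Re (cinner (P y) y)" and "c = cinner (P x) y"
  have ax: "cinner (P x) x = of_real a" "cinner (P y) y = of_real b"
    using positive_opD[OF P] by (auto simp: a_def b_def complex_eq_iff)
  have yx: "cinner (P y) x = cnj c"
    by (simp add: c_def positive_op_symmetric[OF P, of y] flip: cinner_commute)
  have ineq: "0 \<le> a - 2 * t * (cmod c)\<^sup>2 + t\<^sup>2 * (cmod c)\<^sup>2 * b" for t :: real
  proof -
    let ?z = "x - (of_real t * c) *\<^sub>C y"
    have "cinner (P ?z) ?z = of_real a - of_real t * (c * cnj c) - of_real t * (c * cnj c)
        + of_real t * of_real t * (c * cnj c) * of_real b"
      by (simp add: bounded_clinear_simps[OF bc] cinner_diff_left cinner_diff_right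
          cinner_scaleC_left cinner_scaleC_right ax yx algebra_simps flip: c_def)
    also have "\<dots> = of_real (a - 2 * t * (cmod c)\<^sup>2 + t\<^sup>2 * (cmod c)\<^sup>2 * b)"
      unfolding complex_norm_square[symmetric] by (simp add: power2_eq_square)
    finally show ?thesis using positive_opD(3)[OF P, of ?z] by (metis Re_complex_of_real)
  qed
  have a: "a \<ge> 0" and b: "b \<ge> 0" using positive_opD(3)[OF P] by (auto simp: a_def b_def)
  have "(cmod c)\<^sup>2 \<le> a * b"
  proof (cases "b = 0")
    case True
    show ?thesis
    proof (cases "c = 0")
      case False
      \<comment> \<open>For \<open>b = 0\<close> the polynomial is affine, and this value of
        \<open>t\<close> would make it equal to \<open>- a - 2\<close>.\<close>
      then have "a - 2 * ((a + 1) / (cmod c)\<^sup>2) * (cmod c)\<^sup>2 = - a - 2" by simp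
      then show ?thesis using ineq[of "(a + 1) / (cmod c)\<^sup>2"] True a by simp
    qed (use a b in simp)
  next
    case False
    then have "b > 0" using b by simp
    \<comment> \<open>The polynomial is smallest at \<open>t = 1 / b\<close>.\<close>
    then show ?thesis using ineq[of "1 / b"] by (simp add: field_simps power2_eq_square)
  qed
  then show ?thesis by (simp add: a_def b_def c_def)
qed

text \<open>In operator terms \<open>P P <= K P\<close>. It is the inequality of Cauchy and Schwarz
  for the form of \<open>P\<close> at \<open>x\<close> and \<open>P x\<close>, after cancelling
  \<open>(norm (P x))^2\<close>. The contraction property of \<open>1 - P\<close>, the uniqueness of
  roots and the decay in the polar approximation all rest on it.\<close>

lemma positive_op_norm_sq_le:
  assumes P: "positive_op P" and K: "\<And>x. norm (P x) \<le> K * norm x"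
  shows "(norm (P x))\<^sup>2 \<le> K * Re (cinner (P x) x)"
proof (cases "P x = 0")
  case False
  let ?a = "Re (cinner (P x) x)"
  have "((norm (P x))\<^sup>2)\<^sup>2 = (cmod (cinner (P x) (P x)))\<^sup>2" by (simp add: cinner_self norm_power)
  also have "\<dots> \<le> ?a * Re (cinner (P (P x)) (P x))"
    by (rule positive_op_Cauchy_Schwarz[OF P])
  also have "\<dots> \<le> ?a * (norm (P (P x)) * norm (P x))"
    using cinner_Cauchy_Schwarz complex_Re_le_cmod order_trans
    by (intro mult_left_mono positive_opD(3)[OF P]) blast
  also have "\<dots> \<le> ?a * (K * norm (P x) * norm (P x))"
    using K by (intro mult_left_mono mult_right_mono positive_opD(3)[OF P]) auto
  finally have "(norm (P x))\<^sup>2 * (norm (P x))\<^sup>2 \<le> (K * ?a) * (norm (P x))\<^sup>2"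
    by (simp add: power2_eq_square algebra_simps)
  then show ?thesis by (rule mult_right_le_imp_le) (use False in simp)
qed (use positive_opD(3)[OF P, of x] in simp)

lemma positive_op_eq_0:
  assumes P: "positive_op P" and "Re (cinner (P x) x) = 0"
  shows "P x = 0"
  using positive_op_norm_sq_le[OF P bounded_clinearD(8)[OF positive_opD(1)[OF P]], of x] assms(2)
  by simp

text \<open>The iteration \<open>Y \<mapsto> (X + Y\<^sup>2) / 2\<close> converges to the solution \<open>1 - sqrt (1 - X)\<close>; its
  increments are dominated by those of the same iteration for the number \<open>1\<close> in place of \<open>X\<close>.\<close>

primrec sqrt_iter :: "('h::chilbert_space \<Rightarrow> 'h) \<Rightarrow> nat \<Rightarrow> 'h \<Rightarrow> 'h" where
  "sqrt_iter X 0 = (\<lambda>x. 0)"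
| "sqrt_iter X (Suc n) = (\<lambda>x. (1/2) *\<^sub>C (X x + sqrt_iter X n (sqrt_iter X n x)))"

primrec sqrt_iter_real :: "nat \<Rightarrow> real" where
  "sqrt_iter_real 0 = 0"
| "sqrt_iter_real (Suc n) = (1 + (sqrt_iter_real n)\<^sup>2) / 2"

lemma sqrt_iter_real_bounds: "0 \<le> sqrt_iter_real n \<and> sqrt_iter_real n \<le> 1"
proof (induction n)
  case (Suc n)
  then have "(sqrt_iter_real n)\<^sup>2 \<le> 1\<^sup>2" by (intro power_mono) auto
  then show ?case by auto
qed auto

lemma sqrt_iter_real_mono: "mono sqrt_iter_real"
proof -
  have "sqrt_iter_real n \<le> sqrt_iter_real (Suc n)" for n
    \<comment> \<open>\<open>(y - 1)^2 >= 0\<close> rearranges to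
      \<open>y <= (1 + y^2) / 2\<close>.\<close>
    using sum_squares_ge_zero[of "sqrt_iter_real n - 1" 0] by (simp add: algebra_simps power2_eq_square)
  then show ?thesis by (rule incseq_SucI)
qed

lemma bounded_clinear_sqrt_iter:
  assumes X: "bounded_clinear X" shows "bounded_clinear (sqrt_iter X n)"
  by (induction n) (auto intro!: bounded_clinear_intros bounded_clinear_compose[of "sqrt_iter X _" "sqrt_iter X _"] X)

text \<open>Applied with \<open>D\<close> equal to \<open>X\<close>, to the iterates themselves, and
  to any operator commuting with \<open>P\<close>.\<close>

lemma sqrt_iter_commute:
  assumes D: "bounded_clinear D" and "\<And>x. D (X x) = X (D x)"
  shows "D (sqrt_iter X n x) = sqrt_iter X n (D x)"
proof (induction n arbitrary: x)
  case (Suc n)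
  show ?case by (simp only: sqrt_iter.simps bounded_clinear_simps[OF D] assms(2) Suc.IH)
qed (simp add: bounded_clinear_simps[OF D])

text \<open>The root is \<open>Q = 1 - Y\<close>, where \<open>Y\<close> is the limit of the
  iteration for \<open>X = 1 - P\<close>. The clause on commuting operators is carried along for the
  uniqueness proof: every other root of \<open>P\<close> commutes with \<open>P\<close>, hence with
  this one.\<close>

lemma ex_sqrt_contraction:
  fixes P :: "'h::chilbert_space \<Rightarrow> 'h"
  assumes P: "positive_op P" and P1: "\<And>x. norm (P x) \<le> norm x"
  shows "\<exists>Q. positive_op Q \<and> (\<forall>x. Q (Q x) = P x) \<and>
    (\<forall>D. bounded_clinear D \<longrightarrow> (\<forall>x. D (P x) = P (D x)) \<longrightarrow> (\<forall>x. D (Q x) = Q (D x)))"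
proof -
  define X where "X x = x - P x" for x
  let ?Y = "sqrt_iter X" and ?y = sqrt_iter_real
  note bP = positive_opD(1)[OF P]
  have X: "bounded_clinear X"
    unfolding X_def by (intro bounded_clinear_intros bP)
  \<comment> \<open>Since \<open>P P <= P\<close>, the term \<open>(norm (P x))^2\<close> uses up at
    most half of the negative term \<open>2 Re (cinner (P x) x)\<close>.\<close>
  have X1: "norm (X x) \<le> norm x" for x
  proof -
    have Px: "cinner x (P x) = cinner (P x) x" by (simp add: positive_op_symmetric[OF P])
    have "(norm (X x))\<^sup>2 = (norm x)\<^sup>2 - 2 * Re (cinner (P x) x) + (norm (P x))\<^sup>2"
      by (simp add: X_def norm_sq_Re_cinner cinner_diff_left cinner_diff_right Px)
    also have "\<dots> \<le> (norm x)\<^sup>2"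
      using positive_op_norm_sq_le[OF P, of 1 x] P1 positive_opD(3)[OF P, of x] by simp
    finally show ?thesis by simp
  qed
  note bY = bounded_clinear_sqrt_iter[OF X]
  note Yl = bounded_clinear_simps[OF bY]
  have YX: "?Y n (X x) = X (?Y n x)" for n x
    using sqrt_iter_commute[OF X, of X] by metis
  have YY: "?Y n (?Y m x) = ?Y m (?Y n x)" for n m x
    by (rule sqrt_iter_commute[where D = "?Y n" and X = X, OF bY YX])
  have Yn: "norm (?Y n x) \<le> ?y n * norm x" for n x
  proof (induction n arbitrary: x)
    case (Suc n)
    have "norm (?Y n (?Y n x)) \<le> ?y n * (?y n * norm x)"
      using Suc.IH[of "?Y n x"] mult_left_mono[OF Suc.IH[of x]] sqrt_iter_real_bounds[of n]
      by (meson order_trans)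
    then have "norm (X x + ?Y n (?Y n x)) \<le> norm x + ?y n * (?y n * norm x)"
      using X1[of x] norm_triangle_ineq[of "X x" "?Y n (?Y n x)"] by linarith
    then show ?case by (simp add: norm_scaleC power2_eq_square algebra_simps)
  qed simp
  have Yn1: "norm (?Y n x) \<le> norm x" for n x
    using Yn[of n x] mult_right_mono[of "?y n" 1 "norm x"] sqrt_iter_real_bounds[of n] by auto
  have step: "norm (?Y (Suc n) x - ?Y n x) \<le> (?y (Suc n) - ?y n) * norm x" for n x
  proof (induction n arbitrary: x)
    case 0
    then show ?case using X1[of x] by (simp add: norm_scaleC)
  next
    case (Suc n)
    define d where "d = ?Y (Suc n) x - ?Y n x"
    \<comment> \<open>The iterates commute, so the difference of their squares factors as it does
      for numbers, and each increment is controlled by the previous one.\<close>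
    have eq: "?Y (Suc (Suc n)) x - ?Y (Suc n) x = (1/2) *\<^sub>C (?Y (Suc n) d + ?Y n d)"
    proof -
      have "?Y (Suc (Suc n)) x - ?Y (Suc n) x
          = (1/2) *\<^sub>C (?Y (Suc n) (?Y (Suc n) x) - ?Y n (?Y n x))"
        by (simp only: sqrt_iter.simps(2)[of X "Suc n"] sqrt_iter.simps(2)[of X n])
          (simp add: scaleC_diff_right[symmetric])
      also have "?Y (Suc n) (?Y (Suc n) x) - ?Y n (?Y n x) = ?Y (Suc n) d + ?Y n d"
        unfolding d_def by (simp only: Yl(2) YY[of n "Suc n"]) simp
      finally show ?thesis .
    qed
    have "norm (?Y (Suc n) d + ?Y n d) \<le> (?y (Suc n) + ?y n) * norm d"
      using Yn[of "Suc n" d] Yn[of n d] norm_triangle_ineq[of "?Y (Suc n) d" "?Y n d"]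
      by (simp only: distrib_right)
    also have "\<dots> \<le> (?y (Suc n) + ?y n) * ((?y (Suc n) - ?y n) * norm x)"
      using Suc.IH[of x] sqrt_iter_real_bounds[of n] sqrt_iter_real_bounds[of "Suc n"]
      unfolding d_def by (intro mult_left_mono) auto
    also have "\<dots> = ((?y (Suc n))\<^sup>2 - (?y n)\<^sup>2) * norm x"
      by (simp only: power2_eq_square) algebra
    finally have "norm (?Y (Suc (Suc n)) x - ?Y (Suc n) x)
        \<le> (1/2) * (((?y (Suc n))\<^sup>2 - (?y n)\<^sup>2) * norm x)"
      unfolding eq norm_scaleC by simp
    also have "\<dots> = (?y (Suc (Suc n)) - ?y (Suc n)) * norm x"
      unfolding sqrt_iter_real.simps(2)[of "Suc n"] sqrt_iter_real.simps(2)[of n]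
      by (simp add: field_simps)
    finally show ?case .
  qed
  have telescope: "norm (?Y (n + k) x - ?Y n x) \<le> (?y (n + k) - ?y n) * norm x" for n k x
  proof (induction k)
    case (Suc k)
    have "norm (?Y (n + Suc k) x - ?Y n x)
        \<le> norm (?Y (Suc (n + k)) x - ?Y (n + k) x) + norm (?Y (n + k) x - ?Y n x)"
      using norm_triangle_ineq[of "?Y (Suc (n + k)) x - ?Y (n + k) x" "?Y (n + k) x - ?Y n x"]
      by (simp del: sqrt_iter.simps)
    also have "\<dots> \<le> (?y (Suc (n + k)) - ?y (n + k)) * norm x + (?y (n + k) - ?y n) * norm x"
      by (rule add_mono[OF step Suc.IH])
    finally show ?case by (simp add: algebra_simps)
  qed simp
  have "Cauchy ?y"
    using sqrt_iter_real_bounds sqrt_iter_real_mono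
    by (intro convergent_Cauchy Bseq_mono_convergent BseqI'[where K = 1]) (auto simp: mono_def)
  have "convergent (\<lambda>n. ?Y n x)" for x
  proof (rule Cauchy_convergent, rule metric_CauchyI)
    fix \<epsilon> :: real assume "\<epsilon> > 0"
    define \<delta> where "\<delta> = \<epsilon> / 2 / (norm x + 1)"
    have pos: "norm x + 1 > 0" by (simp add: add_nonneg_pos)
    have \<delta>: "\<delta> > 0" "\<delta> * norm x + \<delta> = \<epsilon> / 2"
    proof -
      show "\<delta> > 0" unfolding \<delta>_def using \<open>\<epsilon> > 0\<close> pos by (intro divide_pos_pos) auto
      have "\<delta> * (norm x + 1) = \<epsilon> / 2" 
        using nonzero_eq_divide_eq[of "norm x + 1" \<delta> "\<epsilon> / 2"] pos \<delta>_def by (metis less_irrefl)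
      then show "\<delta> * norm x + \<delta> = \<epsilon> / 2" by (simp add: distrib_left)
    qed
    then obtain M where M: "\<And>m n. m \<ge> M \<Longrightarrow> n \<ge> M \<Longrightarrow> dist (?y m) (?y n) < \<delta>"
      using metric_CauchyD[OF \<open>Cauchy ?y\<close>] by meson
    have *: "dist (?Y m x) (?Y M x) < \<epsilon> / 2" if "m \<ge> M" for m
    proof -
      obtain k where k: "m = M + k" using le_Suc_ex[OF \<open>m \<ge> M\<close>] by blast
      have "dist (?Y m x) (?Y M x) \<le> (?y m - ?y M) * norm x"
        using telescope[of M k x] by (simp add: k dist_norm)
      also have "\<dots> \<le> \<delta> * norm x"
        using M[OF that order_refl] by (intro mult_right_mono) (simp_all add: dist_real_def)
      also have "\<dots> < \<epsilon> / 2"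
        using \<delta> by linarith
      finally show ?thesis .
    qed
    show "\<exists>M. \<forall>m\<ge>M. \<forall>n\<ge>M. dist (?Y m x) (?Y n x) < \<epsilon>"
      using * dist_triangle_half_l by blast
  qed
  then obtain Y where lim: "\<And>x. (\<lambda>n. ?Y n x) \<longlonglongrightarrow> Y x"
    unfolding convergent_def by metis
  have bY': "bounded_clinear Y"
  proof (rule bounded_clinearI[where K = 1])
    fix x y c
    have "(\<lambda>n. ?Y n (x + y)) \<longlonglongrightarrow> Y x + Y y"
      unfolding Yl by (intro tendsto_add lim)
    then show "Y (x + y) = Y x + Y y" using lim LIMSEQ_unique by blast
    have "(\<lambda>n. ?Y n (c *\<^sub>C x)) \<longlonglongrightarrow> c *\<^sub>C Y x"
      unfolding Yl by (intro tendsto_scaleC tendsto_const lim)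
    then show "Y (c *\<^sub>C x) = c *\<^sub>C Y x" using lim LIMSEQ_unique by blast
    show "norm (Y x) \<le> 1 * norm x"
      using Lim_bounded[OF tendsto_norm[OF lim[of x]], of 0 "norm x"] Yn1 by simp
  qed
  have comm: "D (Y x) = Y (D x)"
    if D: "bounded_clinear D" and DP: "\<And>x. D (P x) = P (D x)" for D x
  proof -
    have "D (X x) = X (D x)" for x by (simp add: X_def bounded_clinear_simps[OF D] DP)
    then have "D (?Y n x) = ?Y n (D x)" for n by (rule sqrt_iter_commute[OF D])
    moreover have "(\<lambda>n. D (?Y n x)) \<longlonglongrightarrow> D (Y x)"
      by (rule bounded_linear.tendsto[OF bounded_clinearD(1)[OF D] lim])
    ultimately show ?thesis using lim[of "D x"] by (simp add: LIMSEQ_unique)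
  qed
  have fix_eq: "Y x = (1/2) *\<^sub>C (X x + Y (Y x))" for x
  proof -
    \<comment> \<open>Pointwise convergence alone does not pass through the square. Since all
      iterates are contractions, \<open>?Y n (?Y n x)\<close> differs from \<open>?Y n (Y x)\<close>
      by a null sequence.\<close>
    have "(\<lambda>n. ?Y n (?Y n x - Y x)) \<longlonglongrightarrow> 0"
    proof (rule Lim_null_comparison)
      show "\<forall>\<^sub>F n in sequentially. norm (?Y n (?Y n x - Y x)) \<le> norm (?Y n x - Y x)"
        using Yn1 by auto
      show "(\<lambda>n. norm (?Y n x - Y x)) \<longlonglongrightarrow> 0"
        using lim[of x] tendsto_norm_zero LIM_zero by blast
    qed
    from tendsto_add[OF this lim[of "Y x"]] have "(\<lambda>n. ?Y n (?Y n x)) \<longlonglongrightarrow> Y (Y x)"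
      by (simp add: Yl)
    then have "(\<lambda>n. ?Y (Suc n) x) \<longlonglongrightarrow> (1/2) *\<^sub>C (X x + Y (Y x))"
      by (simp, intro tendsto_scaleC tendsto_const tendsto_add)
    moreover have "(\<lambda>n. ?Y (Suc n) x) \<longlonglongrightarrow> Y x" using lim LIMSEQ_Suc by blast
    ultimately show ?thesis using LIMSEQ_unique by blast
  qed
  have symX: "cinner (X x) y = cinner x (X y)" for x y
    by (simp add: X_def cinner_diff_left cinner_diff_right positive_op_symmetric[OF P])
  have "cinner (?Y n x) y = cinner x (?Y n y)" for n x y
    by (induction n arbitrary: x y)
      (auto simp: cinner_scaleC_left cinner_scaleC_right cinner_add_left cinner_add_right symX)
  then have "Im (cinner (?Y n x) x) = 0" for n x
    by (metis Im_complex_of_real Reals_cnj_iff cinner_commute complex_is_Real_iff)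
  moreover have "(\<lambda>n. Im (cinner (?Y n x) x)) \<longlonglongrightarrow> Im (cinner (Y x) x)" for x
    by (intro tendsto_Im tendsto_cinner lim tendsto_const)
  ultimately have ImY: "Im (cinner (Y x) x) = 0" for x
    by (simp add: LIMSEQ_const_iff)
  define Q where "Q x = x - Y x" for x
  have "positive_op Q"
  proof (rule positive_opI)
    show "bounded_clinear Q" unfolding Q_def by (intro bounded_clinear_intros bY')
    show "Im (cinner (Q x) x) = 0" for x by (simp add: Q_def cinner_diff_left ImY)
    have "norm (Y x) \<le> norm x" for x
      using Lim_bounded[OF tendsto_norm[OF lim[of x]], of 0 "norm x"] Yn1 by simp
    then have "cmod (cinner (Y x) x) \<le> (norm x)\<^sup>2" for x
      using cinner_Cauchy_Schwarz[of "Y x" x] mult_right_mono[of "norm (Y x)" "norm x" "norm x"]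
      by (simp add: power2_eq_square)
    then show "0 \<le> Re (cinner (Q x) x)" for x
      using order_trans[OF complex_Re_le_cmod[of "cinner (Y x) x"]]
      by (simp add: Q_def cinner_diff_left flip: norm_sq_Re_cinner)
  qed
  moreover have "Q (Q x) = P x" for x
  proof -
    \<comment> \<open>Twice the fixed point equation reads \<open>2 Y = X + Y Y\<close>, that is,
      the square of \<open>1 - Y\<close> is \<open>1 - X = P\<close>.\<close>
    have "Y x + Y x = X x + Y (Y x)"
      using arg_cong[OF fix_eq[of x], of "\<lambda>z. z + z"]
      by (simp add: scaleC_add_left[symmetric] scaleC_one)
    then show ?thesis
      by (simp add: Q_def bounded_clinear_simps[OF bY'] X_def algebra_simps)
  qed
  moreover have "D (Q x) = Q (D x)"
    if "bounded_clinear D" "\<And>x. D (P x) = P (D x)" for D x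
    using comm[OF that] by (simp add: Q_def bounded_clinear_simps[OF that(1)])
  ultimately show ?thesis by blast
qed

lemma positive_op_scale:
  assumes "positive_op P" "0 \<le> r"
  shows "positive_op (\<lambda>x. complex_of_real r *\<^sub>C P x)"
  using assms positive_opD[OF assms(1)]
  by (intro positive_opI bounded_clinear_intros) (auto simp: cinner_scaleC_left)

lemma ex_sqrt:
  fixes P :: "'h::chilbert_space \<Rightarrow> 'h"
  assumes P: "positive_op P"
  shows "\<exists>Q. positive_op Q \<and> (\<forall>x. Q (Q x) = P x) \<and>
    (\<forall>D. bounded_clinear D \<longrightarrow> (\<forall>x. D (P x) = P (D x)) \<longrightarrow> (\<forall>x. D (Q x) = Q (D x)))"
proof -
  note bP = positive_opD(1)[OF P]
  \<comment> \<open>Adding \<open>1\<close> keeps the scaling factor positive also for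
    \<open>P = 0\<close>.\<close>
  define K where "K = onorm P + 1"
  have K: "K > 0" using onorm_nonneg[OF bP] by (simp add: K_def)
  let ?P = "\<lambda>x. complex_of_real (1/K) *\<^sub>C P x"
  have "norm (?P x) \<le> norm x" for x
  proof -
    have "norm (P x) \<le> K * norm x"
      using bounded_clinearD(8)[OF bP, of x] by (simp add: K_def algebra_simps add_increasing)
    then show ?thesis using K by (simp add: norm_scaleC field_simps norm_divide)
  qed
  moreover have "positive_op ?P" using K by (intro positive_op_scale P) auto
  ultimately obtain Q where
    Q: "positive_op Q" "\<And>x. Q (Q x) = ?P x"
    and D: "\<And>D x. bounded_clinear D \<Longrightarrow> (\<And>x. D (?P x) = ?P (D x)) \<Longrightarrow> D (Q x) = Q (D x)"
    using ex_sqrt_contraction[of ?P] by blast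
  let ?Q = "\<lambda>x. complex_of_real (sqrt K) *\<^sub>C Q x"
  note bQ = positive_opD(1)[OF Q(1)]
  have "positive_op ?Q" using K by (intro positive_op_scale Q) auto
  moreover have "?Q (?Q x) = P x" for x
    using K by (simp add: bounded_clinear_simps[OF bQ] scaleC_scaleC Q scaleC_one
        flip: of_real_mult mult.assoc)
  moreover have "D (?Q x) = ?Q (D x)" if "bounded_clinear D" "\<And>x. D (P x) = P (D x)" for D x
    using D[OF that(1)] that(2) by (simp add: bounded_clinear_simps[OF that(1)])
  ultimately show ?thesis by blast
qed

text \<open>The square root \<open>R\<close> built above commutes with \<open>Q\<close>, so \<open>(R + Q) (R - Q) = 0\<close>.\<close>

lemma sqrt_unique:
  fixes P :: "'h::chilbert_space \<Rightarrow> 'h"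
  assumes Q: "positive_op Q" "\<And>x. Q (Q x) = P x"
    and Q': "positive_op Q'" "\<And>x. Q' (Q' x) = P x" and P: "positive_op P"
  shows "Q = Q'"
proof -
  obtain R where R: "positive_op R" "\<And>x. R (R x) = P x"
    and comm: "\<And>D x. bounded_clinear D \<Longrightarrow> (\<And>x. D (P x) = P (D x)) \<Longrightarrow> D (R x) = R (D x)"
    using ex_sqrt[OF P] by blast
  have "Q x = R x" if Q: "positive_op Q" "\<And>x. Q (Q x) = P x" for Q x
  proof -
    note bQ = positive_opD(1)[OF Q(1)] and bR = positive_opD(1)[OF R(1)]
    have QR: "Q (R x) = R (Q x)" for x
      by (rule comm[OF bQ]) (simp flip: Q(2))
    \<comment> \<open>From \<open>R y + Q y = 0\<close> both nonnegative forms vanish at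
      \<open>y\<close>, hence \<open>R y = Q y = 0\<close>. By symmetry \<open>cinner y y\<close> is
      \<open>cinner (R y - Q y) x\<close>.\<close>
    define y where "y = R x - Q x"
    have "R y + Q y = 0"
      by (simp add: y_def bounded_clinear_simps[OF bQ] bounded_clinear_simps[OF bR] QR R Q)
    then have "Re (cinner (R y) y) + Re (cinner (Q y) y) = 0"
      by (metis cinner_add_left cinner_zero_left plus_complex.sel(1) zero_complex.sel(1))
    then have "Re (cinner (R y) y) = 0" "Re (cinner (Q y) y) = 0"
      using positive_opD(3)[OF R(1), of y] positive_opD(3)[OF Q(1), of y] by auto
    then have 0: "R y = 0" "Q y = 0"
      using positive_op_eq_0 R(1) Q(1) by blast+
    have "cinner y y = cinner (R y) x - cinner (Q y) x"
      by (simp add: positive_op_symmetric[OF R(1)] positive_op_symmetric[OF Q(1)] cinner_diff_right y_def)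
    then have "y = 0" by (simp add: 0 cinner_self)
    then show ?thesis by (simp add: y_def)
  qed
  from this[OF Q] this[OF Q'] show ?thesis by auto
qed

context orthonormal
begin

lemma positive_op_adj_compose:
  assumes A: "bounded_clinear (A :: 'h \<Rightarrow> 'h)"
  shows "positive_op (\<lambda>x. adj A (A x))"
  by (rule positive_opI)
    (simp_all add: bounded_clinear_compose bounded_clinear_adj A adj'[OF A] cinner_self)

lemma abs_op_eqI:
  assumes A: "bounded_clinear (A :: 'h \<Rightarrow> 'h)" and P: "positive_op P" "\<And>x. P (P x) = adj A (A x)"
  shows "abs_op A = P"
  unfolding abs_op_def
proof (rule the_equality)
  show "positive_op P \<and> P \<circ> P = adj A \<circ> A" using P by auto
  fix P' assume "positive_op P' \<and> P' \<circ> P' = adj A \<circ> A"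
  then show "P' = P"
    using sqrt_unique[OF _ _ P positive_op_adj_compose[OF A]] by (auto simp: fun_eq_iff)
qed

lemma abs_op:
  assumes A: "bounded_clinear (A :: 'h \<Rightarrow> 'h)"
  shows "positive_op (abs_op A)" "abs_op A (abs_op A x) = adj A (A x)"
proof -
  obtain P where "positive_op P" "\<And>x. P (P x) = adj A (A x)"
    using ex_sqrt[OF positive_op_adj_compose[OF A]] by blast
  with abs_op_eqI[OF A this] show "positive_op (abs_op A)" "abs_op A (abs_op A x) = adj A (A x)"
    by auto
qed

subsection \<open>Trace class operators\<close>

lemma norm_abs_op:
  assumes A: "bounded_clinear (A :: 'h \<Rightarrow> 'h)"
  shows "norm (abs_op A x) = norm (A x)"
proof -
  have "cinner (abs_op A x) (abs_op A x) = cinner (A x) (A x)"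
    by (simp add: positive_op_symmetric[OF abs_op(1)[OF A]] abs_op(2)[OF A] adj[OF A])
  then show ?thesis by (simp add: norm_eq_sqrt_cinner)
qed

text \<open>A substitute for the polar decomposition \<open>A = V \<bar>A\<bar>\<close>: with \<open>X = 1 - s \<bar>A\<bar>\<close> the operators
  \<open>V\<^sub>n = A (\<Sum>k<n. s X\<^sup>k)\<close> satisfy \<open>V\<^sub>n \<bar>A\<bar> = A (1 - X\<^sup>n)\<close>, and \<open>\<bar>A\<bar> X\<^sup>n\<close> tends to \<open>0\<close>
  pointwise because \<open>\<parallel>X z\<parallel>\<^sup>2 \<le> \<parallel>z\<parallel>\<^sup>2 - s \<langle>\<bar>A\<bar> z, z\<rangle>\<close>.\<close>

lemma polar_approximation:
  assumes A: "bounded_clinear (A :: 'h \<Rightarrow> 'h)"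
  shows "\<exists>V. (\<forall>n. bounded_clinear (V n)) \<and> (\<forall>n x. norm (V n x) \<le> 2 * norm x) \<and>
    (\<forall>x. (\<lambda>n. V n (abs_op A x)) \<longlonglongrightarrow> A x) \<and>
    (\<forall>x. (\<lambda>n. cinner (A x) (V n x)) \<longlonglongrightarrow> cinner (abs_op A x) x)"
proof -
  define P where "P = abs_op A"
  have P: "positive_op P" and PP: "\<And>x. P (P x) = adj A (A x)" and nP: "\<And>x. norm (A x) = norm (P x)"
    using abs_op[OF A] norm_abs_op[OF A] by (auto simp: P_def)
  note bP = positive_opD(1)[OF P]
  define K where "K = onorm P + 1"
  have K: "K > 0" using onorm_nonneg[OF bP] by (simp add: K_def)
  have PK: "norm (P x) \<le> K * norm x" for x
    using bounded_clinearD(8)[OF bP, of x] by (simp add: K_def algebra_simps add_increasing)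
  define s :: real where "s = 1 / K"
  have s: "s > 0" "s * K = 1" using K by (auto simp: s_def)
  define X where "X x = x - complex_of_real s *\<^sub>C P x" for x
  have bX: "bounded_clinear X"
    unfolding X_def by (intro bounded_clinear_intros bP)
  note bXn = bounded_clinear_funpow[OF bX]
  have PX: "P (X x) = X (P x)" for x
    by (simp add: X_def bounded_clinear_simps[OF bP])
  have PXn: "P ((X ^^ n) x) = (X ^^ n) (P x)" for n x
    by (induction n) (auto simp: PX)
  have decr: "(norm (X z))\<^sup>2 \<le> (norm z)\<^sup>2 - s * Re (cinner (P z) z)" for z
  proof -
    have "(norm (X z))\<^sup>2 = (norm z)\<^sup>2 - 2 * s * Re (cinner (P z) z) + s * (s * (norm (P z))\<^sup>2)"
      by (simp add: X_def norm_sq_Re_cinner cinner_diff_left cinner_diff_right cinner_scaleC_left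
          cinner_scaleC_right positive_op_symmetric[OF P, of z z] algebra_simps)
    also have "s * (norm (P z))\<^sup>2 \<le> s * (K * Re (cinner (P z) z))"
      using positive_op_norm_sq_le[OF P PK, of z] s by (intro mult_left_mono) auto
    also have "\<dots> = Re (cinner (P z) z)"
      using s(2) by (simp flip: mult.assoc)
    finally show ?thesis using s by (simp add: mult_left_mono)
  qed
  have contr: "norm (X z) \<le> norm z" for z
    using decr[of z] mult_nonneg_nonneg[of s "Re (cinner (P z) z)"] s positive_opD(3)[OF P, of z]
    by (intro power2_le_imp_le[OF _ norm_ge_zero]) linarith
  have contrn: "norm ((X ^^ n) z) \<le> norm z" for n z
    by (induction n) (auto intro: order_trans[OF contr])
  \<comment> \<open>The squared norms of \<open>(X ^^ n) x\<close> decrease to a limit, so their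
    increments tend to \<open>0\<close>; by \<open>decr\<close> these increments dominate
    \<open>(norm (P ((X ^^ n) x)))^2\<close> up to a constant.\<close>
  have null: "(\<lambda>n. P ((X ^^ n) x)) \<longlonglongrightarrow> 0" for x
  proof -
    let ?u = "\<lambda>n. (norm ((X ^^ n) x))\<^sup>2"
    have "decseq ?u"
      by (rule decseq_SucI) (simp add: power_mono contr)
    moreover have "\<forall>n. 0 \<le> ?u n" by simp
    ultimately obtain L where L: "?u \<longlonglongrightarrow> L" "\<forall>n. L \<le> ?u n"
      by (rule decseq_convergent)
    have "(\<lambda>n. (K / s) * (?u n - ?u (Suc n))) \<longlonglongrightarrow> (K / s) * (L - L)"
      by (intro tendsto_intros L(1) LIMSEQ_Suc[OF L(1)])
    then have *: "(\<lambda>n. (K / s) * (?u n - ?u (Suc n))) \<longlonglongrightarrow> 0" by simp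
    have "(\<lambda>n. (norm (P ((X ^^ n) x)))\<^sup>2) \<longlonglongrightarrow> 0"
    proof (rule tendsto_sandwich[OF _ _ tendsto_const *])
      have "(norm (P ((X ^^ n) x)))\<^sup>2 \<le> (K / s) * (?u n - ?u (Suc n))" for n
      proof -
        have "(norm (P ((X ^^ n) x)))\<^sup>2 \<le> (K / s) * (s * Re (cinner (P ((X ^^ n) x)) ((X ^^ n) x)))"
          using positive_op_norm_sq_le[OF P PK, of "(X ^^ n) x"] s by simp
        also have "\<dots> \<le> (K / s) * (?u n - ?u (Suc n))"
          using decr[of "(X ^^ n) x"] K s by (intro mult_left_mono) auto
        finally show ?thesis .
      qed
      then show "\<forall>\<^sub>F n in sequentially. (norm (P ((X ^^ n) x)))\<^sup>2 \<le> (K / s) * (?u n - ?u (Suc n))"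
        by simp
    qed simp
    then have "(\<lambda>n. sqrt ((norm (P ((X ^^ n) x)))\<^sup>2)) \<longlonglongrightarrow> sqrt 0"
      by (rule tendsto_real_sqrt)
    then show ?thesis using tendsto_norm_zero_cancel by simp
  qed
  define g where "g n x = (\<Sum>k<n. (X ^^ k) (complex_of_real s *\<^sub>C x))" for n x
  have bg: "bounded_clinear (g n)" for n
  proof -
    have "bounded_clinear (\<lambda>x. (X ^^ k) (complex_of_real s *\<^sub>C x))" for k
      using bounded_clinear_compose[OF bXn bounded_clinear_scaleC[OF bounded_clinear_id]] .
    then show ?thesis unfolding g_def by (intro bounded_clinear_sum)
  qed
  have gP: "g n (P x) = x - (X ^^ n) x" for n x
  proof -
    have "(X ^^ k) (complex_of_real s *\<^sub>C P x) = (X ^^ k) x - (X ^^ Suc k) x" for k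
    proof -
      have "complex_of_real s *\<^sub>C P x = x - X x" by (simp add: X_def)
      then show ?thesis by (simp add: bounded_clinear_simps[OF bXn] funpow_swap1)
    qed
    then have "g n (P x) = (\<Sum>k<n. (X ^^ k) x - (X ^^ Suc k) x)" by (simp add: g_def)
    also have "\<dots> = x - (X ^^ n) x" by (induction n) simp_all
    finally show ?thesis .
  qed
  have Pg: "P (g n x) = x - (X ^^ n) x" for n x
    unfolding gP[symmetric] g_def
    by (simp add: bounded_clinear_simps[OF bP] PXn)
  define V where "V n x = A (g n x)" for n x
  show ?thesis
  proof (intro exI[of _ V] conjI allI)
    show "bounded_clinear (V n)" for n
      unfolding V_def by (rule bounded_clinear_compose[OF A bg])
    \<comment> \<open>\<open>A\<close> and \<open>P\<close> have equal norms at every vector, so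
      \<open>norm (V n x) = norm (P (g n x)) = norm (x - (X ^^ n) x)\<close>. The triangle
      inequality yields \<open>2\<close> where a partial isometry would have
      \<open>1\<close>.\<close>
    show "norm (V n x) \<le> 2 * norm x" for n x
      using norm_triangle_ineq4[of x "(X ^^ n) x"] contrn[of n x] by (simp add: V_def nP Pg)
    have "(\<lambda>n. A ((X ^^ n) x)) \<longlonglongrightarrow> 0" for x
      by (rule tendsto_norm_zero_cancel) (use tendsto_norm_zero[OF null[of x]] in \<open>simp add: nP\<close>)
    from tendsto_diff[OF tendsto_const this]
    show "(\<lambda>n. V n (abs_op A x)) \<longlonglongrightarrow> A x" for x
      by (simp add: V_def gP bounded_clinear_simps[OF A] flip: P_def)
    have "(\<lambda>n. cinner (P x) x - cinner x (P ((X ^^ n) x))) \<longlonglongrightarrow> cinner (P x) x - cinner x 0" for x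
      by (intro tendsto_diff tendsto_const tendsto_cinner null)
    moreover have "cinner (A x) (V n x) = cinner (P x) x - cinner x (P ((X ^^ n) x))" for n x
    proof -
      have "cinner (A x) (V n x) = cinner (P (P x)) (g n x)" by (simp add: V_def PP adj'[OF A])
      also have "\<dots> = cinner (P x) (x - (X ^^ n) x)" by (simp add: positive_op_symmetric[OF P, of "P x"] Pg)
      also have "\<dots> = cinner (P x) x - cinner x (P ((X ^^ n) x))"
        by (simp add: cinner_diff_right positive_op_symmetric[OF P, of x "(X ^^ n) x"])
      finally show ?thesis .
    qed
    ultimately show "(\<lambda>n. cinner (A x) (V n x)) \<longlonglongrightarrow> cinner (abs_op A x) x" for x
      by (simp flip: P_def)
  qed
qed

text \<open>Both square sums add up the squared matrix entries of \<open>S\<close>, by rows or by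
  columns. For finite \<open>G\<close> the exchange amounts to adding finitely many Parseval
  series.\<close>

lemma Hilbert_Schmidt_adj:
  assumes S: "bounded_clinear S" and bound: "\<And>F. finite F \<Longrightarrow> (\<Sum>j\<in>F. (norm (S (e j)))\<^sup>2) \<le> t"
    and G: "finite G"
  shows "(\<Sum>i\<in>G. (norm (adj S (e i)))\<^sup>2) \<le> t"
proof -
  have "((\<lambda>j. \<Sum>i\<in>G. (cmod (cinner (adj S (e i)) (e j)))\<^sup>2) has_sum
      (\<Sum>i\<in>G. (norm (adj S (e i)))\<^sup>2)) UNIV"
    using G by (induction G) (auto intro!: has_sum_add Parseval)
  moreover have "(\<Sum>j\<in>F. \<Sum>i\<in>G. (cmod (cinner (adj S (e i)) (e j)))\<^sup>2) \<le> t" if "finite F" for F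
  proof -
    have "cmod (cinner (adj S (e i)) (e j)) = cmod (cinner (S (e j)) (e i))" for i j
      by (metis adj'[OF S] cinner_commute complex_mod_cnj)
    then have "(\<Sum>j\<in>F. \<Sum>i\<in>G. (cmod (cinner (adj S (e i)) (e j)))\<^sup>2) \<le> (\<Sum>j\<in>F. (norm (S (e j)))\<^sup>2)"
      using Bessel[OF G] by (intro sum_mono) simp
    also have "\<dots> \<le> t" by (rule bound[OF that])
    finally show ?thesis .
  qed
  ultimately show ?thesis by (rule has_sum_le_finite_sums)
qed

text \<open>A bounded factor on the left costs at most \<open>c^2\<close> termwise. Passing to
  adjoints and back moves the right factor \<open>K\<close> to the left.\<close>

lemma Hilbert_Schmidt_compose:
  assumes S: "bounded_clinear S" and bound: "\<And>F. finite F \<Longrightarrow> (\<Sum>j\<in>F. (norm (S (e j)))\<^sup>2) \<le> t"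
    and K: "bounded_clinear K" "\<And>x. norm (K x) \<le> c * norm x" "0 \<le> c"
    and F: "finite F"
  shows "(\<Sum>j\<in>F. (norm (S (K (e j))))\<^sup>2) \<le> c\<^sup>2 * t"
proof -
  note bK = bounded_clinear_adj[OF K(1)] and bS = bounded_clinear_adj[OF S]
  have "(\<Sum>i\<in>G. (norm (adj K (adj S (e i))))\<^sup>2) \<le> c\<^sup>2 * t" if G: "finite G" for G
  proof -
    have "(\<Sum>i\<in>G. (norm (adj K (adj S (e i))))\<^sup>2) \<le> (\<Sum>i\<in>G. c\<^sup>2 * (norm (adj S (e i)))\<^sup>2)"
      using norm_adj_le[OF K] by (intro sum_mono) (metis norm_ge_zero power_mono power_mult_distrib)
    also have "\<dots> \<le> c\<^sup>2 * t"
      unfolding sum_distrib_left[symmetric]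
      by (intro mult_left_mono Hilbert_Schmidt_adj[OF S bound G]) auto
    finally show ?thesis .
  qed
  from Hilbert_Schmidt_adj[OF bounded_clinear_compose[OF bK bS] this F]
  show ?thesis by (simp add: adj_compose[OF bK bS] adj_adj S K)
qed

text \<open>With \<open>S\<close> the root of \<open>abs_op A\<close>, the operator \<open>A\<close>
  is the pointwise limit of \<open>V n S S\<close>, and \<open>cinner (V n (S (S x))) (D x) = cinner
  (S x) (S (adj (V n) (D x)))\<close> pairs two Hilbert-Schmidt operators. The bound
  \<open>2\<close> on \<open>D\<close> is chosen so that polar approximants of another operator can
  be inserted for \<open>D\<close>.\<close>

lemma trace_bound:
  assumes A: "A \<in> carr (B1 e)" and D: "bounded_clinear D" "\<And>x. norm (D x) \<le> 2 * norm x"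
    and F: "finite F"
  shows "(\<Sum>j\<in>F. cmod (cinner (A (e j)) (D (e j)))) \<le> 9 * nrm (B1 e) A"
proof -
  have bA: "bounded_clinear A"
    and summable: "(\<lambda>j. Re (cinner (abs_op A (e j)) (e j))) summable_on UNIV"
    using A by (auto simp: B1_def)
  define t where "t = nrm (B1 e) A"
  define P where "P = abs_op A"
  have P: "positive_op P" unfolding P_def by (rule abs_op(1)[OF bA])
  then obtain S where S: "positive_op S" "\<And>x. S (S x) = P x" using ex_sqrt by blast
  note bS = positive_opD(1)[OF S(1)]
  have Se: "(norm (S (e j)))\<^sup>2 = Re (cinner (P (e j)) (e j))" for j
    by (simp add: norm_sq_Re_cinner positive_op_symmetric[OF S(1), of "S (e j)"] flip: S(2))
  have HS: "(\<Sum>j\<in>F. (norm (S (e j)))\<^sup>2) \<le> t" if "finite F" for F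
    unfolding Se t_def B1_def P_def nspace.simps
    using positive_opD(3)[OF P] by (intro finite_sum_le_infsum summable that) (auto simp: P_def)
  obtain V where V: "\<And>n. bounded_clinear (V n)" "\<And>n x. norm (V n x) \<le> 2 * norm x"
    "\<And>x. (\<lambda>n. V n (abs_op A x)) \<longlonglongrightarrow> A x"
    "\<And>x. (\<lambda>n. cinner (A x) (V n x)) \<longlonglongrightarrow> cinner (abs_op A x) x"
    using polar_approximation[OF bA] by auto
  have "(\<Sum>j\<in>F. cmod (cinner (V n (P (e j))) (D (e j)))) \<le> 9 * t" for n
  proof -
    let ?K = "\<lambda>x. adj (V n) (D x)"
    have K: "bounded_clinear ?K" "norm (?K x) \<le> 4 * norm x" for x
      using norm_adj_le[OF V(1,2), of n "D x"] D(2)[of x]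
      by (auto intro!: bounded_clinear_compose[OF bounded_clinear_adj[OF V(1)] D(1)])
    have "cmod (cinner (V n (P (e j))) (D (e j)))
        \<le> ((norm (S (e j)))\<^sup>2 + (norm (S (?K (e j))))\<^sup>2) / 2" for j
    proof -
      have "cinner (V n (P (e j))) (D (e j)) = cinner (S (e j)) (S (?K (e j)))"
        by (simp add: adj[OF V(1)] positive_op_symmetric[OF S(1), of "S (e j)"] flip: S(2))
      then show ?thesis
        using cinner_Cauchy_Schwarz[of "S (e j)" "S (?K (e j))"]
          sum_squares_bound[of "norm (S (e j))" "norm (S (?K (e j)))"] by simp
    qed
    then have "(\<Sum>j\<in>F. cmod (cinner (V n (P (e j))) (D (e j))))
        \<le> (\<Sum>j\<in>F. ((norm (S (e j)))\<^sup>2 + (norm (S (?K (e j))))\<^sup>2) / 2)"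
      by (intro sum_mono)
    also have "\<dots> = ((\<Sum>j\<in>F. (norm (S (e j)))\<^sup>2) + (\<Sum>j\<in>F. (norm (S (?K (e j))))\<^sup>2)) / 2"
      by (simp add: sum.distrib flip: sum_divide_distrib)
    \<comment> \<open>\<open>adj (V n)\<close> and \<open>D\<close> are both bounded by
      \<open>2\<close>, whence the \<open>4\<close>; the resulting \<open>17/2\<close> is rounded up
      to \<open>9\<close>.\<close>
    also have "\<dots> \<le> (t + 4\<^sup>2 * t) / 2"
      by (intro divide_right_mono add_mono HS F Hilbert_Schmidt_compose[OF bS HS K]) auto
    also have "\<dots> \<le> 9 * t"
      using HS[of "{}"] by simp
    finally show ?thesis .
  qed
  moreover have "(\<lambda>n. \<Sum>j\<in>F. cmod (cinner (V n (P (e j))) (D (e j))))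
      \<longlonglongrightarrow> (\<Sum>j\<in>F. cmod (cinner (A (e j)) (D (e j))))"
    unfolding P_def by (intro tendsto_sum tendsto_norm tendsto_cinner V(3) tendsto_const)
  ultimately show ?thesis
    unfolding t_def by (intro Lim_bounded[where M = 0]) auto
qed

text \<open>The diagonal entries of the absolute value of \<open>C = A - B\<close> are limits of
  \<open>cinner (C (e j)) (V n (e j))\<close>, which is additive in \<open>C\<close>. The two parts
  are bounded by \<open>trace_bound\<close> uniformly in \<open>n\<close> and \<open>F\<close>.
  Without summability the infinite sum in the trace norm would be the default
  \<open>0\<close>.\<close>

lemma B1_diff:
  assumes A: "A \<in> carr (B1 e)" and B: "B \<in> carr (B1 e)"
  shows "A - B \<in> carr (B1 e)"
proof -
  have bA: "bounded_clinear A" and bB: "bounded_clinear B" using A B by (auto simp: B1_def)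
  define C where "C = A - B"
  have bC: "bounded_clinear C"
    unfolding C_def fun_diff_def by (intro bounded_clinear_intros bA bB)
  obtain V where V: "\<And>n. bounded_clinear (V n)" "\<And>n x. norm (V n x) \<le> 2 * norm x"
    "\<And>x. (\<lambda>n. V n (abs_op C x)) \<longlonglongrightarrow> C x"
    and lim: "\<And>x. (\<lambda>n. cinner (C x) (V n x)) \<longlonglongrightarrow> cinner (abs_op C x) x"
    using polar_approximation[OF bC] by auto
  let ?M = "9 * nrm (B1 e) A + 9 * nrm (B1 e) B"
  have "(\<Sum>j\<in>F. Re (cinner (abs_op C (e j)) (e j))) \<le> ?M" if F: "finite F" for F
  proof (rule Lim_bounded[where M = 0])
    show "(\<lambda>n. \<Sum>j\<in>F. Re (cinner (C (e j)) (V n (e j))))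
        \<longlonglongrightarrow> (\<Sum>j\<in>F. Re (cinner (abs_op C (e j)) (e j)))"
      by (intro tendsto_sum tendsto_Re lim)
    have "(\<Sum>j\<in>F. Re (cinner (C (e j)) (V n (e j)))) \<le> ?M" for n
    proof -
      have "Re (cinner (C (e j)) (V n (e j)))
          \<le> cmod (cinner (A (e j)) (V n (e j))) + cmod (cinner (B (e j)) (V n (e j)))" for j
        using complex_Re_le_cmod[of "cinner (C (e j)) (V n (e j))"]
          norm_triangle_ineq4[of "cinner (A (e j)) (V n (e j))" "cinner (B (e j)) (V n (e j))"]
        by (simp add: C_def cinner_diff_left)
      then have "(\<Sum>j\<in>F. Re (cinner (C (e j)) (V n (e j))))
          \<le> (\<Sum>j\<in>F. cmod (cinner (A (e j)) (V n (e j)))) + (\<Sum>j\<in>F. cmod (cinner (B (e j)) (V n (e j))))"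
        unfolding sum.distrib[symmetric] by (intro sum_mono)
      also have "\<dots> \<le> ?M"
        by (intro add_mono trace_bound A B V F)
      finally show ?thesis .
    qed
    then show "\<forall>n\<ge>0. (\<Sum>j\<in>F. Re (cinner (C (e j)) (V n (e j)))) \<le> ?M" by blast
  qed
  then have "(\<lambda>j. Re (cinner (abs_op C (e j)) (e j))) summable_on UNIV"
    using positive_opD(3)[OF abs_op(1)[OF bC]]
    by (intro nonneg_bdd_above_summable_on) (auto intro!: bdd_aboveI[where M = ?M])
  with bC show ?thesis by (simp add: B1_def C_def)
qed

lemma abs_op_positive:
  assumes "positive_op (P :: 'h \<Rightarrow> 'h)" shows "abs_op P = P"
proof (rule abs_op_eqI)
  have "adj P = P" by (rule adj_eqI) (rule positive_op_symmetric[OF assms])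
  then show "P (P x) = adj P (P x)" for x by simp
qed (use assms positive_opD in auto)

lemma positive_op_projection: "positive_op (rank_one (e i) (e i))"
proof (rule positive_opI)
  have "cinner (rank_one (e i) (e i) x) x = of_real ((cmod (cinner x (e i)))\<^sup>2)" for x
    by (simp add: rank_one_def cinner_scaleC_left complex_norm_square cinner_commute[of "e i" x]
        del: of_real_power)
  then show "Im (cinner (rank_one (e i) (e i) x) x) = 0" "0 \<le> Re (cinner (rank_one (e i) (e i) x) x)" for x
    by simp_all
qed (rule bounded_clinear_rank_one)

lemma B1_projection:
  assumes "0 \<le> r"
  shows "(\<lambda>x. complex_of_real r *\<^sub>C rank_one (e i) (e i) x) \<in> carr (B1 e)"
proof -
  have P: "positive_op (\<lambda>x. complex_of_real r *\<^sub>C rank_one (e i) (e i) x)"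
    by (rule positive_op_scale[OF positive_op_projection assms])
  moreover have "(\<lambda>j. Re (cinner (complex_of_real r *\<^sub>C rank_one (e i) (e i) (e j)) (e j)))
      summable_on UNIV"
    by (rule finite_nonzero_values_imp_summable_on)
      (rule finite_subset[of _ "{i}"], auto simp: rank_one_def cinner_e)
  ultimately show ?thesis
    using positive_opD(1)[OF P] by (simp add: B1_def abs_op_positive[OF P])
qed

end

subsection \<open>Compact operators\<close>

lemma compact_closure_subset: "S \<subseteq> K \<Longrightarrow> compact K \<Longrightarrow> compact (closure (S::'a::metric_space set))"
  by (metis closed_closure closure_minimal compact_Int_closed compact_imp_closed inf.absorb_iff2)

text \<open>Passing to the closure costs radius: a finite union of closed balls of radius
  \<open>\<epsilon>/2\<close> is closed, and it lies in the union of the open balls of radius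
  \<open>\<epsilon>\<close>.\<close>

lemma compact_closure_iff_totally_bounded:
  "compact (closure (S::'a::banach set)) \<longleftrightarrow> (\<forall>\<epsilon>>0. \<exists>k. finite k \<and> S \<subseteq> (\<Union>x\<in>k. ball x \<epsilon>))"
proof
  assume "compact (closure S)"
  then show "\<forall>\<epsilon>>0. \<exists>k. finite k \<and> S \<subseteq> (\<Union>x\<in>k. ball x \<epsilon>)"
    unfolding compact_eq_totally_bounded by (meson closure_subset order_trans)
next
  assume *: "\<forall>\<epsilon>>0. \<exists>k. finite k \<and> S \<subseteq> (\<Union>x\<in>k. ball x \<epsilon>)"
  have "\<exists>k. finite k \<and> closure S \<subseteq> (\<Union>x\<in>k. ball x \<epsilon>)" if "\<epsilon> > 0" for \<epsilon>
  proof -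
    obtain k where k: "finite k" "S \<subseteq> (\<Union>x\<in>k. ball x (\<epsilon>/2))"
      using *[rule_format, of "\<epsilon>/2"] \<open>\<epsilon> > 0\<close> by auto
    have "S \<subseteq> (\<Union>x\<in>k. cball x (\<epsilon>/2))"
      by (rule order_trans[OF k(2)]) (intro UN_mono order_refl ball_subset_cball)
    moreover have "closed (\<Union>x\<in>k. cball x (\<epsilon>/2))" using k(1) by (intro closed_UN) auto
    ultimately have "closure S \<subseteq> (\<Union>x\<in>k. cball x (\<epsilon>/2))" by (rule closure_minimal)
    also have "\<dots> \<subseteq> (\<Union>x\<in>k. ball x \<epsilon>)" by (intro UN_mono order_refl) (use that in auto)
    finally show ?thesis using k(1) by blast
  qed
  then show "compact (closure S)"
    unfolding compact_eq_totally_bounded by (simp add: complete_eq_closed)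
qed

lemma B0_carrD:
  assumes "A \<in> carr B0"
  shows "bounded_clinear A" "compact (closure (A ` cball 0 1))"
  using assms by (auto simp: B0_def)

lemma nrm_B0 [simp]: "nrm B0 = onorm"
  by (simp add: B0_def)

lemma B0_carrI:
  assumes "bounded_clinear A" "A ` cball 0 1 \<subseteq> K" "compact K"
  shows "A \<in> carr B0"
  using assms compact_closure_subset by (auto simp: B0_def)

lemma B0_add:
  assumes "A \<in> carr B0" "B \<in> carr B0"
  shows "A + B \<in> carr B0"
proof (rule B0_carrI)
  show "bounded_clinear (A + B)"
    unfolding plus_fun_def by (intro bounded_clinear_intros B0_carrD assms)
  show "compact ((\<lambda>p. fst p + snd p) ` (closure (A ` cball 0 1) \<times> closure (B ` cball 0 1)))"
    by (intro compact_continuous_image compact_Times B0_carrD assms continuous_intros)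
  show "(A + B) ` cball 0 1
      \<subseteq> (\<lambda>p. fst p + snd p) ` (closure (A ` cball 0 1) \<times> closure (B ` cball 0 1))"
  proof clarify
    fix h :: 'a assume "h \<in> cball 0 1"
    then have "(A h, B h) \<in> closure (A ` cball 0 1) \<times> closure (B ` cball 0 1)"
      using closure_subset[of "A ` cball 0 1"] closure_subset[of "B ` cball 0 1"] by blast
    then show "(A + B) h
        \<in> (\<lambda>p. fst p + snd p) ` (closure (A ` cball 0 1) \<times> closure (B ` cball 0 1))"
      by (rule rev_image_eqI) (simp add: plus_fun_def)
  qed
qed

lemma B0_compose:
  assumes R: "bounded_clinear R" and A: "A \<in> carr B0"
  shows "R \<circ> A \<in> carr B0"
proof (rule B0_carrI)
  show "bounded_clinear (R \<circ> A)"
    unfolding comp_def by (rule bounded_clinear_compose[OF R B0_carrD(1)[OF A]])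
  show "compact (R ` closure (A ` cball 0 1))"
    using linear_continuous_on[OF bounded_clinearD(1)[OF R]] B0_carrD(2)[OF A]
    by (intro compact_continuous_image)
  show "(R \<circ> A) ` cball 0 1 \<subseteq> R ` closure (A ` cball 0 1)"
    using closure_subset[of "A ` cball 0 1"] by auto
qed

lemma B0_scaleC:
  assumes A: "A \<in> carr B0"
  shows "c *\<^sub>C A \<in> carr B0"
  using B0_compose[OF bounded_clinear_scaleC[OF bounded_clinear_id, of c] A]
  by (simp add: scaleC_fun_def comp_def)

lemma B0_zero: "0 \<in> carr B0"
  by (rule B0_carrI[of _ "{0}"]) (auto simp: zero_fun_def bounded_clinear_zero)

lemma B0_sum: "(\<And>j. j \<in> F \<Longrightarrow> f j \<in> carr B0) \<Longrightarrow> sum f F \<in> carr B0"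
  by (induction F rule: infinite_finite_induct) (auto intro: B0_zero B0_add)

lemma B0_rank_one: "rank_one u v \<in> carr B0"
proof (rule B0_carrI)
  show "compact ((\<lambda>c. c *\<^sub>C v) ` cball 0 (norm u))"
    by (intro compact_continuous_image compact_cball
        linear_continuous_on bounded_bilinear.bounded_linear_left[OF bounded_bilinear_scaleC])
  show "rank_one u v ` cball 0 1 \<subseteq> (\<lambda>c. c *\<^sub>C v) ` cball 0 (norm u)"
  proof (clarsimp simp: rank_one_def)
    fix h :: 'a assume "norm h \<le> 1"
    then have "cmod (cinner h u) \<le> norm u"
      using cinner_Cauchy_Schwarz[of h u] mult_right_mono[of "norm h" 1 "norm u"] by simp
    then show "cinner h u *\<^sub>C v \<in> (\<lambda>c. c *\<^sub>C v) ` cball 0 (norm u)" by simp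
  qed
qed (rule bounded_clinear_rank_one)

text \<open>A finite \<open>\<epsilon>/2\<close>-net for the image of the unit ball under
  \<open>B\<close> is an \<open>\<epsilon>\<close>-net for its image under \<open>A\<close>.\<close>

lemma B0_limit:
  assumes A: "bounded_clinear A"
    and lim: "\<And>\<epsilon>. \<epsilon> > 0 \<Longrightarrow> \<exists>B\<in>carr B0. \<forall>x. norm (B x - A x) \<le> \<epsilon> * norm (x::'h::chilbert_space)"
  shows "A \<in> carr B0"
proof -
  have "\<exists>k. finite k \<and> A ` cball 0 1 \<subseteq> (\<Union>x\<in>k. ball x \<epsilon>)" if "\<epsilon> > 0" for \<epsilon>
  proof -
    have "\<epsilon> / 2 > 0" using that by simp
    then obtain B where B: "B \<in> carr B0" "\<And>x. norm (B x - A x) \<le> \<epsilon> / 2 * norm x"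
      using lim by blast
    obtain k where k: "finite k" "B ` cball 0 1 \<subseteq> (\<Union>x\<in>k. ball x (\<epsilon> / 2))"
      using B0_carrD(2)[OF B(1)] \<open>\<epsilon> / 2 > 0\<close> unfolding compact_closure_iff_totally_bounded by blast
    have "A h \<in> (\<Union>x\<in>k. ball x \<epsilon>)" if h: "norm h \<le> 1" for h
    proof -
      have "B h \<in> B ` cball 0 1" using h by (intro imageI) simp
      then have "B h \<in> (\<Union>x\<in>k. ball x (\<epsilon> / 2))" using k(2) by blast
      then obtain x where x: "x \<in> k" "dist x (B h) < \<epsilon> / 2" by auto
      have "norm (B h - A h) \<le> \<epsilon> / 2"
        using B(2)[of h] h mult_left_mono[of "norm h" 1 "\<epsilon> / 2"] \<open>\<epsilon> > 0\<close> by linarith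
      then have "dist x (A h) < \<epsilon>"
        using x(2) dist_triangle[of x "A h" "B h"] by (simp add: dist_norm[of "B h"])
      then show ?thesis using x(1) by auto
    qed
    with k(1) show ?thesis by (auto intro!: exI[of _ k])
  qed
  then show ?thesis
    using A by (simp add: B0_def compact_closure_iff_totally_bounded)
qed

section \<open>Norm convergent series of compact operators\<close>

lemma sum_fun_apply: "(\<Sum>j\<in>F. f j) h = (\<Sum>j\<in>F. f j (h :: 'a) :: 'b::comm_monoid_add)"
  by (induction F rule: infinite_finite_induct) (auto simp: zero_fun_def plus_fun_def)

lemma norm_sums_B0_pointwise:
  assumes "norm_sums B0 f s" and f: "\<And>j. bounded_clinear (f j)"
  shows "(\<lambda>j. f j h) sums s h"
proof -
  have s: "bounded_clinear s" using assms(1) by (simp add: norm_sums_def B0_carrD)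
  have b: "bounded_clinear ((\<Sum>j<n. f j) - s)" for n
    unfolding fun_diff_def sum_fun_apply by (intro bounded_clinear_intros s f)
  have "(\<lambda>n. onorm ((\<Sum>j<n. f j) - s) * norm h) \<longlonglongrightarrow> 0 * norm h"
    using assms(1) by (intro tendsto_mult tendsto_const) (simp add: norm_sums_def)
  then have "(\<lambda>n. onorm ((\<Sum>j<n. f j) - s) * norm h) \<longlonglongrightarrow> 0" by simp
  moreover have "\<forall>\<^sub>F n in sequentially. norm ((\<Sum>j<n. f j h) - s h)
      \<le> onorm ((\<Sum>j<n. f j) - s) * norm h"
    using bounded_clinearD(8)[OF b, of _ h] by (simp add: fun_diff_def sum_fun_apply)
  ultimately have "(\<lambda>n. (\<Sum>j<n. f j h) - s h) \<longlonglongrightarrow> 0"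
    by (rule Lim_null_comparison[rotated])
  then show ?thesis unfolding sums_def by (rule LIM_zero_cancel)
qed

text \<open>Norm limits are pointwise limits. This lets the definite description in
  \<open>module_form\<close> denote.\<close>

lemma norm_sums_B0_unique:
  assumes "norm_sums B0 f s" "norm_sums B0 f s'" "\<And>j. bounded_clinear (f j)"
  shows "s = s'"
  using norm_sums_B0_pointwise[OF assms(1,3)] norm_sums_B0_pointwise[OF assms(2,3)] sums_unique2
  by (intro ext) blast

text \<open>Completeness of the compact operators. The estimate is uniform in \<open>h\<close>
  relative to \<open>norm h\<close>, so the pointwise limit is also the limit in operator norm, and
  \<open>B0_limit\<close> makes it compact.\<close>

lemma norm_sums_B0_Cauchy:
  assumes f: "\<And>j. f j \<in> carr B0"
    and Cauchy: "\<And>\<epsilon>. \<epsilon> > 0 \<Longrightarrow>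
      \<exists>N. \<forall>m\<ge>N. \<forall>n\<ge>m. \<forall>h. norm (\<Sum>j=m..<n. f j h) \<le> \<epsilon> * norm (h::'h::chilbert_space)"
  shows "\<exists>s. norm_sums B0 f s"
proof -
  define P where "P n h = (\<Sum>j<n. f j h)" for n h
  have PB: "P n \<in> carr B0" for n
  proof -
    have "P n = (\<Sum>j<n. f j)" by (simp add: fun_eq_iff P_def sum_fun_apply)
    then show ?thesis by (simp add: B0_sum f)
  qed
  note bP = B0_carrD(1)[OF PB]
  have diff: "norm (P n h - P m h) = norm (\<Sum>j=m..<n. f j h)" if "m \<le> n" for m n h
    using sum_diff_nat_ivl[of 0 m n "\<lambda>j. f j h"] that by (simp add: P_def lessThan_atLeast0)
  have Cauchy': "\<exists>N. \<forall>m\<ge>N. \<forall>n\<ge>m. \<forall>h. norm (P n h - P m h) \<le> \<epsilon> * norm h" if "\<epsilon> > 0" for \<epsilon>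
    using Cauchy[OF that] diff by metis
  have "convergent (\<lambda>n. P n h)" for h
  proof (rule Cauchy_convergent, rule CauchyI')
    fix \<epsilon> :: real assume "\<epsilon> > 0"
    define \<delta> where "\<delta> = \<epsilon> / (norm h + 1)"
    have pos: "norm h + 1 > 0" by (simp add: add_nonneg_pos)
    have \<delta>: "\<delta> > 0" unfolding \<delta>_def using \<open>\<epsilon> > 0\<close> pos by (intro divide_pos_pos) auto
    have "\<delta> * (norm h + 1) = \<epsilon>"
      using nonzero_eq_divide_eq[of "norm h + 1" \<delta> "\<epsilon>"] pos \<delta>_def by (metis less_irrefl)
    then have small: "\<delta> * norm h < \<epsilon>" using \<delta> by (simp add: distrib_left)
    obtain N where "\<forall>m\<ge>N. \<forall>n\<ge>m. \<forall>h. norm (P n h - P m h) \<le> \<delta> * norm h"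
      using Cauchy'[OF \<delta>] by blast
    then have "dist (P m h) (P n h) < \<epsilon>" if "m \<ge> N" "n > m" for m n
      using that small by (simp add: dist_norm norm_minus_commute) (meson le_less_trans less_imp_le)
    then show "\<exists>M. \<forall>m\<ge>M. \<forall>n>m. dist (P m h) (P n h) < \<epsilon>" by blast
  qed
  then obtain s where s: "\<And>h. (\<lambda>n. P n h) \<longlonglongrightarrow> s h"
    unfolding convergent_def by metis
  have close: "\<exists>N. \<forall>m\<ge>N. \<forall>h. norm (P m h - s h) \<le> \<epsilon> * norm h" if \<epsilon>: "\<epsilon> > 0" for \<epsilon>
  proof -
    obtain N where N: "\<And>m n h. m \<ge> N \<Longrightarrow> n \<ge> m \<Longrightarrow> norm (P n h - P m h) \<le> \<epsilon> * norm h"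
      using Cauchy'[OF \<epsilon>] by blast
    have "norm (s h - P m h) \<le> \<epsilon> * norm h" if "m \<ge> N" for m h
      by (rule Lim_bounded[OF tendsto_norm[OF tendsto_diff[OF s tendsto_const]], of m])
        (use N[OF that] in auto)
    then show ?thesis by (auto simp: norm_minus_commute intro!: exI[of _ N])
  qed
  have bs: "bounded_clinear s"
  proof -
    obtain N where N: "\<And>h. norm (P N h - s h) \<le> 1 * norm h"
      using close[of 1] by auto
    show ?thesis
    proof (rule bounded_clinearI[where K = "onorm (P N) + 1"])
      fix x y c
      have "(\<lambda>n. P n (x + y)) \<longlonglongrightarrow> s x + s y"
        unfolding bounded_clinear_simps[OF bP] by (intro tendsto_add s)
      then show "s (x + y) = s x + s y" using s LIMSEQ_unique by blast
      have "(\<lambda>n. P n (c *\<^sub>C x)) \<longlonglongrightarrow> c *\<^sub>C s x"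
        unfolding bounded_clinear_simps[OF bP] by (intro tendsto_scaleC tendsto_const s)
      then show "s (c *\<^sub>C x) = c *\<^sub>C s x" using s LIMSEQ_unique by blast
      show "norm (s x) \<le> (onorm (P N) + 1) * norm x"
        using N[of x] bounded_clinearD(8)[OF bP, of N x] norm_triangle_ineq4[of "P N x" "P N x - s x"]
        by (simp add: algebra_simps)
    qed
  qed
  have sB: "s \<in> carr B0"
    by (rule B0_limit[OF bs]) (metis close PB order_refl)
  have eq: "(\<Sum>j<n. f j) - s = (\<lambda>h. P n h - s h)" for n
    by (simp add: fun_eq_iff fun_diff_def sum_fun_apply P_def)
  have "(\<lambda>n. onorm ((\<Sum>j<n. f j) - s)) \<longlonglongrightarrow> 0"
  proof (rule LIMSEQ_I)
    fix r :: real assume "r > 0"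
    then obtain N where N: "\<And>m h. m \<ge> N \<Longrightarrow> norm (P m h - s h) \<le> r / 2 * norm h"
      using close[of "r / 2"] by auto
    have "norm (onorm ((\<Sum>j<n. f j) - s) - 0) < r" if "n \<ge> N" for n
    proof -
      have "onorm ((\<Sum>j<n. f j) - s) \<le> r / 2"
        unfolding eq using N[OF that] \<open>r > 0\<close> by (intro onorm_bound) auto
      moreover have "0 \<le> onorm ((\<Sum>j<n. f j) - s)"
        unfolding eq by (intro onorm_nonneg bounded_clinear_intros bs bP)
      ultimately show ?thesis using \<open>r > 0\<close> by simp
    qed
    then show "\<exists>N. \<forall>n\<ge>N. norm (onorm ((\<Sum>j<n. f j) - s) - 0) < r" by blast
  qed
  with sB show ?thesis by (auto simp: norm_sums_def)
qed

section \<open>Attainment of the norm by compact operators\<close>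

context orthonormal
begin

text \<open>For a maximising sequence \<open>h\<^sub>n\<close> in the unit ball, \<open>\<parallel>A\<^sup>* A h\<^sub>n - \<parallel>A\<parallel>\<^sup>2 h\<^sub>n\<parallel>\<close> tends to \<open>0\<close>, so
  convergence of (a subsequence of) \<open>A h\<^sub>n\<close> forces convergence of \<open>h\<^sub>n\<close>.\<close>

lemma B0_attains_onorm:
  assumes A: "A \<in> carr B0" and nz: "A \<noteq> (0 :: 'h \<Rightarrow> 'h)"
  obtains h where "norm h = 1" "norm (A h) = onorm A"
proof -
  note bA = B0_carrD(1)[OF A]
  define l where "l = onorm A"
  have "l \<noteq> 0"
    using nz onorm_eq_0[OF bounded_clinearD(1)[OF bA]] by (auto simp: l_def fun_eq_iff)
  then have l: "l > 0" using onorm_nonneg[OF bA] by (simp add: l_def)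
  have Al: "norm (A x) \<le> l * norm x" for x unfolding l_def by (rule bounded_clinearD(8)[OF bA])
  have "\<exists>h. norm h = 1 \<and> l - 1 / Suc n < norm (A h)" for n
  proof -
    \<comment> \<open>\<open>onorm_bound\<close> asks for a nonnegative constant, while
      \<open>l - 1 / Suc n\<close> may be negative.\<close>
    define m where "m = max 0 (l - 1 / Suc n)"
    have m: "0 \<le> m" "l - 1 / Suc n \<le> m" by (auto simp: m_def)
    have "m < l" using l by (simp add: m_def)
    then have "\<not> onorm A \<le> m" unfolding l_def by (simp only: not_le)
    then obtain x where x: "norm (A x) > m * norm x"
      by (meson m(1) not_le onorm_bound)
    then have "x \<noteq> 0" by (auto simp: bounded_clinear_simps[OF bA])
    let ?h = "complex_of_real (1 / norm x) *\<^sub>C x"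
    have "norm ?h = 1" using \<open>x \<noteq> 0\<close> by (simp add: norm_scaleC norm_divide)
    moreover have "m < norm (A ?h)"
      using x \<open>x \<noteq> 0\<close> by (simp add: bounded_clinear_simps[OF bA] norm_scaleC norm_divide pos_less_divide_eq)
    ultimately show ?thesis using m(2) by (intro exI[of _ ?h]) linarith
  qed
  then obtain h where h1: "\<And>n. norm (h n) = 1" and h: "\<And>n. l - 1 / Suc n < norm (A (h n))"
    by metis
  have "A (h n) \<in> closure (A ` cball 0 1)" for n
    using closure_subset[of "A ` cball 0 1"] h1[of n] by auto
  then obtain w r where r: "strict_mono r" and w: "((\<lambda>n. A (h n)) \<circ> r) \<longlonglongrightarrow> w"
    using B0_carrD(2)[OF A] unfolding compact_def by metis
  define k where "k = h \<circ> r"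
  have k1: "norm (k n) = 1" for n by (simp add: k_def h1)
  have Ak: "(\<lambda>n. A (k n)) \<longlonglongrightarrow> w" using w by (simp add: k_def comp_def)
  have nAk: "(\<lambda>n. norm (A (k n))) \<longlonglongrightarrow> l"
  proof (rule tendsto_sandwich)
    have "(\<lambda>n. l - 1 / real (Suc n)) \<longlonglongrightarrow> l - 0"
      by (intro tendsto_diff tendsto_const LIMSEQ_Suc[OF lim_1_over_n])
    from LIMSEQ_subseq_LIMSEQ[OF this r]
    show "(\<lambda>n. l - 1 / real (Suc (r n))) \<longlonglongrightarrow> l" by (simp add: comp_def)
    show "\<forall>\<^sub>F n in sequentially. l - 1 / real (Suc (r n)) \<le> norm (A (k n))"
      using h by (simp add: k_def less_imp_le)
    show "\<forall>\<^sub>F n in sequentially. norm (A (k n)) \<le> l"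
      using Al k1 by (metis (mono_tags, lifting) always_eventually mult.right_neutral)
  qed simp
  define d where "d n = adj A (A (k n)) - complex_of_real (l\<^sup>2) *\<^sub>C k n" for n
  \<comment> \<open>In the expanded square only the first term is estimated, by
    \<open>norm (adj A z) <= l * norm z\<close>. What remains is \<open>l^2\<close> times a gap that
    closes along the maximising sequence.\<close>
  have dn: "(norm (d n))\<^sup>2 \<le> l\<^sup>2 * (l\<^sup>2 - (norm (A (k n)))\<^sup>2)" for n
  proof -
    have "(norm (d n))\<^sup>2 = (norm (adj A (A (k n))))\<^sup>2 - 2 * l\<^sup>2 * (norm (A (k n)))\<^sup>2 + l\<^sup>2 * l\<^sup>2"
    proof -
      have "Re (cinner (adj A (A (k n))) (complex_of_real (l\<^sup>2) *\<^sub>C k n)) = l\<^sup>2 * (norm (A (k n)))\<^sup>2"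
        by (simp add: adj'[OF bA] cinner_scaleC_right cinner_self flip: of_real_power of_real_mult)
      moreover have "(norm (complex_of_real (l\<^sup>2) *\<^sub>C k n))\<^sup>2 = l\<^sup>2 * l\<^sup>2"
        using l by (simp add: norm_scaleC k1 power2_eq_square norm_mult)
      ultimately show ?thesis unfolding d_def norm_diff_sq by simp
    qed
    also have "(norm (adj A (A (k n))))\<^sup>2 \<le> (l * norm (A (k n)))\<^sup>2"
      using norm_adj_le[OF bA Al] l by (intro power_mono) auto
    finally show ?thesis by (simp add: power_mult_distrib algebra_simps)
  qed
  have "(\<lambda>n. (norm (d n))\<^sup>2) \<longlonglongrightarrow> 0"
  proof (rule tendsto_sandwich[OF _ _ tendsto_const])
    have "(\<lambda>n. l\<^sup>2 * (l\<^sup>2 - (norm (A (k n)))\<^sup>2)) \<longlonglongrightarrow> l\<^sup>2 * (l\<^sup>2 - l\<^sup>2)"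
      by (intro tendsto_intros nAk)
    then show "(\<lambda>n. l\<^sup>2 * (l\<^sup>2 - (norm (A (k n)))\<^sup>2)) \<longlonglongrightarrow> 0" by simp
  qed (use dn in auto)
  then have "(\<lambda>n. sqrt ((norm (d n))\<^sup>2)) \<longlonglongrightarrow> sqrt 0" by (rule tendsto_real_sqrt)
  then have d0: "d \<longlonglongrightarrow> 0" using tendsto_norm_zero_cancel[of d] by simp
  define v where "v = complex_of_real (1 / l\<^sup>2) *\<^sub>C adj A w"
  have "k \<longlonglongrightarrow> v"
  proof -
    \<comment> \<open>The definition of \<open>d n\<close> is solved for \<open>k n\<close>, so that
      the right hand side involves \<open>k n\<close> only through \<open>A (k n)\<close> and a null
      sequence.\<close>
    have "k n = complex_of_real (1 / l\<^sup>2) *\<^sub>C (adj A (A (k n)) - d n)" for n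
      using l by (simp add: d_def scaleC_scaleC scaleC_one flip: of_real_mult of_real_power)
    moreover have "(\<lambda>n. complex_of_real (1 / l\<^sup>2) *\<^sub>C (adj A (A (k n)) - d n))
        \<longlonglongrightarrow> complex_of_real (1 / l\<^sup>2) *\<^sub>C (adj A w - 0)"
      by (intro tendsto_scaleC tendsto_const tendsto_diff d0
          bounded_linear.tendsto[OF bounded_clinearD(1)[OF bounded_clinear_adj[OF bA]] Ak])
    ultimately show ?thesis by (simp add: v_def)
  qed
  have "(\<lambda>n. norm (k n)) \<longlonglongrightarrow> norm v" by (intro tendsto_norm \<open>k \<longlonglongrightarrow> v\<close>)
  then have "norm v = 1" by (simp add: k1 LIMSEQ_const_iff)
  moreover have "(\<lambda>n. norm (A (k n))) \<longlonglongrightarrow> norm (A v)"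
    by (intro tendsto_norm bounded_linear.tendsto[OF bounded_clinearD(1)[OF bA] \<open>k \<longlonglongrightarrow> v\<close>])
  then have "norm (A v) = l" using nAk LIMSEQ_unique by blast
  ultimately show ?thesis using that l_def by blast
qed

text \<open>At a unit vector with \<open>norm (P h) = onorm P\<close> the inequality
  \<open>(norm (P h))^2 <= onorm P * Re (cinner (P h) h)\<close> pushes the form up to
  \<open>onorm P\<close>. The module calls for the form, since its squared norm is the norm of a
  positive operator.\<close>

lemma positive_B0_attains_onorm:
  assumes P: "P \<in> carr B0" "positive_op P" and nz: "P \<noteq> (0 :: 'h \<Rightarrow> 'h)"
  obtains h where "norm h = 1" "Re (cinner (P h) h) = onorm P"
proof -
  note bP = B0_carrD(1)[OF P(1)]
  obtain h where h: "norm h = 1" "norm (P h) = onorm P" by (rule B0_attains_onorm[OF P(1) nz])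
  have pos: "onorm P > 0"
    using nz onorm_pos_lt[OF bounded_clinearD(1)[OF bP]] by (auto simp: fun_eq_iff)
  have "onorm P * onorm P \<le> onorm P * Re (cinner (P h) h)"
    using positive_op_norm_sq_le[OF P(2) bounded_clinearD(8)[OF bP], of h] h
    by (simp add: power2_eq_square)
  then have "onorm P \<le> Re (cinner (P h) h)" using pos by simp
  moreover have "Re (cinner (P h) h) \<le> onorm P"
    using cinner_Cauchy_Schwarz[of "P h" h] complex_Re_le_cmod[of "cinner (P h) h"] h by simp
  ultimately show ?thesis using that h by fastforce
qed

end

subsection \<open>Norming functionals and numerical hypercyclicity\<close>

lemma scaleC_fun_apply: "(c *\<^sub>C f) x = c *\<^sub>C f x"
  by (simp add: scaleC_fun_def)

text \<open>Scalars as a Hilbert space, so that \<open>ell2\<close> fits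
  \<open>square_sum_space\<close> with its entries as coordinates.\<close>

instantiation complex :: chilbert_space
begin
definition cinner_complex :: "complex \<Rightarrow> complex \<Rightarrow> complex"
  where "cinner_complex x y = x * cnj y"
instance
  by standard
    (auto simp: cinner_complex_def scaleC_complex_def scaleR_conv_of_real algebra_simps cmod_def
      power2_eq_square)
end

text \<open>The Hahn-Banach conclusion together with definiteness of the norm. Each of the four
  spaces satisfies it by an explicit functional.\<close>

definition norming :: "'x::complex_vector nspace \<Rightarrow> bool"
  where "norming X \<longleftrightarrow> (\<forall>x\<in>carr X. x \<noteq> 0 \<longrightarrow> 0 < nrm X x \<and>
    (\<exists>f\<in>carr (dual X). f x = of_real (nrm X x) \<and> (\<forall>y\<in>carr X. cmod (f y) \<le> nrm X y)))"

lemma linear_on_carrD: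
  assumes "linear_on_carr X f"
  shows "x \<in> carr X \<Longrightarrow> y \<in> carr X \<Longrightarrow> f (x + y) = f x + f y"
    "x \<in> carr X \<Longrightarrow> f (c *\<^sub>C x) = c *\<^sub>C f x"
  using assms by (auto simp: linear_on_carr_def)

lemma bounded_opsD:
  assumes "T \<in> bounded_ops X"
  shows "linear_on_carr X T" "x \<in> carr X \<Longrightarrow> T x \<in> carr X"
  using assms by (auto simp: bounded_ops_def)

lemma bounded_ops_funpow:
  "T \<in> bounded_ops X \<Longrightarrow> x \<in> carr X \<Longrightarrow> (T ^^ n) x \<in> carr X"
  by (induction n) (auto intro: bounded_opsD)

locale complex_nspace =
  fixes X :: "'x::complex_vector nspace"
  assumes carr_add: "x \<in> carr X \<Longrightarrow> y \<in> carr X \<Longrightarrow> x + y \<in> carr X"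
    and carr_scaleC: "x \<in> carr X \<Longrightarrow> c *\<^sub>C x \<in> carr X"
    and nrm_scaleC: "x \<in> carr X \<Longrightarrow> nrm X (c *\<^sub>C x) = cmod c * nrm X x"
begin

lemma carr_diff: "x \<in> carr X \<Longrightarrow> y \<in> carr X \<Longrightarrow> x - y \<in> carr X"
  using carr_add[OF _ carr_scaleC[of y "-1"], of x] by (simp add: scaleC_minus_one)

lemma linear_on_carr_diff:
  assumes "linear_on_carr X f" "x \<in> carr X" "y \<in> carr X"
  shows "f (x - y) = f x - f y"
  using linear_on_carrD(1)[OF assms(1,2) carr_scaleC[OF assms(3), of "-1"]]
    linear_on_carrD(2)[OF assms(1,3), of "-1"] by (simp add: scaleC_minus_one)

lemma nrm_zero: "x \<in> carr X \<Longrightarrow> nrm X 0 = 0"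
  using nrm_scaleC[of x 0] by simp

lemma normalise:
  assumes "x \<in> carr X" "0 < nrm X x"
  shows "complex_of_real (1 / nrm X x) *\<^sub>C x \<in> unit_sphere X"
  using assms by (simp add: unit_sphere_def carr_scaleC nrm_scaleC norm_divide)

lemma ex_num_state:
  assumes "norming X" "x \<in> unit_sphere X"
  shows "\<exists>f. (x, f) \<in> num_states X \<and> linear_on_carr X f \<and> (\<forall>y\<in>carr X. cmod (f y) \<le> nrm X y)"
proof -
  have x: "x \<in> carr X" "nrm X x = 1" using assms(2) by (auto simp: unit_sphere_def)
  then have "x \<noteq> 0" using nrm_zero[OF x(1)] by auto
  then obtain f where f: "f \<in> carr (dual X)" "f x = 1" "\<And>y. y \<in> carr X \<Longrightarrow> cmod (f y) \<le> nrm X y"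
    using assms(1) x unfolding norming_def by fastforce
  have "nrm (dual X) f = 1"
    unfolding dual_def nspace.simps
    by (rule cSup_eq_maximum) (use x f(2,3) in \<open>force intro!: image_eqI[of _ _ x]\<close>)+
  with x f(1,2) have "(x, f) \<in> num_states X" by (simp add: num_states_def unit_sphere_def)
  moreover have "linear_on_carr X f" using f(1) by (simp add: dual_def)
  ultimately show ?thesis using f(3) by blast
qed

lemma dual_bound:
  assumes nn: "\<And>y. y \<in> carr X \<Longrightarrow> 0 \<le> nrm X y" and f: "f \<in> carr (dual X)" and y: "y \<in> carr X"
  shows "cmod (f y) \<le> nrm (dual X) f * nrm X y"
proof -
  obtain K where lin: "linear_on_carr X f" and K: "\<And>x. x \<in> carr X \<Longrightarrow> cmod (f x) \<le> K * nrm X x"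
    using f by (auto simp: dual_def)
  show ?thesis
  proof (cases "nrm X y = 0")
    \<comment> \<open>A vector of norm \<open>0\<close> cannot be normalised; there the bound by
      \<open>K\<close> forces \<open>f y = 0\<close>.\<close>
    case True
    then show ?thesis using K[OF y] by simp
  next
    case False
    then have pos: "0 < nrm X y" using nn[OF y] by simp
    define z where "z = complex_of_real (1 / nrm X y) *\<^sub>C y"
    have z: "z \<in> carr X" "nrm X z = 1" using normalise[OF y pos] by (auto simp: z_def unit_sphere_def)
    have "bdd_above ((\<lambda>x. cmod (f x)) ` {x \<in> carr X. nrm X x \<le> 1})"
    proof (rule bdd_aboveI2)
      fix x assume x: "x \<in> {x \<in> carr X. nrm X x \<le> 1}"
      then have "K * nrm X x \<le> \<bar>K\<bar> * nrm X x" using nn by (intro mult_right_mono) auto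
      also have "\<dots> \<le> \<bar>K\<bar>" using x nn mult_left_mono[of "nrm X x" 1 "\<bar>K\<bar>"] by auto
      finally show "cmod (f x) \<le> \<bar>K\<bar>" using K[of x] x by simp
    qed
    then have "cmod (f z) \<le> nrm (dual X) f"
      unfolding dual_def nspace.simps by (rule cSUP_upper[rotated]) (use z in auto)
    moreover have "cmod (f z) = cmod (f y) / nrm X y"
      using pos by (simp add: z_def linear_on_carrD(2)[OF lin y] scaleC_complex_def norm_divide)
    ultimately show ?thesis using pos by (simp add: pos_divide_le_eq)
  qed
qed

lemma dual_diff:
  assumes nn: "\<And>y. y \<in> carr X \<Longrightarrow> 0 \<le> nrm X y" and f: "f \<in> carr (dual X)" and g: "g \<in> carr (dual X)"
  shows "f - g \<in> carr (dual X)"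
proof -
  have "cmod ((f - g) y) \<le> (nrm (dual X) f + nrm (dual X) g) * nrm X y" if "y \<in> carr X" for y
    using dual_bound[OF nn f that] dual_bound[OF nn g that] norm_triangle_ineq4[of "f y" "g y"]
    by (simp add: distrib_right)
  then have "\<exists>K. \<forall>y\<in>carr X. cmod ((f - g) y) \<le> K * nrm X y" by blast
  then show ?thesis
    using f g by (auto simp: dual_def linear_on_carr_def scaleC_complex_def algebra_simps)
qed

text \<open>If \<open>S = B T A\<close> with \<open>A = B\<^sup>-\<^sup>1\<close>, the orbit of \<open>B x\<^sub>0\<close> under \<open>S\<close> still approximates all multiples
  of \<open>B x\<^sub>0\<close>, and any norming functional of \<open>B x\<^sub>0\<close> maps these multiples onto the plane.\<close>

lemma strongly_numerically_hypercyclicI: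
  assumes norming: "norming X" and T: "T \<in> bounded_ops X" and x0: "x0 \<in> carr X" "x0 \<noteq> 0"
    and approx: "\<And>c \<epsilon>. 0 < \<epsilon> \<Longrightarrow> \<exists>n. nrm X ((T ^^ n) x0 - c *\<^sub>C x0) < \<epsilon>"
  shows "strongly_numerically_hypercyclic X T"
  unfolding strongly_numerically_hypercyclic_def
proof (intro ballI impI)
  fix S assume S: "S \<in> bounded_ops X" and "similar_ops X S T"
  then obtain A B where A: "A \<in> bounded_ops X" and B: "B \<in> bounded_ops X"
    and inv: "\<And>x. x \<in> carr X \<Longrightarrow> A (B x) = x" and SBTA: "\<And>x. x \<in> carr X \<Longrightarrow> S x = B (T (A x))"
    unfolding similar_ops_def by blast
  define x1 where "x1 = B x0"
  have x1: "x1 \<in> carr X" unfolding x1_def by (rule bounded_opsD(2)[OF B x0(1)])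
  have "A 0 = 0"
    using linear_on_carrD(2)[OF bounded_opsD(1)[OF A] x0(1), of 0] by simp
  then have "x1 \<noteq> 0" using inv[OF x0(1)] x0(2) by (auto simp: x1_def)
  define r where "r = nrm X x1"
  have r: "r > 0" using norming x1 \<open>x1 \<noteq> 0\<close> unfolding norming_def r_def by blast
  define x where "x = complex_of_real (1 / r) *\<^sub>C x1"
  have x: "x \<in> unit_sphere X" using normalise[OF x1] r by (simp add: x_def r_def)
  obtain f where state: "(x, f) \<in> num_states X" and lf: "linear_on_carr X f"
    and fle: "\<And>y. y \<in> carr X \<Longrightarrow> cmod (f y) \<le> nrm X y"
    using ex_num_state[OF norming x] by blast
  have fx1: "f x1 = of_real r"
    using state r by (simp add: num_states_def x_def linear_on_carrD(2)[OF lf x1] scaleC_complex_def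
        field_simps)
  note orb = bounded_ops_funpow[OF T x0(1)]
  have Sn: "(S ^^ n) x = complex_of_real (1 / r) *\<^sub>C B ((T ^^ n) x0)" for n
  proof (induction n)
    case (Suc n)
    note b = bounded_opsD(2)[OF B orb[of n]]
    have "(S ^^ Suc n) x = complex_of_real (1 / r) *\<^sub>C S (B ((T ^^ n) x0))"
      using linear_on_carrD(2)[OF bounded_opsD(1)[OF S] b] by (simp add: Suc)
    then show ?case by (simp add: SBTA[OF b] inv[OF orb])
  qed (simp add: x_def x1_def)
  obtain K where K: "\<And>z. z \<in> carr X \<Longrightarrow> nrm X (B z) \<le> K * nrm X z"
    using B by (auto simp: bounded_ops_def)
  have "c \<in> closure (range (\<lambda>n. f ((S ^^ n) x)))" for c
    unfolding closure_approachable
  proof (intro allI impI)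
    fix \<epsilon> :: real assume "\<epsilon> > 0"
    \<comment> \<open>An error in the orbit of \<open>x0\<close> grows at most by
      \<open>\<bar>K\<bar>\<close> under \<open>B\<close> and is then divided by \<open>r\<close>.
      The \<open>+ 1\<close> keeps the denominator positive.\<close>
    define \<delta> where "\<delta> = \<epsilon> * r / (\<bar>K\<bar> + 1)"
    have K1: "\<bar>K\<bar> + 1 > 0" by simp
    then have \<delta>: "\<delta> > 0" using \<open>\<epsilon> > 0\<close> r by (simp add: \<delta>_def)
    obtain n where n: "nrm X ((T ^^ n) x0 - c *\<^sub>C x0) < \<delta>" using approx[OF \<delta>] by blast
    let ?z = "(T ^^ n) x0 - c *\<^sub>C x0"
    have z: "?z \<in> carr X" by (intro carr_diff carr_scaleC orb x0)
    have "B ?z = B ((T ^^ n) x0) - c *\<^sub>C x1"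
      by (simp add: x1_def linear_on_carr_diff[OF bounded_opsD(1)[OF B] orb carr_scaleC[OF x0(1)]]
          linear_on_carrD(2)[OF bounded_opsD(1)[OF B] x0(1)])
    then have "f (B ?z) = f (B ((T ^^ n) x0)) - c * of_real r"
      by (simp add: linear_on_carr_diff[OF lf bounded_opsD(2)[OF B orb] carr_scaleC[OF x1]]
          linear_on_carrD(2)[OF lf x1] fx1 scaleC_complex_def)
    moreover have "f ((S ^^ n) x) = f (B ((T ^^ n) x0)) / of_real r"
      by (simp add: Sn linear_on_carrD(2)[OF lf bounded_opsD(2)[OF B orb]] scaleC_complex_def)
    ultimately have "f ((S ^^ n) x) - c = f (B ?z) / of_real r"
      using r by (simp add: field_simps)
    then have "dist (f ((S ^^ n) x)) c = cmod (f (B ?z)) / r"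
      using r by (simp add: dist_norm norm_divide)
    also have "\<dots> \<le> K * nrm X ?z / r"
      using order_trans[OF fle[OF bounded_opsD(2)[OF B z]] K[OF z]] r by (simp add: divide_right_mono)
    also have "\<dots> < \<epsilon>"
    proof -
      have nz: "0 \<le> nrm X ?z" using order_trans[OF norm_ge_zero fle[OF z]] .
      have "K * nrm X ?z \<le> (\<bar>K\<bar> + 1) * nrm X ?z" using nz by (intro mult_right_mono) auto
      also have "\<dots> < (\<bar>K\<bar> + 1) * \<delta>" using n by (intro mult_strict_left_mono) auto
      also have "\<dots> = \<epsilon> * r" using K1 by (simp add: \<delta>_def)
      finally show ?thesis using r by (simp add: pos_divide_less_eq)
    qed
    finally show "\<exists>y\<in>range (\<lambda>n. f ((S ^^ n) x)). dist y c < \<epsilon>" by blast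
  qed
  with state show "numerically_hypercyclic X S"
    unfolding numerically_hypercyclic_def by blast
qed

end

subsection \<open>Spaces normed by square sums\<close>

lemma sum_cinner_le:
  fixes u v :: "'i \<Rightarrow> 'h::chilbert_space"
  shows "(\<Sum>i\<in>F. cmod (cinner (u i) (v i)))
    \<le> sqrt (\<Sum>i\<in>F. (norm (u i))\<^sup>2) * sqrt (\<Sum>i\<in>F. (norm (v i))\<^sup>2)"
proof -
  have "(\<Sum>i\<in>F. cmod (cinner (u i) (v i))) \<le> (\<Sum>i\<in>F. \<bar>norm (u i)\<bar> * \<bar>norm (v i)\<bar>)"
    by (intro sum_mono) (simp add: cinner_Cauchy_Schwarz)
  also have "\<dots> \<le> L2_set (\<lambda>i. norm (u i)) F * L2_set (\<lambda>i. norm (v i)) F"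
    by (rule L2_set_mult_ineq)
  finally show ?thesis by (simp add: L2_set_def)
qed

lemma norm_add_sq_le: "(norm (x + y))\<^sup>2 \<le> 2 * (norm x)\<^sup>2 + 2 * (norm (y::'a::real_normed_vector))\<^sup>2"
proof -
  have "(norm (x + y))\<^sup>2 \<le> (norm x + norm y)\<^sup>2" by (intro power_mono norm_triangle_ineq) simp
  also have "\<dots> \<le> 2 * (norm x)\<^sup>2 + 2 * (norm y)\<^sup>2"
    using sum_squares_bound[of "norm x" "norm y"] by (simp add: power2_sum)
  finally show ?thesis .
qed

lemma square_summable_add:
  fixes u v :: "'i \<Rightarrow> 'h::real_normed_vector"
  assumes "(\<lambda>i. (norm (u i))\<^sup>2) summable_on UNIV" "(\<lambda>i. (norm (v i))\<^sup>2) summable_on UNIV"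
  shows "(\<lambda>i. (norm (u i + v i))\<^sup>2) summable_on UNIV"
  by (rule summable_on_comparison_test[of "\<lambda>i. 2 * (norm (u i))\<^sup>2 + 2 * (norm (v i))\<^sup>2"])
    (auto intro!: summable_on_add summable_on_cmult_right assms norm_add_sq_le)

lemma square_summable_cinner:
  fixes u v :: "'i \<Rightarrow> 'h::chilbert_space"
  assumes u: "(\<lambda>i. (norm (u i))\<^sup>2) summable_on UNIV" and v: "(\<lambda>i. (norm (v i))\<^sup>2) summable_on UNIV"
  shows "(\<lambda>i. cinner (u i) (v i)) summable_on UNIV"
    and "cmod (\<Sum>\<^sub>\<infinity>i. cinner (u i) (v i))
      \<le> sqrt (\<Sum>\<^sub>\<infinity>i. (norm (u i))\<^sup>2) * sqrt (\<Sum>\<^sub>\<infinity>i. (norm (v i))\<^sup>2)" (is "_ \<le> ?M")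
proof -
  have fin: "(\<Sum>i\<in>F. cmod (cinner (u i) (v i))) \<le> ?M" if "finite F" for F
  proof -
    have "sqrt (\<Sum>i\<in>F. (norm (u i))\<^sup>2) * sqrt (\<Sum>i\<in>F. (norm (v i))\<^sup>2) \<le> ?M"
      by (intro mult_mono real_sqrt_le_mono finite_sum_le_infsum u v that)
        (auto intro!: sum_nonneg infsum_nonneg)
    with sum_cinner_le[of u v F] show ?thesis by linarith
  qed
  have abs: "(\<lambda>i. cmod (cinner (u i) (v i))) summable_on UNIV"
    by (rule nonneg_bdd_above_summable_on) (use fin in \<open>auto intro!: bdd_aboveI[where M = ?M]\<close>)
  then show "(\<lambda>i. cinner (u i) (v i)) summable_on UNIV" by (rule abs_summable_summable)
  have "cmod (\<Sum>\<^sub>\<infinity>i. cinner (u i) (v i)) \<le> (\<Sum>\<^sub>\<infinity>i. cmod (cinner (u i) (v i)))"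
    by (rule norm_infsum_bound[OF abs])
  also have "\<dots> \<le> ?M" by (rule infsum_le_finite_sums[OF abs fin])
  finally show "cmod (\<Sum>\<^sub>\<infinity>i. cinner (u i) (v i)) \<le> ?M" .
qed

text \<open>Common frame for \<open>ell2\<close> and the Hilbert-Schmidt operators:
  \<open>U x\<close> lists the entries of a sequence or the columns \<open>A (e j)\<close> of an
  operator, and embeds the space isometrically into a Hilbert sum.\<close>

locale square_sum_space =
  fixes X :: "'x::complex_vector nspace" and U :: "'x \<Rightarrow> 'i \<Rightarrow> 'h::chilbert_space"
  assumes U_add: "U (x + y) i = U x i + U y i"
    and U_scaleC: "U (c *\<^sub>C x) i = c *\<^sub>C U x i"
    and add_carr: "x \<in> carr X \<Longrightarrow> y \<in> carr X \<Longrightarrow> x + y \<in> carr X"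
    and scaleC_carr: "x \<in> carr X \<Longrightarrow> c *\<^sub>C x \<in> carr X"
    and summable: "x \<in> carr X \<Longrightarrow> (\<lambda>i. (norm (U x i))\<^sup>2) summable_on UNIV"
    and nrm: "x \<in> carr X \<Longrightarrow> nrm X x = sqrt (\<Sum>\<^sub>\<infinity>i. (norm (U x i))\<^sup>2)"
    and inj: "x \<in> carr X \<Longrightarrow> (\<And>i. U x i = 0) \<Longrightarrow> x = 0"
begin

sublocale complex_nspace X
proof
  show "nrm X (c *\<^sub>C x) = cmod c * nrm X x" if "x \<in> carr X" for x c
    using that scaleC_carr[OF that, of c]
    by (simp add: nrm U_scaleC norm_scaleC power_mult_distrib infsum_cmult_right' real_sqrt_mult)
qed (auto intro: add_carr scaleC_carr)

lemma norm_U_le: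
  assumes "x \<in> carr X" shows "norm (U x i) \<le> nrm X x"
proof -
  have "(\<Sum>i\<in>{i}. (norm (U x i))\<^sup>2) \<le> (\<Sum>\<^sub>\<infinity>i. (norm (U x i))\<^sup>2)"
    by (rule finite_sum_le_infsum) (auto intro: summable assms)
  then show ?thesis unfolding nrm[OF assms] by (simp add: real_le_rsqrt)
qed

lemma norming: "norming X"
  unfolding norming_def
proof (intro ballI impI conjI)
  fix x assume x: "x \<in> carr X" "x \<noteq> 0"
  then obtain i where "U x i \<noteq> 0" using inj by blast
  then show pos: "0 < nrm X x" using norm_U_le[OF x(1), of i] by (meson less_le_trans zero_less_norm_iff)
  \<comment> \<open>The inner product with \<open>x\<close>, scaled to norm \<open>1\<close>. The
    value \<open>0\<close> off the carrier is the normalisation demanded by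
    \<open>dual\<close>.\<close>
  define f where "f y = (if y \<in> carr X then (\<Sum>\<^sub>\<infinity>i. cinner (U y i) (U x i)) / nrm X x else 0)" for y
  have "f x = of_real (nrm X x)"
  proof -
    have "(\<Sum>\<^sub>\<infinity>i. cinner (U x i) (U x i)) = of_real (\<Sum>\<^sub>\<infinity>i. (norm (U x i))\<^sup>2)"
      unfolding cinner_self
      by (rule infsumI[OF has_sum_of_real[OF has_sum_infsum[OF summable[OF x(1)]]]])
    also have "(\<Sum>\<^sub>\<infinity>i. (norm (U x i))\<^sup>2) = nrm X x * nrm X x"
      using pos unfolding nrm[OF x(1)] by simp
    finally show ?thesis using x pos by (simp add: f_def)
  qed
  moreover have bound: "cmod (f y) \<le> nrm X y" if "y \<in> carr X" for y
    using square_summable_cinner(2)[OF summable[OF that] summable[OF x(1)]] pos that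
    by (simp add: f_def norm_divide pos_divide_le_eq flip: nrm[OF that] nrm[OF x(1)])
  moreover have "f \<in> carr (dual X)"
  proof -
    note sc = square_summable_cinner(1)[OF summable summable[OF x(1)]]
    have "linear_on_carr X f"
      unfolding linear_on_carr_def
      by (auto simp: f_def add_carr scaleC_carr U_add U_scaleC cinner_add_left cinner_scaleC_left
          infsum_add sc infsum_cmult_right' add_divide_distrib scaleC_complex_def)
    moreover have "\<exists>K. \<forall>y\<in>carr X. cmod (f y) \<le> K * nrm X y"
      using bound by (intro exI[of _ 1]) simp
    ultimately show ?thesis by (simp add: dual_def f_def)
  qed
  ultimately show "\<exists>f\<in>carr (dual X). f x = of_real (nrm X x) \<and> (\<forall>y\<in>carr X. cmod (f y) \<le> nrm X y)"
    by blast
qed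

end

lemma ell2_carr_iff: "x \<in> carr ell2 \<longleftrightarrow> (\<lambda>n. (cmod (x n))\<^sup>2) summable_on UNIV"
  by (simp add: ell2_def summable_on_UNIV_nonneg_real_iff)

lemma nrm_ell2: "x \<in> carr ell2 \<Longrightarrow> nrm ell2 x = sqrt (\<Sum>\<^sub>\<infinity>n. (cmod (x n))\<^sup>2)"
  unfolding ell2_carr_iff
  using sums_unique[OF has_sum_imp_sums[OF has_sum_infsum], of "\<lambda>n. (cmod (x n))\<^sup>2"]
  by (simp add: ell2_def)

interpretation ell2: square_sum_space ell2 "\<lambda>x. x"
proof
  fix x y :: "nat \<Rightarrow> complex" and c
  show "x + y \<in> carr ell2" if "x \<in> carr ell2" "y \<in> carr ell2"
    using square_summable_add[of x y] that by (simp add: ell2_carr_iff plus_fun_def)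
  show "c *\<^sub>C x \<in> carr ell2" if "x \<in> carr ell2"
    using that unfolding ell2_carr_iff scaleC_fun_def norm_scaleC power_mult_distrib
    by (rule summable_on_cmult_right)
qed (auto simp: ell2_carr_iff nrm_ell2 plus_fun_def scaleC_fun_def zero_fun_def)

section \<open>The Hilbert-Schmidt and the compact operators as normed spaces\<close>

context orthonormal
begin

lemma ext_on_basis:
  assumes A: "bounded_clinear A" and B: "bounded_clinear B" and "\<And>j. A (e j) = B (e j)"
  shows "A = (B :: 'h \<Rightarrow> 'h)"
proof
  fix x
  have "((\<lambda>j. A (cinner x (e j) *\<^sub>C e j)) has_sum A x) UNIV"
    "((\<lambda>j. B (cinner x (e j) *\<^sub>C e j)) has_sum B x) UNIV"
    by (rule has_sum_bounded_linear[OF bounded_clinearD(1) expansion], fact)+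
  then show "A x = B x"
    using has_sum_unique by (simp add: bounded_clinear_simps[OF A] bounded_clinear_simps[OF B] assms(3)) blast
qed

sublocale B2: square_sum_space "B2 e" "\<lambda>A j. A (e j)"
proof
  fix A B :: "'h \<Rightarrow> 'h" and c
  show "A + B \<in> carr (B2 e)" if "A \<in> carr (B2 e)" "B \<in> carr (B2 e)"
    using square_summable_add[of "\<lambda>j. A (e j)" "\<lambda>j. B (e j)"] bounded_clinear_add[of A B] that
    by (simp add: B2_def plus_fun_def)
  show "c *\<^sub>C A \<in> carr (B2 e)" if "A \<in> carr (B2 e)"
    using that bounded_clinear_scaleC[of A c]
    by (auto simp: B2_def scaleC_fun_def norm_scaleC power_mult_distrib intro: summable_on_cmult_right)
  show "A = 0" if "A \<in> carr (B2 e)" "\<And>j. A (e j) = 0"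
    using ext_on_basis[of A "\<lambda>x. 0"] that by (simp add: B2_def bounded_clinear_zero zero_fun_def)
qed (auto simp: B2_def plus_fun_def scaleC_fun_def)

sublocale B0: complex_nspace "B0 :: ('h \<Rightarrow> 'h) nspace"
proof
  fix A :: "'h \<Rightarrow> 'h" and c
  assume A: "A \<in> carr B0"
  note bA = B0_carrD(1)[OF A]
  have le: "onorm (\<lambda>x. c *\<^sub>C A x) \<le> cmod c * onorm A" if "bounded_clinear A" for c and A :: "'h \<Rightarrow> 'h"
    using bounded_clinearD(8)[OF that]
    by (intro onorm_bound) (auto simp: norm_scaleC onorm_nonneg[OF that] mult.assoc intro!: mult_left_mono)
  have "cmod c * onorm A \<le> onorm (\<lambda>x. c *\<^sub>C A x)"
  proof (cases "c = 0")
    case False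
    \<comment> \<open>The upper estimate, applied to the multiple by \<open>c\<close> and the scalar
      \<open>1 / c\<close>, is the lower estimate.\<close>
    have "onorm A \<le> cmod (1 / c) * onorm (\<lambda>x. c *\<^sub>C A x)"
      using le[OF bounded_clinear_scaleC[OF bA, of c], of "1 / c"] False
      by (simp add: scaleC_scaleC scaleC_one)
    then show ?thesis using False by (simp add: norm_divide field_simps)
  qed (simp add: onorm_zero)
  with le[OF bA, of c] show "nrm B0 (c *\<^sub>C A) = cmod c * nrm B0 A"
    by (simp add: scaleC_fun_def)
qed (auto intro: B0_add B0_scaleC)

text \<open>The functional is \<open>A \<mapsto> cinner (A h) (K h) / onorm K\<close>, where
  \<open>h\<close> is a unit vector at which the compact operator \<open>K\<close> attains its
  norm.\<close>

lemma B0_norming: "norming (B0 :: ('h \<Rightarrow> 'h) nspace)"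
  unfolding norming_def nrm_B0
proof (intro ballI impI conjI)
  fix K :: "'h \<Rightarrow> 'h" assume K: "K \<in> carr B0" "K \<noteq> 0"
  then show pos: "0 < onorm K"
    using onorm_pos_lt[OF bounded_clinearD(1)[OF B0_carrD(1)[OF K(1)]]] by (auto simp: fun_eq_iff)
  obtain h where h: "norm h = 1" "norm (K h) = onorm K" by (rule B0_attains_onorm[OF K])
  define f where "f A = (if A \<in> carr B0 then cinner (A h) (K h) / onorm K else 0)" for A :: "'h \<Rightarrow> 'h"
  have "f K = of_real (onorm K)"
    using K pos by (simp add: f_def cinner_self h power2_eq_square)
  moreover have bound: "cmod (f A) \<le> onorm A" if A: "A \<in> carr B0" for A
  proof -
    have "norm (A h) \<le> onorm A" using bounded_clinearD(8)[OF B0_carrD(1)[OF A], of h] h by simp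
    then have "norm (A h) * norm (K h) \<le> onorm A * onorm K"
      using pos unfolding h(2) by (intro mult_right_mono) auto
    then have "cmod (cinner (A h) (K h)) \<le> onorm A * onorm K"
      by (rule order_trans[OF cinner_Cauchy_Schwarz])
    then show ?thesis using pos A by (simp add: f_def norm_divide pos_divide_le_eq)
  qed
  moreover have "f \<in> carr (dual B0)"
  proof -
    have "linear_on_carr B0 f"
      unfolding linear_on_carr_def
      by (auto simp: f_def B0_add B0_scaleC scaleC_fun_apply cinner_add_left
          cinner_scaleC_left add_divide_distrib scaleC_complex_def)
    moreover have "\<exists>K. \<forall>A\<in>carr B0. cmod (f A) \<le> K * onorm A"
      using bound by (intro exI[of _ 1]) simp
    ultimately show ?thesis by (simp add: dual_def f_def)
  qed
  ultimately show "\<exists>f\<in>carr (dual B0). f K = of_real (onorm K) \<and> (\<forall>A\<in>carr B0. cmod (f A) \<le> onorm A)"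
    by blast
qed

subsection \<open>The standard Hilbert module\<close>

text \<open>The Cauchy criterion for the series of \<open>adj (x j) \<circ> x j\<close> in operator
  norm, read on quadratic forms. In this shape it is stable under sums and multiples, and it
  controls mixed series \<open>adj (y j) \<circ> x j\<close> as well.\<close>

definition column_summable :: "(nat \<Rightarrow> 'h \<Rightarrow> 'h) \<Rightarrow> bool"
  where "column_summable x \<longleftrightarrow> (\<forall>j. x j \<in> carr B0) \<and>
    (\<forall>\<epsilon>>0. \<exists>N. \<forall>m\<ge>N. \<forall>n\<ge>m. \<forall>h. (\<Sum>j=m..<n. (norm (x j h))\<^sup>2) \<le> \<epsilon> * (norm h)\<^sup>2)"

lemma bounded_clinear_adj_compose:
  "x \<in> carr B0 \<Longrightarrow> y \<in> carr B0 \<Longrightarrow> bounded_clinear (adj y \<circ> (x :: 'h \<Rightarrow> 'h))"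
  unfolding comp_def
  by (rule bounded_clinear_compose[OF bounded_clinear_adj[OF B0_carrD(1)] B0_carrD(1)])

text \<open>Testing a tail \<open>k\<close> of the series at \<open>h\<close> against itself gives
  \<open>(norm k)^2\<close> as a sum of the \<open>cinner (x j h) (y j k)\<close>. The inequality of
  Cauchy and Schwarz bounds it by the two tails, leaving one factor \<open>norm k\<close> to
  cancel.\<close>

lemma ex_module_form:
  assumes x: "column_summable x" and y: "column_summable y"
  shows "\<exists>s. norm_sums B0 (\<lambda>j. adj (y j) \<circ> x j) s"
proof (rule norm_sums_B0_Cauchy)
  have xB: "x j \<in> carr B0" and yB: "y j \<in> carr B0" for j
    using x y by (auto simp: column_summable_def)
  note bx = B0_carrD(1)[OF xB] and byy = B0_carrD(1)[OF yB]
  show "adj (y j) \<circ> x j \<in> carr B0" for j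
    by (rule B0_compose[OF bounded_clinear_adj[OF byy] xB])
  fix \<epsilon> :: real assume "\<epsilon> > 0"
  then obtain N M where
    N: "\<forall>m\<ge>N. \<forall>n\<ge>m. \<forall>h. (\<Sum>j=m..<n. (norm (x j h))\<^sup>2) \<le> \<epsilon> * (norm h)\<^sup>2"
    and M: "\<forall>m\<ge>M. \<forall>n\<ge>m. \<forall>h. (\<Sum>j=m..<n. (norm (y j h))\<^sup>2) \<le> \<epsilon> * (norm h)\<^sup>2"
    using x y unfolding column_summable_def by presburger
  have "norm (\<Sum>j=m..<n. (adj (y j) \<circ> x j) h) \<le> \<epsilon> * norm h"
    if "m \<ge> max N M" "n \<ge> m" for m n h
  proof -
    define k where k: "k = (\<Sum>j=m..<n. (adj (y j) \<circ> x j) h)"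
    have "cinner k z = (\<Sum>j=m..<n. cinner (x j h) (y j z))" for z
      unfolding k cinner_sum_left by (simp add: adj'[OF byy])
    from arg_cong[OF this[of k], of cmod]
    have "(norm k)\<^sup>2 = cmod (\<Sum>j=m..<n. cinner (x j h) (y j k))"
      by (simp add: cinner_self norm_power)
    also have "\<dots> \<le> sqrt (\<Sum>j=m..<n. (norm (x j h))\<^sup>2) * sqrt (\<Sum>j=m..<n. (norm (y j k))\<^sup>2)"
      by (rule order_trans[OF norm_sum sum_cinner_le])
    also have "\<dots> \<le> sqrt (\<epsilon> * (norm h)\<^sup>2) * sqrt (\<epsilon> * (norm k)\<^sup>2)"
      using N[rule_format, of m n h] M[rule_format, of m n k] that \<open>\<epsilon> > 0\<close>
      by (intro mult_mono real_sqrt_le_mono) (auto intro: sum_nonneg)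
    also have "\<dots> = (\<epsilon> * norm h) * norm k"
      using \<open>\<epsilon> > 0\<close> by (simp add: real_sqrt_mult)
    finally have *: "norm k * norm k \<le> (\<epsilon> * norm h) * norm k" by (simp only: power2_eq_square)
    have "norm k \<le> \<epsilon> * norm h"
    proof (cases "norm k = 0")
      case True
      then show ?thesis using \<open>\<epsilon> > 0\<close> by simp
    next
      case False
      then have "0 < norm k" using norm_ge_zero[of k] by linarith
      with * show ?thesis by (rule mult_right_le_imp_le)
    qed
    then show ?thesis unfolding k .
  qed
  then show "\<exists>N. \<forall>m\<ge>N. \<forall>n\<ge>m. \<forall>h. norm (\<Sum>j=m..<n. (adj (y j) \<circ> x j) h) \<le> \<epsilon> * norm h" by blast
qed

lemma module_form_eqI:
  assumes "norm_sums B0 (\<lambda>j. adj (y j) \<circ> x j) s" "\<And>j. x j \<in> carr B0" "\<And>j. y j \<in> carr B0"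
  shows "module_form x y = (s :: 'h \<Rightarrow> 'h)"
  unfolding module_form_def
proof (rule the_equality, rule assms(1))
  show "s' = s" if "norm_sums B0 (\<lambda>j. adj (y j) \<circ> x j) s'" for s'
    by (rule norm_sums_B0_unique[OF that assms(1) bounded_clinear_adj_compose[OF assms(2,3)]])
qed

lemma sums_module_form:
  assumes "norm_sums B0 (\<lambda>j. adj (y j) \<circ> x j) s" "\<And>j. x j \<in> carr B0" "\<And>j. y j \<in> carr B0"
  shows "(\<lambda>j. cinner (x j h) (y j k)) sums cinner (s h) (k :: 'h)"
proof -
  have "(\<lambda>j. (adj (y j) \<circ> x j) h) sums s h"
    by (rule norm_sums_B0_pointwise[OF assms(1) bounded_clinear_adj_compose[OF assms(2,3)]])
  from bounded_linear.sums[OF bounded_bilinear.bounded_linear_left[OF bounded_bilinear_cinner] this]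
  show ?thesis by (simp add: adj'[OF B0_carrD(1)[OF assms(3)]])
qed

text \<open>For the converse direction the form of a tail is the difference of the forms of
  \<open>P n - s\<close> and \<open>P m - s\<close>, each at most \<open>\<epsilon>/2\<close> times
  the squared norm of \<open>h\<close>.\<close>

lemma l2_module_carr_iff: "x \<in> carr l2_module \<longleftrightarrow> column_summable (x :: nat \<Rightarrow> 'h \<Rightarrow> 'h)"
proof
  assume "column_summable x"
  then show "x \<in> carr l2_module"
    using ex_module_form[of x x] by (auto simp: l2_module_def column_summable_def)
next
  assume "x \<in> carr l2_module"
  then obtain s where xB: "\<And>j. x j \<in> carr B0" and s: "norm_sums B0 (\<lambda>j. adj (x j) \<circ> x j) s"
    by (auto simp: l2_module_def)
  define P where "P n = (\<Sum>j<n. adj (x j) \<circ> x j)" for n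
  have bs: "bounded_clinear s" using s by (simp add: norm_sums_def B0_carrD)
  have bd: "bounded_clinear (P n - s)" for n
    unfolding P_def fun_diff_def sum_fun_apply
    by (intro bounded_clinear_intros bs bounded_clinear_adj_compose xB)
  have "\<exists>N. \<forall>m\<ge>N. \<forall>n\<ge>m. \<forall>h. (\<Sum>j=m..<n. (norm (x j h))\<^sup>2) \<le> \<epsilon> * (norm h)\<^sup>2" if "\<epsilon> > 0" for \<epsilon>
  proof -
    have "(\<lambda>n. onorm (P n - s)) \<longlonglongrightarrow> 0" using s by (simp add: norm_sums_def P_def)
    from LIMSEQ_D[OF this, of "\<epsilon> / 2"] that obtain N
      where N: "\<And>n. n \<ge> N \<Longrightarrow> onorm (P n - s) < \<epsilon> / 2" by (auto simp: onorm_nonneg[OF bd])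
    have "(\<Sum>j=m..<n. (norm (x j h))\<^sup>2) \<le> \<epsilon> * (norm h)\<^sup>2" if mn: "m \<ge> N" "n \<ge> m" for m n h
    proof -
      have PPh: "cinner (P n h) h = of_real (\<Sum>j<n. (norm (x j h))\<^sup>2)" for n
        by (simp add: P_def sum_fun_apply cinner_sum_left adj'[OF B0_carrD(1)[OF xB]] cinner_self)
      have "of_real (\<Sum>j=m..<n. (norm (x j h))\<^sup>2) = cinner (P n h) h - cinner (P m h) h"
        using sum_diff_nat_ivl[of 0 m n "\<lambda>j. (norm (x j h))\<^sup>2"] mn(2)
        unfolding PPh of_real_diff[symmetric] by (simp only: lessThan_atLeast0)
      also have "\<dots> = cinner ((P n - s) h) h - cinner ((P m - s) h) h"
        by (simp add: fun_diff_def cinner_diff_left)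
      finally have "(\<Sum>j=m..<n. (norm (x j h))\<^sup>2)
          = Re (cinner ((P n - s) h) h) - Re (cinner ((P m - s) h) h)"
        by (metis Re_complex_of_real minus_complex.sel(1))
      also have "\<dots> \<le> cmod (cinner ((P n - s) h) h) + cmod (cinner ((P m - s) h) h)"
        using abs_Re_le_cmod[of "cinner ((P n - s) h) h"] abs_Re_le_cmod[of "cinner ((P m - s) h) h"]
        by linarith
      also have "\<dots> \<le> \<epsilon> / 2 * (norm h)\<^sup>2 + \<epsilon> / 2 * (norm h)\<^sup>2"
      proof (rule add_mono)
        have "cmod (cinner ((P n - s) h) h) \<le> \<epsilon> / 2 * (norm h)\<^sup>2" if "n \<ge> N" for n
        proof -
          have "cmod (cinner ((P n - s) h) h) \<le> norm ((P n - s) h) * norm h"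
            by (rule cinner_Cauchy_Schwarz)
          also have "\<dots> \<le> (onorm (P n - s) * norm h) * norm h"
            by (intro mult_right_mono bounded_clinearD(8) bd) simp
          also have "\<dots> \<le> (\<epsilon> / 2 * norm h) * norm h"
            using N[OF that] by (intro mult_right_mono) auto
          finally show ?thesis by (simp add: power2_eq_square)
        qed
        then show "cmod (cinner ((P n - s) h) h) \<le> \<epsilon> / 2 * (norm h)\<^sup>2"
          "cmod (cinner ((P m - s) h) h) \<le> \<epsilon> / 2 * (norm h)\<^sup>2"
          using mn by auto
      qed
      finally show ?thesis by simp
    qed
    then show ?thesis by blast
  qed
  with xB show "column_summable x" by (simp add: column_summable_def)
qed

lemma l2_module_carrD: "x \<in> carr l2_module \<Longrightarrow> x j \<in> carr (B0 :: ('h \<Rightarrow> 'h) nspace)"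
  by (simp add: l2_module_def)

text \<open>The matrix coefficients of the form are scalar series; later computations with
  \<open>module_form\<close> go through them.\<close>

lemma module_form:
  assumes "x \<in> carr l2_module" "y \<in> carr (l2_module :: (nat \<Rightarrow> 'h \<Rightarrow> 'h) nspace)"
  shows "module_form x y \<in> carr B0"
    and "(\<lambda>j. cinner (x j h) (y j k)) sums cinner (module_form x y h) k"
proof -
  obtain s where s: "norm_sums B0 (\<lambda>j. adj (y j) \<circ> x j) s"
    using ex_module_form assms l2_module_carr_iff by blast
  have "module_form x y = s"
    by (rule module_form_eqI[OF s]) (use assms l2_module_carrD in blast)+
  then show "module_form x y \<in> carr B0"
    "(\<lambda>j. cinner (x j h) (y j k)) sums cinner (module_form x y h) k"
    using s sums_module_form[OF s l2_module_carrD[OF assms(1)] l2_module_carrD[OF assms(2)]]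
    by (auto simp: norm_sums_def)
qed

lemma nrm_l2_module: "nrm l2_module x = sqrt (onorm (module_form x (x :: nat \<Rightarrow> 'h \<Rightarrow> 'h)))"
  by (simp add: l2_module_def)

lemma nrm_l2_module_sq:
  assumes "x \<in> carr (l2_module :: (nat \<Rightarrow> 'h \<Rightarrow> 'h) nspace)"
  shows "(nrm l2_module x)\<^sup>2 = onorm (module_form x x)" "0 \<le> nrm l2_module x"
  using onorm_nonneg[OF B0_carrD(1)[OF module_form(1)[OF assms assms]]] by (auto simp: nrm_l2_module)

lemma sum_norm_sq_le:
  assumes x: "x \<in> carr (l2_module :: (nat \<Rightarrow> 'h \<Rightarrow> 'h) nspace)"
  shows "(\<Sum>j<n. (norm (x j h))\<^sup>2) \<le> (nrm l2_module x * norm h)\<^sup>2"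
proof -
  have s: "(\<lambda>j. (norm (x j h))\<^sup>2) sums Re (cinner (module_form x x h) h)"
    using sums_Re[OF module_form(2)[OF x x, of h h]] by (simp add: norm_sq_Re_cinner)
  have "(\<Sum>j<n. (norm (x j h))\<^sup>2) \<le> Re (cinner (module_form x x h) h)"
    using sum_le_suminf[OF sums_summable[OF s], of "{..<n}"] sums_unique[OF s] by auto
  also have "\<dots> \<le> norm (module_form x x h) * norm h"
    using cinner_Cauchy_Schwarz complex_Re_le_cmod order_trans by blast
  also have "\<dots> \<le> onorm (module_form x x) * norm h * norm h"
    by (intro mult_right_mono bounded_clinearD(8) B0_carrD(1) module_form(1) x) simp
  finally show ?thesis
    by (simp add: power_mult_distrib nrm_l2_module_sq[OF x]) (simp add: power2_eq_square)
qed

lemma norm_coordinate_le: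
  assumes x: "x \<in> carr (l2_module :: (nat \<Rightarrow> 'h \<Rightarrow> 'h) nspace)"
  shows "norm (x j h) \<le> nrm l2_module x * norm h"
proof (rule power2_le_imp_le)
  have "(norm (x j h))\<^sup>2 \<le> (\<Sum>j<Suc j. (norm (x j h))\<^sup>2)"
    by (rule member_le_sum[of j]) auto
  also have "\<dots> \<le> (nrm l2_module x * norm h)\<^sup>2" by (rule sum_norm_sq_le[OF x])
  finally show "(norm (x j h))\<^sup>2 \<le> (nrm l2_module x * norm h)\<^sup>2" .
qed (use nrm_l2_module_sq[OF x] in simp)

text \<open>Cauchy and Schwarz on partial sums, then a limit. It bounds the norming functionals of
  the module and settles the exponent \<open>0\<close> in the example.\<close>

lemma cmod_module_form_le:
  assumes x: "x \<in> carr l2_module" and y: "y \<in> carr (l2_module :: (nat \<Rightarrow> 'h \<Rightarrow> 'h) nspace)"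
  shows "cmod (cinner (module_form x y h) k) \<le> (nrm l2_module x * norm h) * (nrm l2_module y * norm k)"
    (is "_ \<le> ?M")
proof (rule Lim_bounded[where M = 0])
  show "(\<lambda>n. cmod (\<Sum>j<n. cinner (x j h) (y j k))) \<longlonglongrightarrow> cmod (cinner (module_form x y h) k)"
    using module_form(2)[OF x y] unfolding sums_def by (rule tendsto_norm)
  have "cmod (\<Sum>j<n. cinner (x j h) (y j k)) \<le> ?M" for n
  proof -
    have "cmod (\<Sum>j<n. cinner (x j h) (y j k))
        \<le> sqrt (\<Sum>j<n. (norm (x j h))\<^sup>2) * sqrt (\<Sum>j<n. (norm (y j k))\<^sup>2)"
      by (rule order_trans[OF norm_sum sum_cinner_le])
    also have "\<dots> \<le> sqrt ((nrm l2_module x * norm h)\<^sup>2) * sqrt ((nrm l2_module y * norm k)\<^sup>2)"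
      by (intro mult_mono real_sqrt_le_mono sum_norm_sq_le x y) (auto intro: sum_nonneg)
    finally show ?thesis using nrm_l2_module_sq(2)[OF x] nrm_l2_module_sq(2)[OF y] by simp
  qed
  then show "\<forall>n\<ge>0. cmod (\<Sum>j<n. cinner (x j h) (y j k)) \<le> ?M" by blast
qed

lemma module_form_add:
  assumes "x \<in> carr l2_module" "x' \<in> carr l2_module" "x + x' \<in> carr l2_module"
    "y \<in> carr (l2_module :: (nat \<Rightarrow> 'h \<Rightarrow> 'h) nspace)"
  shows "cinner (module_form (x + x') y h) k = cinner (module_form x y h) k + cinner (module_form x' y h) k"
  using sums_add[OF module_form(2)[OF assms(1,4)] module_form(2)[OF assms(2,4)]]
    module_form(2)[OF assms(3,4)] sums_unique2
  by (fastforce simp: plus_fun_def cinner_add_left)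

lemma module_form_scaleC:
  assumes "x \<in> carr l2_module" "c *\<^sub>C x \<in> carr l2_module"
    "y \<in> carr (l2_module :: (nat \<Rightarrow> 'h \<Rightarrow> 'h) nspace)"
  shows "cinner (module_form (c *\<^sub>C x) y h) k = c * cinner (module_form x y h) k"
  using sums_mult[OF module_form(2)[OF assms(1,3)], of c] module_form(2)[OF assms(2,3)] sums_unique2
  by (fastforce simp: scaleC_fun_def cinner_scaleC_left)

sublocale l2_module: complex_nspace "l2_module :: (nat \<Rightarrow> 'h \<Rightarrow> 'h) nspace"
proof
  fix x y :: "nat \<Rightarrow> 'h \<Rightarrow> 'h" and c
  show "x + y \<in> carr l2_module" if xy: "x \<in> carr l2_module" "y \<in> carr l2_module"
    unfolding l2_module_carr_iff column_summable_def
  proof (intro conjI allI impI)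
    show "(x + y) j \<in> carr B0" for j
      using xy by (simp add: B0_add l2_module_carrD)
    fix \<epsilon> :: real assume "\<epsilon> > 0"
    \<comment> \<open>The squared norm of a sum is at most twice the sum of the squared norms, so
      two tails of size \<open>\<epsilon>/4\<close> contribute \<open>\<epsilon>\<close>.\<close>
    then have "\<epsilon> / 4 > 0" by simp
    then obtain N M where
      N: "\<forall>m\<ge>N. \<forall>n\<ge>m. \<forall>h. (\<Sum>j=m..<n. (norm (x j h))\<^sup>2) \<le> \<epsilon> / 4 * (norm h)\<^sup>2"
      and M: "\<forall>m\<ge>M. \<forall>n\<ge>m. \<forall>h. (\<Sum>j=m..<n. (norm (y j h))\<^sup>2) \<le> \<epsilon> / 4 * (norm h)\<^sup>2"
      using xy unfolding l2_module_carr_iff column_summable_def by presburger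
    have "(\<Sum>j=m..<n. (norm ((x + y) j h))\<^sup>2) \<le> \<epsilon> * (norm h)\<^sup>2" if "m \<ge> max N M" "n \<ge> m" for m n h
    proof -
      have "(\<Sum>j=m..<n. (norm ((x + y) j h))\<^sup>2)
          \<le> (\<Sum>j=m..<n. 2 * (norm (x j h))\<^sup>2 + 2 * (norm (y j h))\<^sup>2)"
        by (intro sum_mono) (simp add: norm_add_sq_le)
      also have "\<dots> = 2 * (\<Sum>j=m..<n. (norm (x j h))\<^sup>2) + 2 * (\<Sum>j=m..<n. (norm (y j h))\<^sup>2)"
        by (simp add: sum.distrib sum_distrib_left)
      also have "\<dots> \<le> \<epsilon> * (norm h)\<^sup>2"
        using N[rule_format, of m n h] M[rule_format, of m n h] that by linarith
      finally show ?thesis .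
    qed
    then show "\<exists>N. \<forall>m\<ge>N. \<forall>n\<ge>m. \<forall>h. (\<Sum>j=m..<n. (norm ((x + y) j h))\<^sup>2) \<le> \<epsilon> * (norm h)\<^sup>2"
      by blast
  qed
  show cx: "c *\<^sub>C x \<in> carr l2_module" if x: "x \<in> carr l2_module"
    unfolding l2_module_carr_iff column_summable_def
  proof (intro conjI allI impI)
    show "(c *\<^sub>C x) j \<in> carr B0" for j
      using x by (simp add: B0_scaleC l2_module_carrD scaleC_fun_apply[of c x])
    fix \<epsilon> :: real assume \<epsilon>: "\<epsilon> > 0"
    define d where "d = (cmod c)\<^sup>2 + 1"
    have d: "d > 0" by (simp add: d_def add_nonneg_pos)
    then have "\<epsilon> / d > 0" using \<epsilon> by simp
    then obtain N where
      N: "\<forall>m\<ge>N. \<forall>n\<ge>m. \<forall>h. (\<Sum>j=m..<n. (norm (x j h))\<^sup>2) \<le> \<epsilon> / d * (norm h)\<^sup>2"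
      using x unfolding l2_module_carr_iff column_summable_def by presburger
    have "(\<Sum>j=m..<n. (norm ((c *\<^sub>C x) j h))\<^sup>2) \<le> \<epsilon> * (norm h)\<^sup>2" if "m \<ge> N" "n \<ge> m" for m n h
    proof -
      have "(\<Sum>j=m..<n. (norm ((c *\<^sub>C x) j h))\<^sup>2) = (cmod c)\<^sup>2 * (\<Sum>j=m..<n. (norm (x j h))\<^sup>2)"
        by (simp add: scaleC_fun_apply norm_scaleC power_mult_distrib sum_distrib_left)
      also have "\<dots> \<le> d * (\<Sum>j=m..<n. (norm (x j h))\<^sup>2)"
        by (intro mult_right_mono sum_nonneg) (auto simp: d_def)
      also have "\<dots> \<le> d * (\<epsilon> / d * (norm h)\<^sup>2)"
        using N that d by (intro mult_left_mono) auto
      also have "\<dots> = \<epsilon> * (norm h)\<^sup>2" using d by simp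
      finally show ?thesis .
    qed
    then show "\<exists>N. \<forall>m\<ge>N. \<forall>n\<ge>m. \<forall>h. (\<Sum>j=m..<n. (norm ((c *\<^sub>C x) j h))\<^sup>2) \<le> \<epsilon> * (norm h)\<^sup>2"
      by blast
  qed
  show "nrm l2_module (c *\<^sub>C x) = cmod c * nrm l2_module x" if x: "x \<in> carr l2_module"
  proof -
    have "module_form (c *\<^sub>C x) (c *\<^sub>C x) = (c * cnj c) *\<^sub>C module_form x x"
    proof (rule ext, rule cinner_ext)
      fix h k
      have "(\<lambda>j. (c * cnj c) * cinner (x j h) (x j k)) sums cinner (module_form (c *\<^sub>C x) (c *\<^sub>C x) h) k"
        using module_form(2)[OF cx[OF x] cx[OF x], of h k]
        by (simp add: scaleC_fun_apply cinner_scaleC_left cinner_scaleC_right mult_ac)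
      moreover have "(\<lambda>j. (c * cnj c) * cinner (x j h) (x j k))
          sums ((c * cnj c) * cinner (module_form x x h) k)"
        by (intro sums_mult module_form(2) x)
      ultimately show "cinner (module_form (c *\<^sub>C x) (c *\<^sub>C x) h) k
          = cinner (((c * cnj c) *\<^sub>C module_form x x) h) k"
        using sums_unique2 by (simp add: scaleC_fun_apply cinner_scaleC_left) blast
    qed
    then have "onorm (module_form (c *\<^sub>C x) (c *\<^sub>C x)) = (cmod c)\<^sup>2 * onorm (module_form x x)"
      using B0.nrm_scaleC[OF module_form(1)[OF x x], of "c * cnj c"]
      by (simp add: norm_mult power2_eq_square)
    then show ?thesis by (simp add: nrm_l2_module real_sqrt_mult)
  qed
qed

text \<open>The functional is
  \<open>y \<mapsto> cinner (module_form y x h) h / nrm l2_module x\<close>, where the form of the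
  positive compact operator \<open>module_form x x\<close> attains its norm at the unit vector
  \<open>h\<close>.\<close>

lemma l2_module_norming: "norming (l2_module :: (nat \<Rightarrow> 'h \<Rightarrow> 'h) nspace)"
  unfolding norming_def
proof (intro ballI impI conjI)
  fix x :: "nat \<Rightarrow> 'h \<Rightarrow> 'h" assume x: "x \<in> carr l2_module" and "x \<noteq> 0"
  define P where "P = module_form x x"
  have P: "P \<in> carr B0" unfolding P_def by (rule module_form(1)[OF x x])
  note bP = B0_carrD(1)[OF P]
  have s: "(\<lambda>j. (norm (x j h))\<^sup>2) sums Re (cinner (P h) h)" for h
    using sums_Re[OF module_form(2)[OF x x, of h h]] by (simp add: norm_sq_Re_cinner P_def)
  have pos: "positive_op P"
  proof (rule positive_opI[OF bP])
    show "Im (cinner (P h) h) = 0" for h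
      using sums_unique[OF sums_Im[OF module_form(2)[OF x x, of h h]]] by (simp add: P_def)
    show "0 \<le> Re (cinner (P h) h)" for h
      using sums_le[OF _ sums_zero s[of h]] by simp
  qed
  have "P \<noteq> 0"
  proof
    assume "P = 0"
    have "x j h = 0" for j h
      using norm_coordinate_le[OF x, of j h]
      by (simp add: nrm_l2_module onorm_zero \<open>P = 0\<close> zero_fun_def flip: P_def)
    then have "x = 0" by (simp add: fun_eq_iff)
    with \<open>x \<noteq> 0\<close> show False ..
  qed
  obtain h where h: "norm h = 1" "Re (cinner (P h) h) = onorm P"
    by (rule positive_B0_attains_onorm[OF P pos \<open>P \<noteq> 0\<close>])
  have "0 < onorm P"
    using \<open>P \<noteq> 0\<close> onorm_pos_lt[OF bounded_clinearD(1)[OF bP]] by (auto simp: fun_eq_iff)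
  then show nx: "0 < nrm l2_module x" by (simp add: nrm_l2_module P_def)
  have Ph: "cinner (P h) h = of_real (nrm l2_module x * nrm l2_module x)"
    using h(2) positive_opD(2)[OF pos, of h] nrm_l2_module_sq(1)[OF x]
    by (simp add: complex_eq_iff P_def power2_eq_square)
  define f where "f y = (if y \<in> carr l2_module
    then cinner (module_form y x h) h / of_real (nrm l2_module x) else 0)" for y
  have "f x = of_real (nrm l2_module x)"
    using x nx Ph by (simp add: f_def P_def)
  moreover have bound: "cmod (f y) \<le> nrm l2_module y" if "y \<in> carr l2_module" for y
    using cmod_module_form_le[OF that x, of h h] h(1) nx that
    by (simp add: f_def norm_divide pos_divide_le_eq)
  moreover have "f \<in> carr (dual l2_module)"
  proof -
    have "linear_on_carr l2_module f"
      unfolding linear_on_carr_def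
      by (auto simp: f_def l2_module.carr_add l2_module.carr_scaleC module_form_add x
          module_form_scaleC add_divide_distrib scaleC_complex_def)
    moreover have "\<exists>K. \<forall>y\<in>carr l2_module. cmod (f y) \<le> K * nrm l2_module y"
      using bound by (intro exI[of _ 1]) simp
    ultimately show ?thesis by (simp add: dual_def f_def)
  qed
  ultimately show "\<exists>f\<in>carr (dual l2_module). f x = of_real (nrm l2_module x) \<and>
      (\<forall>y\<in>carr l2_module. cmod (f y) \<le> nrm l2_module y)"
    by blast
qed

definition column :: "('h \<Rightarrow> 'h) \<Rightarrow> nat \<Rightarrow> 'h \<Rightarrow> 'h"
  where "column A = (\<lambda>j. if j = 0 then A else 0)"

lemma column_carr:
  assumes "A \<in> carr B0" shows "column A \<in> carr l2_module"
  unfolding l2_module_carr_iff column_summable_def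
  by (auto simp: column_def assms B0_zero intro!: exI[of _ 1])

text \<open>The form of a column with itself is \<open>adj A \<circ> A\<close>, known through its
  matrix coefficients; testing \<open>P h\<close> against itself bounds its norm by
  \<open>(onorm A)^2\<close>.\<close>

lemma nrm_column_le:
  assumes A: "A \<in> carr B0" shows "nrm l2_module (column A) \<le> onorm A"
proof -
  note bA = B0_carrD(1)[OF A] and cA = column_carr[OF A]
  define P where "P = module_form (column A) (column A)"
  have P: "cinner (P h) k = cinner (A h) (A k)" for h k
  proof -
    have "(\<lambda>j. cinner (column A j h) (column A j k)) sums cinner (A h) (A k)"
      using sums_single[of 0 "\<lambda>_. cinner (A h) (A k)"]
      by (rule sums_cong[THEN iffD1, rotated]) (simp add: column_def)
    then show ?thesis using module_form(2)[OF cA cA, of h k] sums_unique2 unfolding P_def by blast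
  qed
  have "onorm P \<le> (onorm A)\<^sup>2"
  proof (rule onorm_bound)
    fix h
    have "norm (P h) * norm (P h) \<le> ((onorm A)\<^sup>2 * norm h) * norm (P h)"
    proof -
      have "norm (P h) * norm (P h) = Re (cinner (A h) (A (P h)))"
        by (simp add: norm_sq_Re_cinner P flip: power2_eq_square)
      also have "\<dots> \<le> norm (A h) * norm (A (P h))"
        using cinner_Cauchy_Schwarz complex_Re_le_cmod order_trans by blast
      also have "\<dots> \<le> (onorm A * norm h) * (onorm A * norm (P h))"
        by (intro mult_mono bounded_clinearD(8)[OF bA]) (auto simp: onorm_nonneg[OF bA])
      finally show ?thesis by (simp add: power2_eq_square mult_ac)
    qed
    then show "norm (P h) \<le> (onorm A)\<^sup>2 * norm h"
      by (cases "norm (P h) = 0") (auto simp: mult_le_cancel_right)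
  qed simp
  then show ?thesis
    unfolding nrm_l2_module P_def[symmetric] using onorm_nonneg[OF bA] by (simp add: real_le_lsqrt)
qed

end

subsection \<open>A vector whose orbit under a multiple of the backward shift approximates its multiples\<close>

text \<open>A pairing function enumerates a countable dense set with infinitely many repetitions.
  Values too large for their index are replaced by \<open>0\<close>, and each value survives at all
  late repetitions.\<close>

lemma ex_slow_recurrent_sequence:
  "\<exists>c :: nat \<Rightarrow> complex. (\<forall>k. cmod (c k) \<le> real k + 1) \<and>
    (\<forall>z \<epsilon> K. 0 < \<epsilon> \<longrightarrow> (\<exists>k\<ge>K. cmod (c k - z) < \<epsilon>))"
proof -
  obtain D :: "complex set" where D: "countable D"
    "\<And>V. open V \<Longrightarrow> V \<noteq> {} \<Longrightarrow> \<exists>d\<in>D. d \<in> V"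
    using countable_dense_exists by blast
  have "D \<noteq> {}" using D(2)[of UNIV] by auto
  define d where "d = from_nat_into D"
  define c where "c k = (let z = d (fst (prod_decode k)) in if cmod z \<le> real k + 1 then z else 0)" for k
  have "cmod (c k) \<le> real k + 1" for k by (simp add: c_def Let_def)
  moreover have "\<exists>k\<ge>K. cmod (c k - z) < \<epsilon>" if "0 < \<epsilon>" for z \<epsilon> K
  proof -
    obtain w where w: "w \<in> D" "w \<in> ball z \<epsilon>" using D(2)[of "ball z \<epsilon>"] \<open>0 < \<epsilon>\<close> by auto
    obtain i where i: "d i = w"
      using w(1) D(1) from_nat_into_surj[of D w] unfolding d_def by auto
    obtain j where j: "cmod w \<le> real j" using real_arch_simple by blast
    \<comment> \<open>A code dominates its second component, so \<open>k\<close> lies beyond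
      \<open>K\<close> and is large enough for \<open>w\<close> to survive.\<close>
    define k where "k = prod_encode (i, max j K)"
    have "k \<ge> max j K" unfolding k_def by (rule le_prod_encode_2)
    then have "k \<ge> K" "cmod w \<le> real k + 1" using j by auto
    then show ?thesis
      using w(2) i by (intro exI[of _ k]) (simp add: c_def Let_def k_def dist_norm norm_minus_commute)
  qed
  ultimately show ?thesis by blast
qed

text \<open>\<open>bit_prod c 0 m\<close> is the product of \<open>c k\<close> over the binary digits \<open>1\<close> of \<open>m\<close>. In base \<open>2\<close> the
  initial segment of length \<open>2\<^sup>k\<close> thus reappears, multiplied by \<open>c k\<close>, at the positions from \<open>2\<^sup>k\<close> on.\<close>

function bit_prod :: "(nat \<Rightarrow> complex) \<Rightarrow> nat \<Rightarrow> nat \<Rightarrow> complex" where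
  "bit_prod c s m = (if m = 0 then 1 else (if odd m then c s else 1) * bit_prod c (Suc s) (m div 2))"
  by auto
termination by (relation "Wellfounded.measure (\<lambda>(c, s, m). m)") auto

declare bit_prod.simps [simp del]

lemma bit_prod_0 [simp]: "bit_prod c s 0 = 1"
  by (simp add: bit_prod.simps)

lemma bit_prod_rec: "bit_prod c s m = (if odd m then c s else 1) * bit_prod c (Suc s) (m div 2)"
  by (cases "m = 0") (simp_all add: bit_prod.simps[of c s m])

text \<open>Adding \<open>2 ^ k\<close> to \<open>j < 2 ^ k\<close> only sets the digit
  \<open>k\<close>. The offset \<open>s\<close> is general because the induction strips the lowest
  digit and moves on to \<open>Suc s\<close>.\<close>

lemma bit_prod_shift:
  "j < 2 ^ k \<Longrightarrow> bit_prod c s (2 ^ k + j) = c (s + k) * bit_prod c s j"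
proof (induction k arbitrary: s j)
  case 0
  then show ?case by (simp add: bit_prod_rec[of c s "Suc 0"])
next
  case (Suc k)
  have "(2 ^ Suc k + j) div 2 = 2 ^ k + j div 2" by simp
  moreover have "bit_prod c (Suc s) (2 ^ k + j div 2) = c (Suc s + k) * bit_prod c (Suc s) (j div 2)"
    using Suc.prems by (intro Suc.IH) auto
  ultimately show ?case
    using bit_prod_rec[of c s "2 ^ Suc k + j"] bit_prod_rec[of c s j] by simp
qed

text \<open>Induction on the leading digit \<open>2 ^ k\<close>: its factor \<open>c k\<close> is at
  most \<open>k + 1\<close>, well below the \<open>2 ^ (2 ^ k)\<close> that this digit contributes
  to the bound.\<close>

lemma cmod_bit_prod_le:
  assumes "\<And>k. cmod (c k) \<le> real k + 1"
  shows "cmod (bit_prod c 0 m) \<le> 2 ^ m"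
proof (induction m rule: less_induct)
  case (less m)
  show ?case
  proof (cases "m = 0")
    case False
    then obtain k where k: "2 ^ k \<le> m" "m < 2 ^ (k + 1)" using ex_power_ivl1[of 2 m] by auto
    define j where "j = m - 2 ^ k"
    have j: "m = 2 ^ k + j" "j < 2 ^ k" using k by (auto simp: j_def)
    have "real k + 1 \<le> 2 ^ (2 ^ k)"
    proof -
      have "k + 1 \<le> (2::nat) ^ k" by (simp add: Suc_leI)
      also have "\<dots> \<le> 2 ^ (2 ^ k)" by (intro power_increasing less_imp_le) auto
      finally have "real (k + 1) \<le> real (2 ^ (2 ^ k))" by (rule of_nat_mono)
      then show ?thesis by simp
    qed
    then have "cmod (c k) * cmod (bit_prod c 0 j) \<le> 2 ^ (2 ^ k) * 2 ^ j"
      using assms[of k] less.IH[of j] j by (intro mult_mono) auto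
    then show ?thesis
      using bit_prod_shift[OF j(2), of c 0] by (simp add: j(1) norm_mult power_add)
  qed simp
qed

text \<open>The terms are \<open>bit_prod c 0 m / 16 ^ m\<close>, and \<open>n = 2 ^ k\<close> with
  \<open>c k\<close> close to \<open>z\<close>. For \<open>m < n\<close> the digit shift gives
  exactly \<open>16 ^ n * x (m + n) = c k * x m\<close>. For \<open>m \<ge> n\<close> both terms are
  small. Digit products are at most \<open>2 ^ m\<close>, so the base \<open>16\<close> leaves a
  decay \<open>(1/8) ^ m\<close>: its part \<open>(1/4) ^ m\<close> beats the surplus
  \<open>2 ^ n\<close>, and \<open>(1/2) ^ m\<close> remains for the estimate.\<close>

lemma ex_universal_sequence:
  "\<exists>x :: nat \<Rightarrow> complex. x 0 = 1 \<and> (\<forall>m. cmod (x m) \<le> (1/2) ^ m) \<and>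
    (\<forall>z \<delta>. 0 < \<delta> \<longrightarrow> (\<exists>n. \<forall>m. cmod (16 ^ n * x (m + n) - z * x m) \<le> \<delta> * (1/2) ^ m))"
proof -
  obtain c :: "nat \<Rightarrow> complex" where c: "\<And>k. cmod (c k) \<le> real k + 1"
    and rec: "\<And>z \<epsilon> K. 0 < \<epsilon> \<Longrightarrow> \<exists>k\<ge>K. cmod (c k - z) < \<epsilon>"
    using ex_slow_recurrent_sequence by blast
  define x where "x m = bit_prod c 0 m / 16 ^ m" for m
  have x8: "cmod (x m) \<le> (1/8) ^ m" for m
    using cmod_bit_prod_le[OF c, of m]
    by (simp add: x_def norm_divide norm_power divide_le_eq flip: power_mult_distrib)
  have "cmod (x m) \<le> (1/2) ^ m" for m
    by (rule order_trans[OF x8]) (intro power_mono, auto)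
  moreover have "\<exists>n. \<forall>m. cmod (16 ^ n * x (m + n) - z * x m) \<le> \<delta> * (1/2) ^ m" if "0 < \<delta>" for z \<delta>
  proof -
    have "(\<lambda>n. (1 + cmod z) * (1/2) ^ n) \<longlonglongrightarrow> (1 + cmod z) * 0"
      by (intro tendsto_intros) auto
    then have "(\<lambda>n. (1 + cmod z) * (1/2) ^ n) \<longlonglongrightarrow> 0" by simp
    from order_tendstoD(2)[OF this \<open>0 < \<delta>\<close>] obtain K
      where K: "\<And>n. n \<ge> K \<Longrightarrow> (1 + cmod z) * (1/2) ^ n < \<delta>"
      unfolding eventually_sequentially by blast
    obtain k where k: "k \<ge> K" "cmod (c k - z) < \<delta>" using rec[OF \<open>0 < \<delta>\<close>] by blast
    define n where "n = (2::nat) ^ k"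
    have "n \<ge> K" using k(1) less_exp[of k] unfolding n_def by linarith
    have "cmod (16 ^ n * x (m + n) - z * x m) \<le> \<delta> * (1/2) ^ m" for m
    proof (cases "m < n")
      case True
      then have "16 ^ n * x (m + n) = c k * x m"
        using bit_prod_shift[of m k c 0] by (simp add: x_def n_def add.commute power_add)
      then have "cmod (16 ^ n * x (m + n) - z * x m) = cmod (c k - z) * cmod (x m)"
        by (simp add: norm_mult flip: left_diff_distrib)
      also have "\<dots> \<le> \<delta> * (1/2) ^ m"
        using k(2) \<open>cmod (x m) \<le> (1/2) ^ m\<close> \<open>0 < \<delta>\<close> by (intro mult_mono) auto
      finally show ?thesis .
    next
      case False
      have e1: "cmod (16 ^ n * x (m + n)) \<le> (1/8) ^ m * 2 ^ n"
      proof -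
        have "cmod (16 ^ n * x (m + n)) = cmod (bit_prod c 0 (m + n)) / 16 ^ m"
          by (simp add: x_def norm_mult norm_divide norm_power power_add)
        also have "\<dots> \<le> 2 ^ (m + n) / 16 ^ m"
          by (intro divide_right_mono cmod_bit_prod_le c) simp
        also have "\<dots> = (2 / 16) ^ m * 2 ^ n" by (simp only: power_add power_divide) simp
        finally show ?thesis by simp
      qed
      have e2: "cmod (z * x m) \<le> cmod z * (1/8) ^ m"
        unfolding norm_mult by (intro mult_left_mono x8) auto
      have "(1/4) ^ m * 2 ^ n \<le> (1/4) ^ n * (2 ^ n :: real)"
        using False by (intro mult_right_mono power_decreasing) auto
      then have e3: "(1/4) ^ m * 2 ^ n \<le> ((1/2) ^ n :: real)" by (simp flip: power_mult_distrib)
      have e4: "(1/4) ^ m \<le> ((1/2) ^ n :: real)"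
        by (rule order_trans[OF _ e3]) simp
      have split: "(1/8) ^ m = (1/4) ^ m * ((1/2) ^ m :: real)" by (simp flip: power_mult_distrib)
      have "cmod (16 ^ n * x (m + n) - z * x m) \<le> (1/8) ^ m * 2 ^ n + cmod z * (1/8) ^ m"
        using norm_triangle_ineq4[of "16 ^ n * x (m + n)" "z * x m"] e1 e2 by linarith
      also have "\<dots> = ((1/4) ^ m * 2 ^ n + cmod z * (1/4) ^ m) * (1/2) ^ m"
        unfolding split by (simp add: algebra_simps)
      also have "\<dots> \<le> ((1/2) ^ n + cmod z * (1/2) ^ n) * (1/2) ^ m"
        using e3 e4 by (intro mult_right_mono add_mono mult_left_mono) auto
      also have "\<dots> \<le> \<delta> * (1/2) ^ m"
        using K[OF \<open>n \<ge> K\<close>] by (intro mult_right_mono) (auto simp: algebra_simps)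
      finally show ?thesis .
    qed
    then show ?thesis by blast
  qed
  moreover have "x 0 = 1" by (simp add: x_def)
  ultimately show ?thesis by blast
qed

lemma sum_geometric_sq_le:
  assumes "\<And>m. cmod (u m) \<le> \<delta> * (1/2) ^ m" "finite F"
  shows "(\<Sum>m\<in>F. (cmod (u m))\<^sup>2) \<le> 2 * \<delta>\<^sup>2"
proof -
  have g: "(\<lambda>m. \<delta>\<^sup>2 * (1/2) ^ m) sums (\<delta>\<^sup>2 * (1 / (1 - 1/2)))"
    by (intro sums_mult geometric_sums) auto
  have "(\<Sum>m\<in>F. (cmod (u m))\<^sup>2) \<le> (\<Sum>m\<in>F. \<delta>\<^sup>2 * (1/2) ^ m)"
  proof (rule sum_mono)
    fix m
    have "(cmod (u m))\<^sup>2 \<le> (\<delta> * (1/2) ^ m)\<^sup>2" by (intro power_mono assms) simp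
    also have "\<dots> = (\<delta>\<^sup>2 * (1/2) ^ m) * (1/2) ^ m" by (simp add: power2_eq_square)
    also have "\<dots> \<le> \<delta>\<^sup>2 * (1/2) ^ m" by (intro mult_left_le power_le_one) auto
    finally show "(cmod (u m))\<^sup>2 \<le> \<delta>\<^sup>2 * (1/2) ^ m" .
  qed
  also have "\<dots> \<le> suminf (\<lambda>m. \<delta>\<^sup>2 * (1/2) ^ m)"
    by (rule sum_le_suminf[OF sums_summable[OF g] assms(2)]) auto
  finally show ?thesis using sums_unique[OF g] by simp
qed

lemma sum_int_geometric_sq_le:
  assumes "\<And>m. cmod (u m) \<le> \<delta> * (1/2) ^ m" "finite F"
  shows "(\<Sum>j\<in>F. (cmod (if 0 \<le> (j::int) then u (nat j) else 0))\<^sup>2) \<le> 2 * \<delta>\<^sup>2"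
proof -
  have "(\<Sum>j\<in>F. (cmod (if 0 \<le> j then u (nat j) else 0))\<^sup>2) = (\<Sum>j\<in>{j\<in>F. 0 \<le> j}. (cmod (u (nat j)))\<^sup>2)"
    using assms(2) by (intro sum.mono_neutral_cong_right) auto
  also have "\<dots> = (\<Sum>m\<in>nat ` {j\<in>F. 0 \<le> j}. (cmod (u m))\<^sup>2)"
    by (subst sum.reindex) (auto simp: inj_on_def)
  also have "\<dots> \<le> 2 * \<delta>\<^sup>2" using assms(2) by (intro sum_geometric_sq_le assms(1)) auto
  finally show ?thesis .
qed

context orthonormal
begin

text \<open>\<open>R\<close> is \<open>16\<close> times the backward shift on the basis vectors of
  nonnegative index and annihilates those of negative index; \<open>g\<close> carries the universal
  sequence on the nonnegative indices.\<close>

lemma ex_universal_operator: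
  "\<exists>(R :: 'h \<Rightarrow> 'h) g. bounded_clinear R \<and> g \<noteq> 0 \<and>
    (\<forall>z \<epsilon>. 0 < \<epsilon> \<longrightarrow> (\<exists>n. norm ((R ^^ n) g - z *\<^sub>C g) < \<epsilon>))"
proof -
  obtain x where x: "x 0 = 1" "\<And>m. cmod (x m) \<le> (1/2) ^ m"
    "\<And>z \<delta>. 0 < \<delta> \<Longrightarrow> \<exists>n. \<forall>m. cmod (16 ^ n * x (m + n) - z * x m) \<le> \<delta> * (1/2) ^ m"
    using ex_universal_sequence by blast
  have "\<exists>r. (\<forall>i. cinner r (e i) = (if 0 \<le> i then 16 * cinner h (e (i + 1)) else 0)) \<and>
      norm r \<le> 16 * norm h" for h
  proof -
    let ?a = "\<lambda>i. if 0 \<le> i then 16 * cinner h (e (i + 1)) else 0"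
    have "(\<Sum>i\<in>F. (cmod (?a i))\<^sup>2) \<le> (16 * norm h)\<^sup>2" if F: "finite F" for F
    proof -
      have "(\<Sum>i\<in>F. (cmod (?a i))\<^sup>2) \<le> (\<Sum>i\<in>F. 256 * (cmod (cinner h (e (i + 1))))\<^sup>2)"
        by (intro sum_mono) (simp add: norm_mult power_mult_distrib)
      also have "\<dots> = 256 * (\<Sum>i\<in>(\<lambda>i. i + 1) ` F. (cmod (cinner h (e i)))\<^sup>2)"
        by (subst sum.reindex) (auto simp: sum_distrib_left inj_on_def)
      also have "\<dots> \<le> 256 * (norm h)\<^sup>2" using F by (intro mult_left_mono Bessel) auto
      finally show ?thesis by (simp add: power_mult_distrib)
    qed
    from ex_coefficients[OF this] obtain r where "\<And>i. cinner r (e i) = ?a i" "(norm r)\<^sup>2 \<le> (16 * norm h)\<^sup>2"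
      by metis
    moreover from this(2) have "norm r \<le> 16 * norm h" by (rule power2_le_imp_le) simp
    ultimately show ?thesis by blast
  qed
  then obtain R where R: "\<And>h i. cinner (R h) (e i) = (if 0 \<le> i then 16 * cinner h (e (i + 1)) else 0)"
    and R16: "\<And>h. norm (R h) \<le> 16 * norm h" by metis
  have bR: "bounded_clinear R"
    by (rule bounded_clinearI[OF _ _ R16])
      (rule ext_e, simp add: R cinner_add_left cinner_scaleC_left algebra_simps)+
  have "(\<Sum>j\<in>F. (cmod (if 0 \<le> j then x (nat j) else 0))\<^sup>2) \<le> 2 * 1\<^sup>2" if "finite F" for F
    using x(2) that by (intro sum_int_geometric_sq_le) auto
  from ex_coefficients[OF this] obtain g where g: "\<And>i. cinner g (e i) = (if 0 \<le> i then x (nat i) else 0)"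
    by metis
  have Rn: "cinner ((R ^^ n) g) (e i) = (if 0 \<le> i then 16 ^ n * x (nat i + n) else 0)" for n i
    by (induction n arbitrary: i) (auto simp: g R nat_add_distrib)
  have "g \<noteq> 0" using g[of 0] x(1) by auto
  moreover have "\<exists>n. norm ((R ^^ n) g - z *\<^sub>C g) < \<epsilon>" if "0 < \<epsilon>" for z \<epsilon>
  proof -
    \<comment> \<open>Summing squares costs a factor \<open>2\<close>, and
      \<open>2 (\<epsilon>/2)^2\<close> is still below \<open>\<epsilon>^2\<close>.\<close>
    obtain n where n: "\<And>m. cmod (16 ^ n * x (m + n) - z * x m) \<le> \<epsilon> / 2 * (1/2) ^ m"
      using x(3)[of "\<epsilon> / 2" z] \<open>0 < \<epsilon>\<close> by auto
    let ?d = "(R ^^ n) g - z *\<^sub>C g"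
    let ?u = "\<lambda>m. 16 ^ n * x (m + n) - z * x m"
    have d: "cinner ?d (e i) = (if 0 \<le> i then ?u (nat i) else 0)" for i
      by (simp add: cinner_diff_left cinner_scaleC_left Rn g)
    have "(norm ?d)\<^sup>2 \<le> 2 * (\<epsilon> / 2)\<^sup>2"
    proof (rule has_sum_le_finite_sums[OF Parseval[of ?d]])
      show "(\<Sum>j\<in>F. (cmod (cinner ?d (e j)))\<^sup>2) \<le> 2 * (\<epsilon> / 2)\<^sup>2" if "finite F" for F
        unfolding d by (rule sum_int_geometric_sq_le[of ?u, OF n that])
    qed
    moreover have "2 * (\<epsilon> / 2)\<^sup>2 < \<epsilon>\<^sup>2"
      using zero_less_power[OF \<open>0 < \<epsilon>\<close>, of 2] by (simp add: power_divide)
    ultimately have "(norm ?d)\<^sup>2 < \<epsilon>\<^sup>2" by (rule le_less_trans)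
    then have "norm ?d < \<epsilon>" by (rule power2_less_imp_less) (use \<open>0 < \<epsilon>\<close> in simp)
    then show ?thesis by blast
  qed
  ultimately show ?thesis using bR by (intro exI[of _ R] exI[of _ g]) auto
qed

subsection \<open>Operators on spaces of operators\<close>

definition column_op :: "('h \<Rightarrow> 'h) \<Rightarrow> ('h \<Rightarrow> 'h) \<Rightarrow> 'h \<Rightarrow> 'h"
  where "column_op R A = rank_one (e 0) (R (A (e 0)))"

lemma rank_one_e: "rank_one (e 0) v (e j) = (if j = 0 then v else 0)"
  by (simp add: rank_one_def cinner_e scaleC_one)

lemma rank_one_diff_scaleC: "rank_one u v - c *\<^sub>C rank_one u w = rank_one u (v - c *\<^sub>C w)"
  by (rule ext) (simp add: rank_one_def scaleC_fun_apply scaleC_diff_right scaleC_scaleC mult.commute)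

lemma rank_one_e_nonzero: "v \<noteq> 0 \<Longrightarrow> rank_one (e 0) v \<noteq> 0"
  using rank_one_e[of v 0] by auto

lemma onorm_rank_one_e_le: "onorm (rank_one (e 0) v) \<le> norm v"
  by (rule onorm_bound)
    (use mult_right_mono[OF cinner_Cauchy_Schwarz[of _ "e 0"] norm_ge_zero[of v]] in
      \<open>simp_all add: rank_one_def norm_scaleC mult.commute[of "norm v"]\<close>)

lemma column_op_linear:
  assumes R: "bounded_clinear R"
  shows "column_op R (A + B) = column_op R A + column_op R B"
    and "column_op R (c *\<^sub>C A) = c *\<^sub>C column_op R A"
  by (auto simp: column_op_def rank_one_def bounded_clinear_simps[OF R] scaleC_fun_apply
      scaleC_add_right scaleC_scaleC mult.commute intro!: ext)

text \<open>The embedding \<open>rank_one (e 0)\<close> intertwines \<open>R\<close> with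
  \<open>column_op R\<close>, which carries the recurrence of \<open>g\<close> over to a rank one
  operator.\<close>

lemma column_op_funpow: "(column_op R ^^ n) (rank_one (e 0) g) = rank_one (e 0) ((R ^^ n) g)"
  by (induction n) (simp_all add: column_op_def rank_one_e)

lemma column_op_funpow_e1:
  assumes "n > 0" shows "(column_op R ^^ n) A (e 1) = 0"
  using assms by (cases n) (simp_all add: column_op_def rank_one_e)

text \<open>Shared by the three spaces. By \<open>diff\<close> the entry at \<open>e 1\<close> is
  Lipschitz on \<open>M\<close>, so the operators whose entry exceeds \<open>2\<close> form an open
  set; the multiple \<open>3\<close> of a projection lies in it, and \<open>small\<close> keeps all
  values of the form outside.\<close>

lemma not_Cstar_transitiveI:
  fixes \<phi> :: "'x::complex_vector \<Rightarrow> 'x \<Rightarrow> 'h \<Rightarrow> 'h"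
  assumes X: "complex_nspace X" "norming X" "x0 \<in> carr X" "x0 \<noteq> 0"
    and diff: "\<And>A B. A \<in> carr M \<Longrightarrow> B \<in> carr M \<Longrightarrow>
      cmod (cinner ((A - B) (e 1)) (e 1)) \<le> C * nrm M (A - B)" and C: "C > 0"
    and large: "(\<lambda>h. complex_of_real 3 *\<^sub>C rank_one (e 1) (e 1) h) \<in> carr M"
    and small: "\<And>n x y. x \<in> unit_sphere X \<Longrightarrow> y \<in> unit_sphere X \<Longrightarrow>
      cmod (cinner (\<phi> ((T ^^ n) x) y (e 1)) (e 1)) \<le> 1"
  shows "\<not> Cstar_transitive X M \<phi> T"
proof
  assume transitive: "Cstar_transitive X M \<phi> T"
  interpret complex_nspace X by fact
  let ?q = "\<lambda>A :: 'h \<Rightarrow> 'h. cmod (cinner (A (e 1)) (e 1))"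
  define V where "V = {A \<in> carr M. 2 < ?q A}"
  have "open_wrt (carr M) (nrm_dist M) V"
    unfolding open_wrt_def
  proof (intro conjI ballI)
    fix A assume A: "A \<in> V"
    have "B \<in> V" if B: "B \<in> carr M" "nrm_dist M A B < (?q A - 2) / C" for B
    proof -
      have "?q A - ?q B \<le> cmod (cinner ((A - B) (e 1)) (e 1))"
        using norm_triangle_ineq2[of "cinner (A (e 1)) (e 1)" "cinner (B (e 1)) (e 1)"]
        by (simp add: cinner_diff_left)
      also have "\<dots> \<le> C * nrm M (A - B)" using A B by (intro diff) (auto simp: V_def)
      also have "\<dots> < ?q A - 2"
        using B(2) C by (simp add: nrm_dist_def pos_less_divide_eq mult.commute)
      finally show ?thesis using B by (simp add: V_def)
    qed
    moreover have "(?q A - 2) / C > 0" using A C by (simp add: V_def)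
    ultimately show "\<exists>\<epsilon>>0. \<forall>B\<in>carr M. nrm_dist M A B < \<epsilon> \<longrightarrow> B \<in> V" by blast
  qed (auto simp: V_def)
  moreover have "V \<noteq> {}"
  proof -
    have "?q (\<lambda>h. complex_of_real 3 *\<^sub>C rank_one (e 1) (e 1) h) = 3"
      by (simp add: rank_one_def cinner_scaleC_left cinner_e)
    with large show ?thesis by (auto simp: V_def intro!: exI)
  qed
  \<comment> \<open>No small neighbourhood is called for: already the full product of spheres
    violates transitivity.\<close>
  moreover have "open_wrt (unit_sphere X \<times> unit_sphere X) (max_dist X X) (unit_sphere X \<times> unit_sphere X)"
    unfolding open_wrt_def by (auto intro!: exI[of _ "1::real"])
  moreover have "unit_sphere X \<times> unit_sphere X \<noteq> {}"
    using normalise[OF X(3)] X(2-4) unfolding norming_def by blast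
  ultimately obtain n x y where "x \<in> unit_sphere X" "y \<in> unit_sphere X" "\<phi> ((T ^^ n) x) y \<in> V"
    using transitive unfolding Cstar_transitive_def by blast
  with small[of x y n] show False by (simp add: V_def)
qed

lemma cmod_op_form_le:
  assumes "bounded_clinear B" "norm (A (e 1)) \<le> 1" "norm (B (e 1)) \<le> 1"
  shows "cmod (cinner (op_form A B (e 1)) (e 1)) \<le> 1"
  using cinner_Cauchy_Schwarz[of "A (e 1)" "B (e 1)"] mult_mono[OF assms(2,3)]
  by (simp add: op_form_def adj'[OF assms(1)])

lemma norm_column_op_funpow_e1:
  assumes "norm (A (e 1)) \<le> 1"
  shows "norm ((column_op R ^^ n) A (e 1)) \<le> 1"
  using assms column_op_funpow_e1[of n R A] by (cases "n = 0") auto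

text \<open>\<open>trace_bound\<close> for the identity and a single basis vector;
  \<open>B1_diff\<close> is what makes it applicable to a difference.\<close>

lemma B1_diff_bound:
  assumes "A \<in> carr (B1 e)" "B \<in> carr (B1 e)"
  shows "cmod (cinner ((A - B) (e 1)) (e 1)) \<le> 9 * nrm (B1 e) (A - B)"
  using trace_bound[OF B1_diff[OF assms] bounded_clinear_id, of "{1}"] by simp

lemma B0_diff_bound:
  assumes "A \<in> carr B0" "B \<in> carr B0"
  shows "cmod (cinner ((A - B) (e 1)) (e 1)) \<le> 1 * nrm B0 (A - B)"
  using cinner_Cauchy_Schwarz[of "(A - B) (e 1)" "e 1"]
    bounded_clinearD(8)[OF B0_carrD(1)[OF B0.carr_diff[OF assms]], of "e 1"] by simp

lemma B0_projection: "(\<lambda>h. complex_of_real 3 *\<^sub>C rank_one (e 1) (e 1) h) \<in> carr B0"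
  using B0_scaleC[OF B0_rank_one, of "complex_of_real 3" "e 1" "e 1"] by (simp add: scaleC_fun_def)

lemma rank_one_B2: "rank_one (e 0) v \<in> carr (B2 e)" "nrm (B2 e) (rank_one (e 0) v) = norm v"
proof -
  have "((\<lambda>j. (norm (rank_one (e 0) v (e j)))\<^sup>2) has_sum (norm v)\<^sup>2) UNIV"
    by (rule has_sum_finite_neutralI[where B = "{0}"]) (auto simp: rank_one_e)
  then show "rank_one (e 0) v \<in> carr (B2 e)" "nrm (B2 e) (rank_one (e 0) v) = norm v"
    by (auto simp: B2_def bounded_clinear_rank_one has_sum_imp_summable infsumI)
qed

lemma B2_example:
  "\<exists>T\<in>bounded_ops (B2 e). strongly_numerically_hypercyclic (B2 e) T \<and>
    \<not> Cstar_transitive (B2 e) (B1 e) op_form T"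
proof -
  obtain R :: "'h \<Rightarrow> 'h" and g where R: "bounded_clinear R" and g: "g \<noteq> 0"
    and approx: "\<And>z \<epsilon>. 0 < \<epsilon> \<Longrightarrow> \<exists>n. norm ((R ^^ n) g - z *\<^sub>C g) < \<epsilon>"
    using ex_universal_operator by blast
  let ?T = "column_op R" and ?x = "rank_one (e 0) g"
  have T: "?T \<in> bounded_ops (B2 e)"
  proof -
    have "nrm (B2 e) (?T A) \<le> onorm R * nrm (B2 e) A" if "A \<in> carr (B2 e)" for A
    proof -
      have "nrm (B2 e) (?T A) \<le> onorm R * norm (A (e 0))"
        unfolding column_op_def rank_one_B2 by (rule bounded_clinearD(8)[OF R])
      also have "\<dots> \<le> onorm R * nrm (B2 e) A"
        by (intro mult_left_mono B2.norm_U_le that onorm_nonneg R)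
      finally show ?thesis .
    qed
    moreover have "?T ` carr (B2 e) \<subseteq> carr (B2 e)" by (auto simp: column_op_def rank_one_B2)
    ultimately show ?thesis
      unfolding bounded_ops_def linear_on_carr_def by (auto simp: column_op_linear[OF R])
  qed
  have "strongly_numerically_hypercyclic (B2 e) ?T"
    by (rule B2.strongly_numerically_hypercyclicI[OF B2.norming T rank_one_B2(1) rank_one_e_nonzero[OF g]])
      (use approx in \<open>simp add: column_op_funpow rank_one_diff_scaleC rank_one_B2(2)\<close>)
  moreover have "\<not> Cstar_transitive (B2 e) (B1 e) op_form ?T"
  proof (rule not_Cstar_transitiveI[OF B2.complex_nspace_axioms B2.norming rank_one_B2(1)
        rank_one_e_nonzero[OF g] B1_diff_bound _ B1_projection])
    fix n x y assume x: "x \<in> unit_sphere (B2 e)" and y: "y \<in> unit_sphere (B2 e)"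
    have "norm (x (e 1)) \<le> 1" "norm (y (e 1)) \<le> 1" "bounded_clinear y"
      using B2.norm_U_le[of x 1] B2.norm_U_le[of y 1] x y by (auto simp: unit_sphere_def B2_def)
    then show "cmod (cinner (op_form ((?T ^^ n) x) y (e 1)) (e 1)) \<le> 1"
      by (intro cmod_op_form_le norm_column_op_funpow_e1)
  qed auto
  ultimately show ?thesis using T by blast
qed

lemma onorm_column_op_le:
  assumes R: "bounded_clinear R" shows "onorm (column_op R A) \<le> onorm R * norm (A (e 0))"
  unfolding column_op_def
  by (rule order_trans[OF onorm_rank_one_e_le bounded_clinearD(8)[OF R]])

lemma B0_example:
  "\<exists>T\<in>bounded_ops (B0 :: ('h \<Rightarrow> 'h) nspace). strongly_numerically_hypercyclic B0 T \<and>
    \<not> Cstar_transitive B0 B0 op_form T"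
proof -
  obtain R :: "'h \<Rightarrow> 'h" and g where R: "bounded_clinear R" and g: "g \<noteq> 0"
    and approx: "\<And>z \<epsilon>. 0 < \<epsilon> \<Longrightarrow> \<exists>n. norm ((R ^^ n) g - z *\<^sub>C g) < \<epsilon>"
    using ex_universal_operator by blast
  let ?T = "column_op R" and ?x = "rank_one (e 0) g"
  have norm_e: "norm (A (e j)) \<le> onorm A" if "A \<in> carr B0" for A :: "'h \<Rightarrow> 'h" and j
    using bounded_clinearD(8)[OF B0_carrD(1)[OF that], of "e j"] by simp
  have T: "?T \<in> bounded_ops B0"
  proof -
    have "onorm (?T A) \<le> onorm R * onorm A" if "A \<in> carr B0" for A
      by (rule order_trans[OF onorm_column_op_le[OF R]])
        (intro mult_left_mono norm_e that onorm_nonneg R)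
    moreover have "?T ` carr B0 \<subseteq> carr B0" by (auto simp: column_op_def B0_rank_one)
    ultimately show ?thesis
      unfolding bounded_ops_def linear_on_carr_def by (auto simp: column_op_linear[OF R])
  qed
  have "strongly_numerically_hypercyclic B0 ?T"
  proof (rule B0.strongly_numerically_hypercyclicI[OF B0_norming T B0_rank_one rank_one_e_nonzero[OF g]])
    fix c \<epsilon> assume "0 < (\<epsilon>::real)"
    then obtain n where n: "norm ((R ^^ n) g - c *\<^sub>C g) < \<epsilon>" using approx by blast
    have "nrm B0 ((?T ^^ n) ?x - c *\<^sub>C ?x) \<le> norm ((R ^^ n) g - c *\<^sub>C g)"
      by (simp add: column_op_funpow rank_one_diff_scaleC onorm_rank_one_e_le)
    with n show "\<exists>n. nrm B0 ((?T ^^ n) ?x - c *\<^sub>C ?x) < \<epsilon>" by (meson le_less_trans)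
  qed
  moreover have "\<not> Cstar_transitive B0 B0 op_form ?T"
  proof (rule not_Cstar_transitiveI[OF B0.complex_nspace_axioms B0_norming B0_rank_one
        rank_one_e_nonzero[OF g] B0_diff_bound _ B0_projection])
    fix n and x y :: "'h \<Rightarrow> 'h" assume x: "x \<in> unit_sphere B0" and y: "y \<in> unit_sphere B0"
    have "norm (x (e 1)) \<le> 1" "norm (y (e 1)) \<le> 1" "bounded_clinear y"
      using norm_e[of x 1] norm_e[of y 1] x y by (auto simp: unit_sphere_def B0_carrD)
    then show "cmod (cinner (op_form ((?T ^^ n) x) y (e 1)) (e 1)) \<le> 1"
      by (intro cmod_op_form_le norm_column_op_funpow_e1)
  qed auto
  ultimately show ?thesis using T by blast
qed

lemma column_diff_scaleC: "column A - c *\<^sub>C column B = column (A - c *\<^sub>C B)"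
  by (rule ext) (simp add: column_def scaleC_fun_apply[of c "\<lambda>j. if j = 0 then B else 0"])

lemma l2_module_example:
  "\<exists>T\<in>bounded_ops (l2_module :: (nat \<Rightarrow> 'h \<Rightarrow> 'h) nspace).
    strongly_numerically_hypercyclic l2_module T \<and> \<not> Cstar_transitive l2_module B0 module_form T"
proof -
  obtain R :: "'h \<Rightarrow> 'h" and g where R: "bounded_clinear R" and g: "g \<noteq> 0"
    and approx: "\<And>z \<epsilon>. 0 < \<epsilon> \<Longrightarrow> \<exists>n. norm ((R ^^ n) g - z *\<^sub>C g) < \<epsilon>"
    using ex_universal_operator by blast
  define T where "T x = column (column_op R (x 0))" for x :: "nat \<Rightarrow> 'h \<Rightarrow> 'h"
  let ?x = "column (rank_one (e 0) g)"
  have colB: "column_op R A \<in> carr B0" for A by (simp add: column_op_def B0_rank_one)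
  have T: "T \<in> bounded_ops l2_module"
  proof -
    have "nrm l2_module (T x) \<le> onorm R * nrm l2_module x" if x: "x \<in> carr l2_module" for x
    proof -
      have "nrm l2_module (T x) \<le> onorm R * norm (x 0 (e 0))"
        unfolding T_def by (rule order_trans[OF nrm_column_le[OF colB] onorm_column_op_le[OF R]])
      also have "\<dots> \<le> onorm R * nrm l2_module x"
        using norm_coordinate_le[OF x, of 0 "e 0"] onorm_nonneg[OF R] by (intro mult_left_mono) auto
      finally show ?thesis .
    qed
    moreover have "T ` carr l2_module \<subseteq> carr l2_module" by (auto simp: T_def column_carr colB)
    moreover have "T (x + y) = T x + T y" "T (c *\<^sub>C x) = c *\<^sub>C T x" for x y c
      by (auto simp: T_def column_def column_op_linear[OF R] scaleC_fun_apply[of c x]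
          scaleC_fun_apply[of c "\<lambda>j. if j = 0 then column_op R (x 0) else 0"] intro!: ext)
    ultimately show ?thesis unfolding bounded_ops_def linear_on_carr_def by auto
  qed
  have Tn: "(T ^^ n) (column A) = column ((column_op R ^^ n) A)" for n A
  proof (induction n)
    case (Suc n)
    have "T (column B) = column (column_op R B)" for B by (simp add: T_def column_def[of B])
    with Suc show ?case by simp
  qed simp
  have xc: "?x \<in> carr l2_module" by (rule column_carr[OF B0_rank_one])
  have x0: "?x \<noteq> 0"
  proof
    assume "?x = 0"
    then have "?x 0 = 0" by simp
    then show False using rank_one_e_nonzero[OF g] by (simp add: column_def)
  qed
  have "strongly_numerically_hypercyclic l2_module T"
  proof (rule l2_module.strongly_numerically_hypercyclicI[OF l2_module_norming T xc x0])
    fix c \<epsilon> assume "0 < (\<epsilon>::real)"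
    then obtain n where n: "norm ((R ^^ n) g - c *\<^sub>C g) < \<epsilon>" using approx by blast
    have "nrm l2_module ((T ^^ n) ?x - c *\<^sub>C ?x) \<le> norm ((R ^^ n) g - c *\<^sub>C g)"
      by (simp add: Tn column_op_funpow column_diff_scaleC rank_one_diff_scaleC
          order_trans[OF nrm_column_le[OF B0_rank_one] onorm_rank_one_e_le])
    with n show "\<exists>n. nrm l2_module ((T ^^ n) ?x - c *\<^sub>C ?x) < \<epsilon>" by (meson le_less_trans)
  qed
  moreover have "\<not> Cstar_transitive l2_module B0 module_form T"
  proof (rule not_Cstar_transitiveI[OF l2_module.complex_nspace_axioms l2_module_norming xc x0
        B0_diff_bound _ B0_projection])
    fix n and x y :: "nat \<Rightarrow> 'h \<Rightarrow> 'h"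
    assume "x \<in> unit_sphere l2_module" and "y \<in> unit_sphere l2_module"
    then have x: "x \<in> carr l2_module" "nrm l2_module x = 1" and y: "y \<in> carr l2_module" "nrm l2_module y = 1"
      by (auto simp: unit_sphere_def)
    show "cmod (cinner (module_form ((T ^^ n) x) y (e 1)) (e 1)) \<le> 1"
    proof (cases n)
      case 0
      then show ?thesis using cmod_module_form_le[OF x(1) y(1), of "e 1" "e 1"] x y by simp
    next
      \<comment> \<open>One application of \<open>T\<close> leaves only coordinate \<open>0\<close>,
        so every iterate from the first on is a column, whatever the other coordinates of
        \<open>x\<close> are.\<close>
      case (Suc m)
      define A where "A = (column_op R ^^ m) (column_op R (x 0))"
      have A: "(T ^^ n) x = column A"
        by (simp only: Suc funpow_Suc_right comp_def T_def[of x] Tn A_def)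
      have "A = (column_op R ^^ n) (x 0)" by (simp only: A_def Suc funpow_Suc_right comp_def)
      then have Ae: "A (e 1) = 0" using column_op_funpow_e1[of n R "x 0"] Suc by simp
      have "(\<lambda>j. cinner (column A j (e 1)) (y j (e 1))) = (\<lambda>j. 0)"
        by (auto simp: column_def Ae)
      then have "cinner (module_form ((T ^^ n) x) y (e 1)) (e 1) = 0"
        using sums_unique[OF module_form(2)[OF bounded_ops_funpow[OF T x(1)] y(1), of n "e 1" "e 1"]]
        by (simp add: A)
      then show ?thesis by simp
    qed
  qed auto
  ultimately show ?thesis using T by blast
qed

end

subsection \<open>The sequence space\<close>

text \<open>Injectivity of \<open>\<sigma>\<close> means that no entry of \<open>x\<close> is used
  twice. This covers the operator \<open>T\<close>, the deletion of a coordinate and the shifted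
  tail.\<close>

lemma ell2_dominated:
  assumes x: "x \<in> carr ell2" and \<sigma>: "inj \<sigma>" and a: "0 \<le> a"
    and w: "\<And>m. cmod (w m) \<le> a * cmod (x (\<sigma> m))"
  shows "w \<in> carr ell2" "nrm ell2 w \<le> a * nrm ell2 x"
proof -
  have xs: "(\<lambda>m. (cmod (x m))\<^sup>2) summable_on UNIV" using x by (simp add: ell2_carr_iff)
  let ?M = "a\<^sup>2 * (\<Sum>\<^sub>\<infinity>m. (cmod (x m))\<^sup>2)"
  have fin: "(\<Sum>m\<in>F. (cmod (w m))\<^sup>2) \<le> ?M" if "finite F" for F
  proof -
    have "(\<Sum>m\<in>F. (cmod (w m))\<^sup>2) \<le> (\<Sum>m\<in>F. a\<^sup>2 * (cmod (x (\<sigma> m)))\<^sup>2)"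
      using power_mono[OF w, of _ 2] by (intro sum_mono) (simp add: power_mult_distrib)
    also have "\<dots> = a\<^sup>2 * (\<Sum>m\<in>\<sigma> ` F. (cmod (x m))\<^sup>2)"
      by (subst sum.reindex) (use \<sigma> in \<open>auto simp: sum_distrib_left intro: inj_on_subset\<close>)
    also have "\<dots> \<le> ?M" using that by (intro mult_left_mono finite_sum_le_infsum xs) auto
    finally show ?thesis .
  qed
  have ws: "(\<lambda>m. (cmod (w m))\<^sup>2) summable_on UNIV"
    by (rule nonneg_bdd_above_summable_on) (use fin in \<open>auto intro!: bdd_aboveI[where M = ?M]\<close>)
  then show wc: "w \<in> carr ell2" by (simp add: ell2_carr_iff)
  have "(\<Sum>\<^sub>\<infinity>m. (cmod (w m))\<^sup>2) \<le> ?M" by (rule infsum_le_finite_sums[OF ws fin])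
  then have "sqrt (\<Sum>\<^sub>\<infinity>m. (cmod (w m))\<^sup>2) \<le> sqrt ?M" by (rule real_sqrt_le_mono)
  then show "nrm ell2 w \<le> a * nrm ell2 x"
    using a by (simp add: nrm_ell2 wc x real_sqrt_mult)
qed

lemma nrm_ell2_nonneg: "x \<in> carr ell2 \<Longrightarrow> 0 \<le> nrm ell2 x"
  by (simp add: nrm_ell2 infsum_nonneg)

lemma nrm_ell2_le:
  assumes "x \<in> carr ell2" "\<And>F. finite F \<Longrightarrow> (\<Sum>m\<in>F. (cmod (x m))\<^sup>2) \<le> M"
  shows "nrm ell2 x \<le> sqrt M"
  unfolding nrm_ell2[OF assms(1)]
  using assms by (intro real_sqrt_le_mono infsum_le_finite_sums) (simp_all add: ell2_carr_iff)

lemma geometric_ell2: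
  assumes "\<And>m. cmod (u m) \<le> \<delta> * (1/2) ^ m"
  shows "u \<in> carr ell2" "nrm ell2 u \<le> sqrt (2 * \<delta>\<^sup>2)"
proof -
  show c: "u \<in> carr ell2"
    unfolding ell2_carr_iff
    by (rule nonneg_bdd_above_summable_on)
      (use sum_geometric_sq_le[of u \<delta>, OF assms] in \<open>auto intro!: bdd_aboveI[where M = "2 * \<delta>\<^sup>2"]\<close>)
  show "nrm ell2 u \<le> sqrt (2 * \<delta>\<^sup>2)"
    by (rule nrm_ell2_le[OF c sum_geometric_sq_le[of u \<delta>, OF assms]])
qed

text \<open>The first coordinate is an eigenvector whose eigenvalue \<open>17\<close> exceeds the growth rate \<open>16\<close> on the
  other coordinates. So states that are nearly supported on it cannot return close to \<open>0\<close>.\<close>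

lemma ell2_example:
  "\<exists>T\<in>bounded_ops ell2. strongly_numerically_hypercyclic ell2 T \<and>
    \<not> topologically_numerically_transitive ell2 T"
proof -
  \<comment> \<open>Coordinate \<open>0\<close> is scaled by \<open>17\<close>; the others undergo
    \<open>16\<close> times their own backward shift, in which the entry \<open>x 1\<close> is
    dropped.\<close>
  define T :: "(nat \<Rightarrow> complex) \<Rightarrow> nat \<Rightarrow> complex"
    where "T x = (\<lambda>m. if m = 0 then 17 * x 0 else 16 * x (Suc m))" for x
  have T: "T \<in> bounded_ops ell2"
  proof -
    have "cmod (T x m) \<le> 17 * cmod (x (if m = 0 then 0 else Suc m))" for x m
      by (simp add: T_def norm_mult)
    moreover have "inj (\<lambda>m::nat. if m = 0 then 0 else Suc m)" by (auto intro!: injI split: if_splits)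
    ultimately have "T x \<in> carr ell2 \<and> nrm ell2 (T x) \<le> 17 * nrm ell2 x" if "x \<in> carr ell2" for x
      using ell2_dominated[OF that, of "\<lambda>m. if m = 0 then 0 else Suc m" 17 "T x"] by simp
    moreover have "T (x + y) = T x + T y" "T (c *\<^sub>C x) = c *\<^sub>C T x" for x y c
      by (rule ext, simp add: T_def scaleC_fun_apply scaleC_complex_def distrib_left)+
    ultimately show ?thesis
      unfolding bounded_ops_def linear_on_carr_def by auto
  qed
  have Tn: "(T ^^ n) x = (\<lambda>m. if m = 0 then 17 ^ n * x 0 else 16 ^ n * x (m + n))" for n x
    by (induction n) (auto simp: T_def fun_eq_iff)
  have "strongly_numerically_hypercyclic ell2 T"
  proof -
    obtain u where u: "u 0 = 1" "\<And>m. cmod (u m) \<le> (1/2) ^ m"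
      "\<And>z \<delta>. 0 < \<delta> \<Longrightarrow> \<exists>n. \<forall>m. cmod (16 ^ n * u (m + n) - z * u m) \<le> \<delta> * (1/2) ^ m"
      using ex_universal_sequence by blast
    \<comment> \<open>The universal sequence, moved past the eigenvector coordinate. The index shift
      doubles geometric bounds, which turns \<open>\<epsilon>/4\<close> into
      \<open>\<epsilon>/2\<close> below.\<close>
    define x where "x m = (if m = 0 then 0 else u (m - 1))" for m
    have "cmod (x m) \<le> 2 * (1/2) ^ m" for m
      using u(2)[of "m - 1"] by (cases m) (auto simp: x_def)
    then have xc: "x \<in> carr ell2" by (rule geometric_ell2)
    have "x 1 \<noteq> 0" using u(1) by (simp add: x_def)
    then have "x \<noteq> 0" by auto
    show ?thesis
    proof (rule ell2.strongly_numerically_hypercyclicI[OF ell2.norming T xc \<open>x \<noteq> 0\<close>])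
      fix c and \<epsilon> :: real assume "0 < \<epsilon>"
      then obtain n where n: "\<And>m. cmod (16 ^ n * u (m + n) - c * u m) \<le> \<epsilon> / 4 * (1/2) ^ m"
        using u(3)[of "\<epsilon> / 4" c] by auto
      have "cmod (((T ^^ n) x - c *\<^sub>C x) m) \<le> \<epsilon> / 2 * (1/2) ^ m" for m
        using n[of "m - 1"] \<open>0 < \<epsilon>\<close>
        by (cases m) (auto simp: Tn x_def scaleC_fun_apply scaleC_complex_def)
      then have "nrm ell2 ((T ^^ n) x - c *\<^sub>C x) \<le> sqrt (2 * (\<epsilon> / 2)\<^sup>2)" by (rule geometric_ell2)
      also have "\<dots> < \<epsilon>"
        using \<open>0 < \<epsilon>\<close> zero_less_power[OF \<open>0 < \<epsilon>\<close>, of 2]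
        by (intro real_less_lsqrt) (simp_all add: power_divide)
      finally show "\<exists>n. nrm ell2 ((T ^^ n) x - c *\<^sub>C x) < \<epsilon>" ..
    qed
  qed
  moreover have "\<not> topologically_numerically_transitive ell2 T"
  proof
    assume transitive: "topologically_numerically_transitive ell2 T"
    define d :: "nat \<Rightarrow> complex" where "d = (\<lambda>m. if m = 0 then 1 else 0)"
    have dc: "d \<in> carr ell2"
      unfolding ell2_carr_iff
      by (rule finite_nonzero_values_imp_summable_on, rule finite_subset[of _ "{0}"]) (auto simp: d_def)
    have nd: "nrm ell2 d = 1"
    proof -
      have "((\<lambda>m. (cmod (d m))\<^sup>2) has_sum 1) UNIV"
        by (rule has_sum_finite_neutralI[where B = "{0}"]) (auto simp: d_def)
      then show ?thesis by (simp add: nrm_ell2[OF dc] infsumI)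
    qed
    \<comment> \<open>Both conditions are used: they give
      \<open>cmod (x 0 * f d) \<ge> 81/100\<close>, and \<open>1 - 81/100 < 1/4\<close> bounds the
      rest of \<open>x\<close> by \<open>1/2\<close>.\<close>
    define U where "U = {(x, f) \<in> num_states ell2. 9/10 < cmod (x 0) \<and> 9/10 < cmod (f d)}"
    have "open_wrt (num_states ell2) (max_dist ell2 (dual ell2)) U"
      unfolding open_wrt_def
    proof (intro conjI ballI)
      fix p assume "p \<in> U"
      then obtain x f where p: "p = (x, f)" and xf: "(x, f) \<in> num_states ell2"
        "9/10 < cmod (x 0)" "9/10 < cmod (f d)" by (auto simp: U_def)
      define \<epsilon> where "\<epsilon> = min (cmod (x 0) - 9/10) (cmod (f d) - 9/10)"
      have "(y, g) \<in> U" if yg: "(y, g) \<in> num_states ell2" and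
        close: "max_dist ell2 (dual ell2) (x, f) (y, g) < \<epsilon>" for y g
      proof -
        have c: "x \<in> carr ell2" "y \<in> carr ell2" "f \<in> carr (dual ell2)" "g \<in> carr (dual ell2)"
          using xf(1) yg by (auto simp: num_states_def unit_sphere_def)
        have "cmod (x 0) - cmod (y 0) \<le> cmod ((x - y) 0)"
          using norm_triangle_ineq2[of "x 0" "y 0"] by simp
        also have "\<dots> \<le> nrm ell2 (x - y)" by (rule ell2.norm_U_le[OF ell2.carr_diff[OF c(1,2)]])
        also have "\<dots> < cmod (x 0) - 9/10"
          using close by (simp add: max_dist_def nrm_dist_def \<epsilon>_def)
        finally have "9/10 < cmod (y 0)" by simp
        moreover have "cmod (f d) - cmod (g d) \<le> cmod ((f - g) d)"
          using norm_triangle_ineq2[of "f d" "g d"] by simp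
        then have "cmod (f d) - cmod (g d) \<le> nrm (dual ell2) (f - g)"
          using ell2.dual_bound[OF nrm_ell2_nonneg ell2.dual_diff[OF nrm_ell2_nonneg c(3,4)] dc] nd
          by simp
        then have "9/10 < cmod (g d)"
          using close by (simp add: max_dist_def nrm_dist_def \<epsilon>_def)
        ultimately show ?thesis using yg by (simp add: U_def)
      qed
      moreover have "\<epsilon> > 0" using xf by (simp add: \<epsilon>_def)
      ultimately show "\<exists>\<epsilon>>0. \<forall>q\<in>num_states ell2. max_dist ell2 (dual ell2) p q < \<epsilon> \<longrightarrow> q \<in> U"
        unfolding p by (auto simp: split_paired_all)
    qed (auto simp: U_def)
    moreover have "U \<noteq> {}"
    proof -
      have "d \<in> unit_sphere ell2" using dc nd by (simp add: unit_sphere_def)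
      then obtain f where "(d, f) \<in> num_states ell2" using ell2.ex_num_state[OF ell2.norming] by blast
      then have "(d, f) \<in> U" by (simp add: U_def) (simp add: num_states_def d_def)
      then show ?thesis by blast
    qed
    moreover have "open (ball (0::complex) (1/4))" "ball (0::complex) (1/4) \<noteq> {}" by auto
    ultimately obtain n x f where xf: "(x, f) \<in> U" and near: "f ((T ^^ n) x) \<in> ball 0 (1/4)"
      using transitive unfolding topologically_numerically_transitive_def by blast
    have x: "x \<in> carr ell2" "nrm ell2 x = 1" and f: "f \<in> carr (dual ell2)" "nrm (dual ell2) f = 1"
      and x0: "9/10 < cmod (x 0)" and fd: "9/10 < cmod (f d)"
      using xf by (auto simp: U_def num_states_def unit_sphere_def)
    have lin: "linear_on_carr ell2 f" using f(1) by (simp add: dual_def)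
    define x' where "x' m = (if m = 0 then 0 else x m)" for m
    have x'c: "x' \<in> carr ell2"
      using ell2_dominated(1)[OF x(1), of "\<lambda>m. m" 1 x'] by (simp add: x'_def)
    have "nrm ell2 x' \<le> sqrt (1 - (cmod (x 0))\<^sup>2)"
    proof (rule nrm_ell2_le[OF x'c])
      fix F :: "nat set" assume F: "finite F"
      have "(\<Sum>m\<in>F. (cmod (x' m))\<^sup>2) = (\<Sum>m\<in>F - {0}. (cmod (x m))\<^sup>2)"
        using F by (intro sum.mono_neutral_cong_right) (auto simp: x'_def)
      then have "(cmod (x 0))\<^sup>2 + (\<Sum>m\<in>F. (cmod (x' m))\<^sup>2) = (\<Sum>m\<in>insert 0 F. (cmod (x m))\<^sup>2)"
        using F by (simp add: sum.insert_remove)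
      also have "\<dots> \<le> (\<Sum>\<^sub>\<infinity>m. (cmod (x m))\<^sup>2)"
        using F x(1) by (intro finite_sum_le_infsum) (auto simp: ell2_carr_iff)
      also have "\<dots> = 1" using x(2) unfolding nrm_ell2[OF x(1)] by simp
      finally show "(\<Sum>m\<in>F. (cmod (x' m))\<^sup>2) \<le> 1 - (cmod (x 0))\<^sup>2" by simp
    qed
    also have "\<dots> \<le> 1/2"
      using power_strict_mono[OF x0, of 2] by (intro real_le_lsqrt) (auto simp: power2_eq_square)
    finally have x'2: "nrm ell2 x' \<le> 1/2" .
    \<comment> \<open>The part of \<open>(T ^^ n) x\<close> off coordinate \<open>0\<close>. It
      reads entries of \<open>x\<close> at positive indices only, so it is controlled by
      \<open>x'\<close>.\<close>
    define w where "w m = (if m = 0 then 0 else 16 ^ n * x (m + n))" for m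
    have "cmod (w m) \<le> 16 ^ n * cmod (x' (m + n))" for m
      by (simp add: w_def x'_def norm_mult norm_power)
    then have w: "w \<in> carr ell2" "nrm ell2 w \<le> 16 ^ n * nrm ell2 x'"
      using ell2_dominated[OF x'c, of "\<lambda>m. m + n" "16 ^ n" w] by (simp_all add: inj_def)
    have "(T ^^ n) x = (17 ^ n * x 0) *\<^sub>C d + w"
      by (auto simp: Tn d_def w_def fun_eq_iff scaleC_fun_apply scaleC_complex_def)
    then have "f ((T ^^ n) x) = 17 ^ n * x 0 * f d + f w"
      by (simp add: linear_on_carrD(1)[OF lin ell2.carr_scaleC[OF dc] w(1)]
          linear_on_carrD(2)[OF lin dc] scaleC_complex_def)
    then have "cmod (17 ^ n * x 0 * f d) - cmod (f w) \<le> cmod (f ((T ^^ n) x))"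
      using norm_triangle_ineq2[of "17 ^ n * x 0 * f d" "- f w"] by simp
    moreover have "cmod (f w) \<le> 16 ^ n * (1/2)"
    proof -
      have "cmod (f w) \<le> nrm ell2 w"
        using ell2.dual_bound[OF nrm_ell2_nonneg f(1) w(1)] f(2) by simp
      also have "\<dots> \<le> 16 ^ n * nrm ell2 x'" by (rule w(2))
      also have "\<dots> \<le> 16 ^ n * (1/2)" by (intro mult_left_mono x'2) simp
      finally show ?thesis .
    qed
    moreover have "17 ^ n * (81/100) \<le> cmod (17 ^ n * x 0 * f d)"
    proof -
      have "9/10 * (9/10) \<le> cmod (x 0) * cmod (f d)" using x0 fd by (intro mult_mono) auto
      then show ?thesis by (simp add: norm_mult norm_power mult.assoc)
    qed
    \<comment> \<open>Together: \<open>81/100 * 17 ^ n - 1/2 * 16 ^ n \<ge> 31/100 * 17 ^ n\<close>,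
      which exceeds \<open>1/4\<close> for every \<open>n\<close>, including
      \<open>0\<close>.\<close>
    moreover have "(16::real) ^ n \<le> 17 ^ n" "1 \<le> (17::real) ^ n" by (auto intro: power_mono)
    ultimately have "1/4 < cmod (f ((T ^^ n) x))" by linarith
    with near show False by simp
  qed
  ultimately show ?thesis using T by blast
qed

theorem corollary4p14:
  fixes e :: "int \<Rightarrow> 'h::chilbert_space"
  assumes "orthonormal_basis e"
  shows "(\<exists>T\<in>bounded_ops (B2 e). strongly_numerically_hypercyclic (B2 e) T \<and>
        \<not> Cstar_transitive (B2 e) (B1 e) op_form T) \<and>
    (\<exists>T\<in>bounded_ops (B0 :: ('h \<Rightarrow> 'h) nspace). strongly_numerically_hypercyclic B0 T \<and>
        \<not> Cstar_transitive B0 B0 op_form T) \<and>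
    (\<exists>T\<in>bounded_ops (l2_module :: (nat \<Rightarrow> 'h \<Rightarrow> 'h) nspace).
        strongly_numerically_hypercyclic l2_module T \<and>
        \<not> Cstar_transitive l2_module B0 module_form T) \<and>
    (\<exists>T\<in>bounded_ops ell2. strongly_numerically_hypercyclic ell2 T \<and>
        \<not> topologically_numerically_transitive ell2 T)"
proof -
  interpret orthonormal e by (rule orthonormal.intro[OF assms])
  show ?thesis by (intro conjI B2_example B0_example l2_module_example ell2_example)
qed

end
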